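(* Let $n\geq1$, $r\geq2$ be integers and $0<q<1$. The algebra inclusion $\mathcal{A}(\mathbb{C}\mathrm{P}^n_q)\hookrightarrow\mathcal{A}(\mathrm{L}^{(n,r)}_q)$ is a quantum principal bundle with structure group $\widetilde{\mathrm{U}}(1):=\mathrm{U}(1)/\mathbb{Z}_r\simeq\mathrm{U}(1)$. In particular, $$\mathcal{A}(\mathbb{C}\mathrm{P}^n_q)=\mathcal{A}(\mathrm{L}^{(n,r)}_q)^{\widetilde{\mathrm{U}}(1)}.$$
   Context: $\mathcal{A}(\mathrm{S}^{2n+1}_q)$ is the unital complex $*$-algebra generated by $z_i,z_i^*$, $i=0,\dots,n$, with relations $z_iz_j=q^{-1}z_jz_i$ for $i<j$; $z_i^*z_j=qz_jz_i^*$ for $i\neq j$; $[z_n^*,z_n]=0$; $[z_i^*,z_i]=(1-q^2)\sum_{j=i+1}^n z_jz_j^*$ for $i=0,\dots,n-1$; $\sum_{i=0}^n z_iz_i^*=1$. $\mathcal{A}(\mathbb{C}\mathrm{P}^n_q)$ is the $*$-subalgebra generated by the elements $z_i^*z_j$; it is the invariant subalgebra for the $\mathrm{U}(1)$-action $z_i\mapsto\lambda z_i$. $\mathcal{A}(\mathrm{L}^{(n,r)}_q)=\bigoplus_{N\in\mathbb{Z}}\mathcal{L}_{rN}$, where $\mathcal{L}_N\subset\mathcal{A}(\mathrm{S}^{2n+1}_q)$ is the $\mathcal{A}(\mathbb{C}\mathrm{P}^n_q)$-bimodule of elements transforming as $\varphi\mapsto\lambda^{-N}\varphi$ under this action; equivalently,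 $\mathcal{A}(\mathrm{L}^{(n,r)}_q)$ is the subalgebra invariant under $z_i\mapsto e^{2\pi\mathrm{i}/r}z_i$. A noncommutative (quantum) principal bundle is a triple $(\mathcal{A},H,\mathcal{F})$ where $H$ is a Hopf $*$-algebra (functions on the structure group), $\mathcal{A}$ is a right $H$-comodule $*$-algebra with coaction $\Delta_R:\mathcal{A}\to\mathcal{A}\otimes H$, $\mathcal{F}=\{a\in\mathcal{A}:\Delta_R(a)=a\otimes1\}$, such that the sequence $0\to\mathcal{A}(\Omega^1_{un}(\mathcal{F}))\mathcal{A}\to\Omega^1_{un}(\mathcal{A})\xrightarrow{\mathrm{ver}}\mathcal{A}\otimes\ker\epsilon_H\to0$ is exact, where $\Omega^1_{un}$ denotes universal one-forms, $\epsilon_H$ is the counit, the first map is inclusion and $\mathrm{ver}(a\otimes b)=(a\otimes1)\Delta_R(b)$. When $H$ is cosemisimple with invertible antipode this is equivalent to the canonical map $\mathcal{A}\otimes_{\mathcal{F}}\mathcal{A}\to\mathcal{A}\otimes H$, $a\otimes b\mapsto(a\otimes1)\Delta_R(b)$, being an isomorphism (Hopf–Galois extension). Here $\mathcal{A}=\mathcal{A}(\mathrm{L}^{(n,r)}_q)$, $\mathcal{F}=\mathcal{A}(\mathbb{C}\mathrm{P}^n_q)$, and $H=\mathcal{A}(\widetilde{\mathrm{U}}(1))=\mathcal{A}(\mathrm{U}(1))^{\mathbb{Z}_r}$ is the Hopf $*$-subalgebra of $\mathcal{A}(\mathrm{U}(1))=\mathbb{C}[\xi,\xi^*]/\langle\xi^*\xi-1\rangle$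 (with $\xi$ group-like) generated by $\xi^r$ and $\xi^{*r}$; the coaction is the restriction to $\mathcal{A}(\mathrm{L}^{(n,r)}_q)$ of the $*$-algebra map determined by $z_i\mapsto z_i\otimes\xi$, i.e. the one dual to the action of $\widetilde{\mathrm{U}}(1)$ induced by $z_i\mapsto\lambda z_i$. *)

theory Defs
  imports Complex_Main "HOL-Algebra.Algebra" "HOL-Library.Poly_Mapping"
begin

section \<open>Complex star-algebras\<close>

record 'a star_algebra = "(complex, 'a) module" +
  star :: "'a \<Rightarrow> 'a"

definition complex_alg :: "complex star_algebra" where
  "complex_alg = \<lparr>carrier = UNIV, monoid.mult = (*), one = 1, ring.zero = 0, add = (+),
     smult = (*), star = cnj\<rparr>"

definition is_star_algebra :: "('a, 'x) star_algebra_scheme \<Rightarrow> bool" where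
  "is_star_algebra A \<longleftrightarrow>
     ring A \<and> Module.module complex_alg A \<and>
     (\<forall>c. \<forall>x \<in> carrier A. \<forall>y \<in> carrier A.
        (c \<odot>\<^bsub>A\<^esub> x) \<otimes>\<^bsub>A\<^esub> y = c \<odot>\<^bsub>A\<^esub> (x \<otimes>\<^bsub>A\<^esub> y) \<and>
        x \<otimes>\<^bsub>A\<^esub> (c \<odot>\<^bsub>A\<^esub> y) = c \<odot>\<^bsub>A\<^esub> (x \<otimes>\<^bsub>A\<^esub> y)) \<and>
     star A \<in> carrier A \<rightarrow> carrier A \<and>
     (\<forall>x \<in> carrier A. star A (star A x) = x) \<and>
     (\<forall>x \<in> carrier A. \<forall>y \<in> carrier A. star A (x \<oplus>\<^bsub>A\<^esub> y) = star A x \<oplus>\<^bsub>A\<^esub> star A y) \<and>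
     (\<forall>x \<in> carrier A. \<forall>y \<in> carrier A. star A (x \<otimes>\<^bsub>A\<^esub> y) = star A y \<otimes>\<^bsub>A\<^esub> star A x) \<and>
     (\<forall>c. \<forall>x \<in> carrier A. star A (c \<odot>\<^bsub>A\<^esub> x) = cnj c \<odot>\<^bsub>A\<^esub> star A x)"

definition linear_maps ::
    "('a, 'x) star_algebra_scheme \<Rightarrow> ('b, 'y) star_algebra_scheme \<Rightarrow> ('a \<Rightarrow> 'b) set" where
  "linear_maps A B = {f \<in> carrier A \<rightarrow> carrier B.
     (\<forall>x \<in> carrier A. \<forall>y \<in> carrier A. f (x \<oplus>\<^bsub>A\<^esub> y) = f x \<oplus>\<^bsub>B\<^esub> f y) \<and>
     (\<forall>c. \<forall>x \<in> carrier A. f (c \<odot>\<^bsub>A\<^esub> x) = c \<odot>\<^bsub>B\<^esub> f x)}"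

definition star_alg_hom ::
    "('a, 'x) star_algebra_scheme \<Rightarrow> ('b, 'y) star_algebra_scheme \<Rightarrow> ('a \<Rightarrow> 'b) set" where
  "star_alg_hom A B = {f \<in> ring_hom A B \<inter> linear_maps A B.
     \<forall>x \<in> carrier A. f (star A x) = star B (f x)}"

definition lin_span :: "('a, 'x) star_algebra_scheme \<Rightarrow> 'a set \<Rightarrow> 'a set" where
  "lin_span A S = \<Inter> {V. submodule V complex_alg A \<and> S \<subseteq> V}"

definition star_subalgebra :: "'a set \<Rightarrow> ('a, 'x) star_algebra_scheme \<Rightarrow> bool" where
  "star_subalgebra B A \<longleftrightarrow> subring B A \<and> submodule B complex_alg A \<and> star A ` B \<subseteq> B"

definition gen_star_subalgebra :: "('a, 'x) star_algebra_scheme \<Rightarrow> 'a set \<Rightarrow> 'a set" where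
  "gen_star_subalgebra A S = \<Inter> {B. star_subalgebra B A \<and> S \<subseteq> B}"

text \<open>The quotient of a star-algebra by a star-stable two-sided ideal; the vector-space part only
  needs \<open>I\<close> to be a subspace.\<close>

definition star_quot :: "('a, 'x) star_algebra_scheme \<Rightarrow> 'a set \<Rightarrow> 'a set star_algebra" where
  "star_quot A I = \<lparr>carrier = a_rcosets\<^bsub>A\<^esub> I, monoid.mult = rcoset_mult A I,
     one = I +>\<^bsub>A\<^esub> \<one>\<^bsub>A\<^esub>, ring.zero = I, add = set_add A,
     smult = (\<lambda>c C. \<Union>x \<in> C. I +>\<^bsub>A\<^esub> (c \<odot>\<^bsub>A\<^esub> x)),
     star = (\<lambda>C. star A ` C)\<rparr>"

text \<open>The monoid algebra over the complex numbers of a monoid \<open>G\<close> with an involution \<open>s\<close>: finitely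
  supported functions on \<open>carrier G\<close> with convolution product, and \<open>s\<close> extended antilinearly.
  It serves both for free algebras and for free vector spaces on products.\<close>

definition monoid_alg ::
    "('a, 'x) monoid_scheme \<Rightarrow> ('a \<Rightarrow> 'a) \<Rightarrow> ('a \<Rightarrow>\<^sub>0 complex) star_algebra" where
  "monoid_alg G s = \<lparr>carrier = {p. Poly_Mapping.keys p \<subseteq> carrier G},
     monoid.mult = (\<lambda>p p'. \<Sum>u \<in> Poly_Mapping.keys p. \<Sum>v \<in> Poly_Mapping.keys p'.
        Poly_Mapping.single (u \<otimes>\<^bsub>G\<^esub> v) (Poly_Mapping.lookup p u * Poly_Mapping.lookup p' v)),
     one = Poly_Mapping.single \<one>\<^bsub>G\<^esub> 1, ring.zero = 0, add = (+),
     smult = (\<lambda>c. Poly_Mapping.map ((*) c)),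
     star = (\<lambda>p. \<Sum>u \<in> Poly_Mapping.keys p.
        Poly_Mapping.single (s u) (cnj (Poly_Mapping.lookup p u)))\<rparr>"


section \<open>Tensor products over the complex numbers\<close>

definition free_pairs ::
    "('a, 'x) star_algebra_scheme \<Rightarrow> ('b, 'y) star_algebra_scheme \<Rightarrow> (('a \<times> 'b) \<Rightarrow>\<^sub>0 complex) star_algebra"
  where "free_pairs A B = monoid_alg (A \<times>\<times> B) (map_prod (star A) (star B))"

definition bilinear_relations ::
    "('a, 'x) star_algebra_scheme \<Rightarrow> ('b, 'y) star_algebra_scheme \<Rightarrow> (('a \<times> 'b) \<Rightarrow>\<^sub>0 complex) set"
  where
  "bilinear_relations A B =
     {Poly_Mapping.single (x \<oplus>\<^bsub>A\<^esub> y, b) 1 - Poly_Mapping.single (x, b) 1 - Poly_Mapping.single (y, b) 1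
        | x y b. x \<in> carrier A \<and> y \<in> carrier A \<and> b \<in> carrier B} \<union>
     {Poly_Mapping.single (a, x \<oplus>\<^bsub>B\<^esub> y) 1 - Poly_Mapping.single (a, x) 1 - Poly_Mapping.single (a, y) 1
        | a x y. a \<in> carrier A \<and> x \<in> carrier B \<and> y \<in> carrier B} \<union>
     {Poly_Mapping.single (c \<odot>\<^bsub>A\<^esub> a, b) 1 - Poly_Mapping.single (a, b) c
        | c a b. a \<in> carrier A \<and> b \<in> carrier B} \<union>
     {Poly_Mapping.single (a, c \<odot>\<^bsub>B\<^esub> b) 1 - Poly_Mapping.single (a, b) c
        | c a b. a \<in> carrier A \<and> b \<in> carrier B}"

definition tensor_null ::
    "('a, 'x) star_algebra_scheme \<Rightarrow> ('b, 'y) star_algebra_scheme \<Rightarrow> (('a \<times> 'b) \<Rightarrow>\<^sub>0 complex) set"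
  where "tensor_null A B = lin_span (free_pairs A B) (bilinear_relations A B)"

text \<open>The star-algebra structure is the usual one: \<open>(a \<otimes> b)(a' \<otimes> b') = aa' \<otimes> bb'\<close> and
  \<open>(a \<otimes> b)* = a* \<otimes> b*\<close>.\<close>

definition tensor ::
    "('a, 'x) star_algebra_scheme \<Rightarrow> ('b, 'y) star_algebra_scheme \<Rightarrow>
     (('a \<times> 'b) \<Rightarrow>\<^sub>0 complex) set star_algebra"
  where "tensor A B = star_quot (free_pairs A B) (tensor_null A B)"

definition tens ::
    "('a, 'x) star_algebra_scheme \<Rightarrow> ('b, 'y) star_algebra_scheme \<Rightarrow> 'a \<Rightarrow> 'b \<Rightarrow>
     (('a \<times> 'b) \<Rightarrow>\<^sub>0 complex) set"
  where "tens A B a b = tensor_null A B +>\<^bsub>free_pairs A B\<^esub> Poly_Mapping.single (a, b) 1"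

text \<open>The linear map on \<open>A \<otimes> B\<close> determined by a bilinear map \<open>\<phi>\<close>.\<close>

definition tensor_lift ::
    "('a, 'x) star_algebra_scheme \<Rightarrow> ('b, 'y) star_algebra_scheme \<Rightarrow> ('c, 'z) star_algebra_scheme \<Rightarrow>
     ('a \<Rightarrow> 'b \<Rightarrow> 'c) \<Rightarrow> (('a \<times> 'b) \<Rightarrow>\<^sub>0 complex) set \<Rightarrow> 'c"
  where
  "tensor_lift A B M \<phi> = (THE g. g \<in> extensional (carrier (tensor A B)) \<and>
     g \<in> linear_maps (tensor A B) M \<and>
     (\<forall>a \<in> carrier A. \<forall>b \<in> carrier B. g (tens A B a b) = \<phi> a b))"

definition tensor_map ::
    "('a, 'x) star_algebra_scheme \<Rightarrow> ('b, 'y) star_algebra_scheme \<Rightarrow>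
     ('c, 'z) star_algebra_scheme \<Rightarrow> ('d, 'w) star_algebra_scheme \<Rightarrow>
     ('a \<Rightarrow> 'c) \<Rightarrow> ('b \<Rightarrow> 'd) \<Rightarrow> (('a \<times> 'b) \<Rightarrow>\<^sub>0 complex) set \<Rightarrow> (('c \<times> 'd) \<Rightarrow>\<^sub>0 complex) set"
  where
  "tensor_map A B A' B' f g =
     tensor_lift A B (tensor A' B') (\<lambda>a b. tens A' B' (f a) (g b))"

definition tensor_assoc ::
    "('a, 'x) star_algebra_scheme \<Rightarrow> ('b, 'y) star_algebra_scheme \<Rightarrow> ('c, 'z) star_algebra_scheme \<Rightarrow>
     (((('a \<times> 'b) \<Rightarrow>\<^sub>0 complex) set \<times> 'c) \<Rightarrow>\<^sub>0 complex) set \<Rightarrow>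
     (('a \<times> (('b \<times> 'c) \<Rightarrow>\<^sub>0 complex) set) \<Rightarrow>\<^sub>0 complex) set"
  where
  "tensor_assoc A B C =
     tensor_lift (tensor A B) C (tensor A (tensor B C))
       (\<lambda>x c. tensor_lift A B (tensor A (tensor B C))
                (\<lambda>a b. tens A (tensor B C) a (tens B C b c)) x)"

definition mult_map ::
    "('a, 'x) star_algebra_scheme \<Rightarrow> (('a \<times> 'a) \<Rightarrow>\<^sub>0 complex) set \<Rightarrow> 'a"
  where "mult_map A = tensor_lift A A A (\<lambda>a b. a \<otimes>\<^bsub>A\<^esub> b)"

text \<open>For subspaces \<open>A \<subseteq> A'\<close> and \<open>B \<subseteq> B'\<close>, the type-level elements of \<open>A \<otimes> B\<close> (cosets of smaller
  free spaces) are not elements of \<open>A' \<otimes> B'\<close>; the identification is made along the canonical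
  embedding. The second function regards a map with values in \<open>A' \<otimes> B'\<close> as a map into
  \<open>A \<otimes> B\<close>.\<close>

definition tensor_incl ::
    "('a, 'x) star_algebra_scheme \<Rightarrow> ('b, 'y) star_algebra_scheme \<Rightarrow>
     ('a, 'z) star_algebra_scheme \<Rightarrow> ('b, 'w) star_algebra_scheme \<Rightarrow>
     (('a \<times> 'b) \<Rightarrow>\<^sub>0 complex) set \<Rightarrow> (('a \<times> 'b) \<Rightarrow>\<^sub>0 complex) set"
  where "tensor_incl A B A' B' = tensor_map A B A' B' (\<lambda>a. a) (\<lambda>b. b)"

definition corestrict_tensor ::
    "('a, 'x) star_algebra_scheme \<Rightarrow> ('b, 'y) star_algebra_scheme \<Rightarrow>
     ('a, 'z) star_algebra_scheme \<Rightarrow> ('b, 'w) star_algebra_scheme \<Rightarrow>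
     ('c \<Rightarrow> (('a \<times> 'b) \<Rightarrow>\<^sub>0 complex) set) \<Rightarrow> 'c \<Rightarrow> (('a \<times> 'b) \<Rightarrow>\<^sub>0 complex) set"
  where
  "corestrict_tensor A B A' B' f x =
     (THE y. y \<in> carrier (tensor A B) \<and> tensor_incl A B A' B' y = f x)"


section \<open>Hopf star-algebras and quantum principal bundles\<close>

record 'h hopf_algebra = "'h star_algebra" +
  comult :: "'h \<Rightarrow> (('h \<times> 'h) \<Rightarrow>\<^sub>0 complex) set"
  counit :: "'h \<Rightarrow> complex"
  antipode :: "'h \<Rightarrow> 'h"

definition hopf_star_algebra :: "('h, 'x) hopf_algebra_scheme \<Rightarrow> bool" where
  "hopf_star_algebra H \<longleftrightarrow>
     is_star_algebra H \<and>
     comult H \<in> star_alg_hom H (tensor H H) \<and>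
     counit H \<in> star_alg_hom H complex_alg \<and>
     antipode H \<in> linear_maps H H \<and>
     (\<forall>h \<in> carrier H.
        tensor_assoc H H H (tensor_map H H (tensor H H) H (comult H) (\<lambda>x. x) (comult H h)) =
        tensor_map H H H (tensor H H) (\<lambda>x. x) (comult H) (comult H h)) \<and>
     (\<forall>h \<in> carrier H. tensor_lift H H H (\<lambda>x y. counit H x \<odot>\<^bsub>H\<^esub> y) (comult H h) = h) \<and>
     (\<forall>h \<in> carrier H. tensor_lift H H H (\<lambda>x y. counit H y \<odot>\<^bsub>H\<^esub> x) (comult H h) = h) \<and>
     (\<forall>h \<in> carrier H.
        tensor_lift H H H (\<lambda>x y. antipode H x \<otimes>\<^bsub>H\<^esub> y) (comult H h) = counit H h \<odot>\<^bsub>H\<^esub> \<one>\<^bsub>H\<^esub>) \<and>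
     (\<forall>h \<in> carrier H.
        tensor_lift H H H (\<lambda>x y. x \<otimes>\<^bsub>H\<^esub> antipode H y) (comult H h) = counit H h \<odot>\<^bsub>H\<^esub> \<one>\<^bsub>H\<^esub>)"

definition hopf_star_iso ::
    "('h, 'x) hopf_algebra_scheme \<Rightarrow> ('k, 'y) hopf_algebra_scheme \<Rightarrow> ('h \<Rightarrow> 'k) set" where
  "hopf_star_iso H K = {f \<in> star_alg_hom H K.
     bij_betw f (carrier H) (carrier K) \<and>
     (\<forall>h \<in> carrier H. comult K (f h) = tensor_map H H K K f f (comult H h)) \<and>
     (\<forall>h \<in> carrier H. counit K (f h) = counit H h) \<and>
     (\<forall>h \<in> carrier H. antipode K (f h) = f (antipode H h))}"

definition comodule_star_algebra ::
    "('a, 'x) star_algebra_scheme \<Rightarrow> ('h, 'y) hopf_algebra_scheme \<Rightarrow>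
     ('a \<Rightarrow> (('a \<times> 'h) \<Rightarrow>\<^sub>0 complex) set) \<Rightarrow> bool" where
  "comodule_star_algebra A H \<delta> \<longleftrightarrow>
     is_star_algebra A \<and>
     \<delta> \<in> star_alg_hom A (tensor A H) \<and>
     (\<forall>a \<in> carrier A.
        tensor_assoc A H H (tensor_map A H (tensor A H) H \<delta> (\<lambda>x. x) (\<delta> a)) =
        tensor_map A H A (tensor H H) (\<lambda>x. x) (comult H) (\<delta> a)) \<and>
     (\<forall>a \<in> carrier A. tensor_lift A H A (\<lambda>x h. counit H h \<odot>\<^bsub>A\<^esub> x) (\<delta> a) = a)"

definition coinvariants ::
    "('a, 'x) star_algebra_scheme \<Rightarrow> ('h, 'y) hopf_algebra_scheme \<Rightarrow>
     ('a \<Rightarrow> (('a \<times> 'h) \<Rightarrow>\<^sub>0 complex) set) \<Rightarrow> 'a set" where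
  "coinvariants A H \<delta> = {a \<in> carrier A. \<delta> a = tens A H a \<one>\<^bsub>H\<^esub>}"

definition universal_forms ::
    "('a, 'x) star_algebra_scheme \<Rightarrow> (('a \<times> 'a) \<Rightarrow>\<^sub>0 complex) set set" where
  "universal_forms A = a_kernel (tensor A A) A (mult_map A)"

text \<open>The subspace \<open>A \<Omega>(F) A\<close> of \<open>\<Omega>(A)\<close>. The bimodule structure \<open>a (x \<otimes> y) b = ax \<otimes> yb\<close> of
  \<open>A \<otimes> A\<close> is written as the product \<open>(a \<otimes> 1)(x \<otimes> y)(1 \<otimes> b)\<close> in the tensor product algebra.\<close>

definition horizontal_forms ::
    "('a, 'x) star_algebra_scheme \<Rightarrow> 'a set \<Rightarrow> (('a \<times> 'a) \<Rightarrow>\<^sub>0 complex) set set" where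
  "horizontal_forms A F = lin_span (tensor A A)
     {tens A A a \<one>\<^bsub>A\<^esub> \<otimes>\<^bsub>tensor A A\<^esub>
        tensor_incl (A\<lparr>carrier := F\<rparr>) (A\<lparr>carrier := F\<rparr>) A A \<omega> \<otimes>\<^bsub>tensor A A\<^esub> tens A A \<one>\<^bsub>A\<^esub> b
      | a \<omega> b. a \<in> carrier A \<and> \<omega> \<in> universal_forms (A\<lparr>carrier := F\<rparr>) \<and> b \<in> carrier A}"

definition ver ::
    "('a, 'x) star_algebra_scheme \<Rightarrow> ('h, 'y) hopf_algebra_scheme \<Rightarrow>
     ('a \<Rightarrow> (('a \<times> 'h) \<Rightarrow>\<^sub>0 complex) set) \<Rightarrow>
     (('a \<times> 'a) \<Rightarrow>\<^sub>0 complex) set \<Rightarrow> (('a \<times> 'h) \<Rightarrow>\<^sub>0 complex) set" where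
  "ver A H \<delta> =
     tensor_lift A A (tensor A H) (\<lambda>a b. tens A H a \<one>\<^bsub>H\<^esub> \<otimes>\<^bsub>tensor A H\<^esub> \<delta> b)"

text \<open>The space \<open>A \<otimes> ker \<epsilon>\<close>, as a subspace of \<open>A \<otimes> H\<close>.\<close>

definition tensor_augmentation ::
    "('a, 'x) star_algebra_scheme \<Rightarrow> ('h, 'y) hopf_algebra_scheme \<Rightarrow>
     (('a \<times> 'h) \<Rightarrow>\<^sub>0 complex) set set" where
  "tensor_augmentation A H = lin_span (tensor A H)
     {tens A H a k | a k. a \<in> carrier A \<and> k \<in> carrier H \<and> counit H k = 0}"

text \<open>Exactness of \<open>0 \<rightarrow> V \<rightarrow> W \<rightarrow> Z \<rightarrow> 0\<close>; unlike \<^const>\<open>short_exact_sequence\<close>, the three spaces may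
  have elements of different types.\<close>

definition short_exact ::
    "('a, 'x) star_algebra_scheme \<Rightarrow> ('b, 'y) star_algebra_scheme \<Rightarrow> ('c, 'z) star_algebra_scheme \<Rightarrow>
     ('a \<Rightarrow> 'b) \<Rightarrow> ('b \<Rightarrow> 'c) \<Rightarrow> bool" where
  "short_exact V W Z f g \<longleftrightarrow>
     Module.module complex_alg V \<and> Module.module complex_alg W \<and> Module.module complex_alg Z \<and>
     f \<in> linear_maps V W \<and> g \<in> linear_maps W Z \<and>
     inj_on f (carrier V) \<and> f ` carrier V = a_kernel W Z g \<and> g ` carrier W = carrier Z"

definition quantum_principal_bundle ::
    "('a, 'x) star_algebra_scheme \<Rightarrow> ('h, 'y) hopf_algebra_scheme \<Rightarrow>
     ('a \<Rightarrow> (('a \<times> 'h) \<Rightarrow>\<^sub>0 complex) set) \<Rightarrow> 'a set \<Rightarrow> bool" where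
  "quantum_principal_bundle A H \<delta> F \<longleftrightarrow>
     hopf_star_algebra H \<and>
     comodule_star_algebra A H \<delta> \<and>
     F = coinvariants A H \<delta> \<and>
     short_exact
       ((tensor A A)\<lparr>carrier := horizontal_forms A F\<rparr>)
       ((tensor A A)\<lparr>carrier := universal_forms A\<rparr>)
       ((tensor A H)\<lparr>carrier := tensor_augmentation A H\<rparr>)
       (\<lambda>\<omega>. \<omega>) (ver A H \<delta>)"


section \<open>Star-algebras given by generators and relations\<close>

text \<open>Words in letters \<open>(i, False)\<close>, standing for the generator with index \<open>i\<close>, and \<open>(i, True)\<close>,
  standing for its adjoint.\<close>

definition free_star_alg :: "'i set \<Rightarrow> (('i \<times> bool) list \<Rightarrow>\<^sub>0 complex) star_algebra" where
  "free_star_alg N =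
     monoid_alg \<lparr>carrier = lists (N \<times> UNIV), monoid.mult = (@), one = []\<rparr>
       (\<lambda>w. rev (map (\<lambda>(i, b). (i, \<not> b)) w))"

definition free_gen :: "'i \<Rightarrow> ('i \<times> bool) list \<Rightarrow>\<^sub>0 complex" where
  "free_gen i = Poly_Mapping.single [(i, False)] 1"

definition star_ideal ::
    "'i set \<Rightarrow> (('i \<times> bool) list \<Rightarrow>\<^sub>0 complex) set \<Rightarrow> (('i \<times> bool) list \<Rightarrow>\<^sub>0 complex) set" where
  "star_ideal N R = Idl\<^bsub>free_star_alg N\<^esub> (R \<union> star (free_star_alg N) ` R)"

definition presented_alg ::
    "'i set \<Rightarrow> (('i \<times> bool) list \<Rightarrow>\<^sub>0 complex) set \<Rightarrow> (('i \<times> bool) list \<Rightarrow>\<^sub>0 complex) set star_algebra"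
  where "presented_alg N R = star_quot (free_star_alg N) (star_ideal N R)"

definition presented_gen ::
    "'i set \<Rightarrow> (('i \<times> bool) list \<Rightarrow>\<^sub>0 complex) set \<Rightarrow> 'i \<Rightarrow> (('i \<times> bool) list \<Rightarrow>\<^sub>0 complex) set"
  where "presented_gen N R i = star_ideal N R +>\<^bsub>free_star_alg N\<^esub> free_gen i"

text \<open>The star-algebra map into \<open>B\<close> determined by sending the generator \<open>i\<close> to \<open>b i\<close>.\<close>

definition presented_hom ::
    "'i set \<Rightarrow> (('i \<times> bool) list \<Rightarrow>\<^sub>0 complex) set \<Rightarrow> ('b, 'y) star_algebra_scheme \<Rightarrow>
     ('i \<Rightarrow> 'b) \<Rightarrow> (('i \<times> bool) list \<Rightarrow>\<^sub>0 complex) set \<Rightarrow> 'b" where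
  "presented_hom N R B b = (THE f. f \<in> extensional (carrier (presented_alg N R)) \<and>
     f \<in> star_alg_hom (presented_alg N R) B \<and> (\<forall>i \<in> N. f (presented_gen N R i) = b i))"

type_synonym word_class = "((nat \<times> bool) list \<Rightarrow>\<^sub>0 complex) set"


section \<open>The Hopf algebras of U(1) and of its quotient\<close>

text \<open>The commutative algebra \<open>\<complex>[\<xi>, \<xi>*]\<close> modulo \<open>\<xi>*\<xi> - 1\<close>: as the ambient free algebra is
  noncommutative, commutativity of the generators is one of the relations.\<close>

definition circle_relations :: "((nat \<times> bool) list \<Rightarrow>\<^sub>0 complex) set" where
  "circle_relations =
     (let F = free_star_alg {0}; \<xi> = free_gen 0; \<xi>s = star F \<xi>
      in {\<xi> \<otimes>\<^bsub>F\<^esub> \<xi>s - \<xi>s \<otimes>\<^bsub>F\<^esub> \<xi>, \<xi>s \<otimes>\<^bsub>F\<^esub> \<xi> - \<one>\<^bsub>F\<^esub>})"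

definition circle_alg :: "word_class star_algebra" where
  "circle_alg = presented_alg {0} circle_relations"

definition xi :: word_class where
  "xi = presented_gen {0} circle_relations 0"

text \<open>Here \<open>\<xi>\<close> is group-like. The antipode is an algebra map (not just an anti-homomorphism)
  because the algebra is commutative.\<close>

definition circle_hopf :: "word_class hopf_algebra" where
  "circle_hopf = star_algebra.extend circle_alg (hopf_algebra.fields
     (presented_hom {0} circle_relations (tensor circle_alg circle_alg)
        (\<lambda>_. tens circle_alg circle_alg xi xi))
     (presented_hom {0} circle_relations complex_alg (\<lambda>_. 1))
     (presented_hom {0} circle_relations circle_alg (\<lambda>_. star circle_alg xi)))"

definition sub_hopf :: "'h hopf_algebra \<Rightarrow> 'h set \<Rightarrow> 'h hopf_algebra" where
  "sub_hopf H K = H\<lparr>carrier := K,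
     comult := corestrict_tensor (H\<lparr>carrier := K\<rparr>) (H\<lparr>carrier := K\<rparr>) H H (comult H)\<rparr>"

definition quotient_circle_hopf :: "nat \<Rightarrow> word_class hopf_algebra" where
  "quotient_circle_hopf r = sub_hopf circle_hopf
     (gen_star_subalgebra circle_alg
        {xi [^]\<^bsub>circle_alg\<^esub> r, star circle_alg xi [^]\<^bsub>circle_alg\<^esub> r})"

definition circle_group :: "complex monoid" where
  "circle_group = \<lparr>carrier = {l. cmod l = 1}, monoid.mult = (*), one = 1\<rparr>"

definition roots_of_unity :: "nat \<Rightarrow> complex set" where
  "roots_of_unity r = {l. cmod l = 1 \<and> l ^ r = 1}"

definition quotient_circle_group :: "nat \<Rightarrow> complex set monoid" where
  "quotient_circle_group r = circle_group Mod roots_of_unity r"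


section \<open>Quantum spheres, projective spaces and lens spaces\<close>

definition sphere_relations :: "nat \<Rightarrow> real \<Rightarrow> ((nat \<times> bool) list \<Rightarrow>\<^sub>0 complex) set" where
  "sphere_relations n q =
     (let F = free_star_alg {..n}; z = free_gen; zs = (\<lambda>i. star F (z i))
      in {z i \<otimes>\<^bsub>F\<^esub> z j - complex_of_real (inverse q) \<odot>\<^bsub>F\<^esub> (z j \<otimes>\<^bsub>F\<^esub> z i)
            | i j. i < j \<and> j \<le> n} \<union>
         {zs i \<otimes>\<^bsub>F\<^esub> z j - complex_of_real q \<odot>\<^bsub>F\<^esub> (z j \<otimes>\<^bsub>F\<^esub> zs i)
            | i j. i \<le> n \<and> j \<le> n \<and> i \<noteq> j} \<union>
         {zs n \<otimes>\<^bsub>F\<^esub> z n - z n \<otimes>\<^bsub>F\<^esub> zs n} \<union>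
         {(zs i \<otimes>\<^bsub>F\<^esub> z i - z i \<otimes>\<^bsub>F\<^esub> zs i)
            - complex_of_real (1 - q\<^sup>2) \<odot>\<^bsub>F\<^esub> (\<Sum>j = i + 1..n. z j \<otimes>\<^bsub>F\<^esub> zs j) | i. i < n} \<union>
         {(\<Sum>i = 0..n. z i \<otimes>\<^bsub>F\<^esub> zs i) - \<one>\<^bsub>F\<^esub>})"

definition sphere_alg :: "nat \<Rightarrow> real \<Rightarrow> word_class star_algebra" where
  "sphere_alg n q = presented_alg {..n} (sphere_relations n q)"

definition sphere_gen :: "nat \<Rightarrow> real \<Rightarrow> nat \<Rightarrow> word_class" where
  "sphere_gen n q i = presented_gen {..n} (sphere_relations n q) i"

definition projective_alg :: "nat \<Rightarrow> real \<Rightarrow> word_class star_algebra" where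
  "projective_alg n q = (sphere_alg n q)\<lparr>carrier := gen_star_subalgebra (sphere_alg n q)
     {star (sphere_alg n q) (sphere_gen n q i) \<otimes>\<^bsub>sphere_alg n q\<^esub> sphere_gen n q j
        | i j. i \<le> n \<and> j \<le> n}\<rparr>"

definition circle_action :: "nat \<Rightarrow> real \<Rightarrow> complex \<Rightarrow> word_class \<Rightarrow> word_class" where
  "circle_action n q l = presented_hom {..n} (sphere_relations n q) (sphere_alg n q)
     (\<lambda>i. l \<odot>\<^bsub>sphere_alg n q\<^esub> sphere_gen n q i)"

definition line_bundle :: "nat \<Rightarrow> real \<Rightarrow> int \<Rightarrow> word_class set" where
  "line_bundle n q N = {\<phi> \<in> carrier (sphere_alg n q).
     \<forall>l \<in> carrier circle_group. circle_action n q l \<phi> = l powi (- N) \<odot>\<^bsub>sphere_alg n q\<^esub> \<phi>}"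

text \<open>The direct sum of the spaces \<open>L\<^sub>r\<^sub>N\<close>, taken inside the algebra of the sphere: finite sums of
  elements of the summands.\<close>

definition lens_alg :: "nat \<Rightarrow> nat \<Rightarrow> real \<Rightarrow> word_class star_algebra" where
  "lens_alg n r q = (sphere_alg n q)\<lparr>carrier :=
     {finsum (sphere_alg n q) \<phi> I | I \<phi>.
        finite I \<and> (\<forall>N \<in> I. \<phi> N \<in> line_bundle n q (int r * N))}\<rparr>"

definition sphere_coaction ::
    "nat \<Rightarrow> real \<Rightarrow> word_class \<Rightarrow> ((word_class \<times> word_class) \<Rightarrow>\<^sub>0 complex) set" where
  "sphere_coaction n q = presented_hom {..n} (sphere_relations n q)
     (tensor (sphere_alg n q) circle_hopf)
     (\<lambda>i. tens (sphere_alg n q) circle_hopf (sphere_gen n q i) xi)"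

definition lens_coaction ::
    "nat \<Rightarrow> nat \<Rightarrow> real \<Rightarrow> word_class \<Rightarrow> ((word_class \<times> word_class) \<Rightarrow>\<^sub>0 complex) set" where
  "lens_coaction n r q =
     corestrict_tensor (lens_alg n r q) (quotient_circle_hopf r) (sphere_alg n q) circle_hopf
       (sphere_coaction n q)"

text \<open>The class \<open>g\<close> of \<open>l\<close> in the quotient group acts through any of its representatives \<open>l \<in> g\<close>.\<close>

definition lens_invariants :: "nat \<Rightarrow> nat \<Rightarrow> real \<Rightarrow> word_class set" where
  "lens_invariants n r q = {a \<in> carrier (lens_alg n r q).
     \<forall>g \<in> carrier (quotient_circle_group r). \<forall>l \<in> g. circle_action n q l a = a}"

end

theory Submission
  imports Defs
begin

text \<open>The coaction grades the lens algebra \<open>A\<close> by the integers, and the Hopf algebra \<open>H\<close> is spanned by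
  the group-like elements \<open>g k = \<xi>\<^bsup>rk\<^esup>\<close>, so that an element \<open>a\<close> of degree \<open>k\<close> is mapped to \<open>a \<otimes> g k\<close>. The
  sphere relations give \<open>1\<close> both as a combination of the \<open>z\<^sub>i* z\<^sub>i\<close> and of the \<open>z\<^sub>i z\<^sub>i*\<close>; inserting such
  expressions into one another shows \<open>1 \<in> A\<^sub>-\<^sub>k A\<^sub>k\<close> for every \<open>k\<close>. A choice of \<open>\<tau>\<^sub>k = \<Sum> a\<^sub>i \<otimes> b\<^sub>i\<close> with
  \<open>a\<^sub>i \<in> A\<^sub>-\<^sub>k\<close>, \<open>b\<^sub>i \<in> A\<^sub>k\<close> and \<open>\<Sum> a\<^sub>i b\<^sub>i = 1\<close> defines a linear right inverse \<open>x \<otimes> g k \<mapsto> x \<tau>\<^sub>k\<close> of the vertical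
  map, and \<open>\<omega>\<close> differs from the image of \<open>ver \<omega>\<close> under it by an element of \<open>A \<Omega>(F) A\<close>. This gives
  exactness. All identities between linear maps on the tensor products are checked on homogeneous
  simple tensors.\<close>

section \<open>Linear algebra over the complex numbers\<close>

text \<open>Two obstacles shape the proof. The sphere algebra is given by generators and relations,
  and no basis of it is constructed. Independence of the homogeneous components comes from the
  coaction instead: pairing its second leg with a functional on the circle algebra projects onto
  chosen degrees (\<open>sproj\<close>), and the powers of \<open>\<xi>\<close> are separated by a
  homomorphism to the Laurent polynomials (\<open>int_alg\<close>). The coaction in turn exists
  because all relations are homogeneous (\<open>presented_hom_graded\<close>), so that no relation
  has to be recomputed in the target. Secondly, \<open>tensor\<close> consists of cosets, so that a
  tensor product of subalgebras is not a subset of the large one; linear retractions onto the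
  subalgebras make the inclusion injective and the corestricted coaction linear.

  The algebra generated by the \<open>z\<^sub>i* z\<^sub>j\<close> visibly lies in degree zero. That
  it is all of degree zero is shown on words: a word of degree zero splits into shorter ones, or it
  is a shorter one enclosed between letters of opposite sign, and such enclosures do not leave the
  subalgebra.\<close>

abbreviation vec :: "('a, 'x) star_algebra_scheme \<Rightarrow> bool" where
  "vec M \<equiv> Module.module complex_alg M"

abbreviation lin_subspace :: "'a set \<Rightarrow> ('a, 'x) star_algebra_scheme \<Rightarrow> bool" where
  "lin_subspace W M \<equiv> submodule W complex_alg M"

lemma complex_alg_simps [simp]:
  "carrier complex_alg = UNIV" "x \<otimes>\<^bsub>complex_alg\<^esub> y = x * y" "\<one>\<^bsub>complex_alg\<^esub> = 1"
  "\<zero>\<^bsub>complex_alg\<^esub> = 0" "x \<oplus>\<^bsub>complex_alg\<^esub> y = x + y" "x \<odot>\<^bsub>complex_alg\<^esub> y = x * y"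
  "star complex_alg x = cnj x"
  by (simp_all add: complex_alg_def)

lemma cring_complex_alg: "cring complex_alg"
proof (rule cringI)
  show "abelian_group complex_alg"
    by (rule abelian_groupI) (auto intro: exI[where x = "- x" for x] simp: add.left_inverse)
  show "comm_monoid complex_alg"
    by (rule comm_monoidI) auto
qed (auto simp: algebra_simps)

text \<open>Additive inverses are not asked for: \<open>(- 1) \<odot> x\<close> is one, because
  \<open>(- 1) \<odot> x \<oplus> 1 \<odot> x = 0 \<odot> x\<close>.\<close>

lemma vecI:
  assumes "\<And>x y. x \<in> carrier M \<Longrightarrow> y \<in> carrier M \<Longrightarrow> x \<oplus>\<^bsub>M\<^esub> y \<in> carrier M"
    and "\<zero>\<^bsub>M\<^esub> \<in> carrier M"
    and "\<And>x y z. x \<in> carrier M \<Longrightarrow> y \<in> carrier M \<Longrightarrow> z \<in> carrier M \<Longrightarrow>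
           x \<oplus>\<^bsub>M\<^esub> y \<oplus>\<^bsub>M\<^esub> z = x \<oplus>\<^bsub>M\<^esub> (y \<oplus>\<^bsub>M\<^esub> z)"
    and "\<And>x y. x \<in> carrier M \<Longrightarrow> y \<in> carrier M \<Longrightarrow> x \<oplus>\<^bsub>M\<^esub> y = y \<oplus>\<^bsub>M\<^esub> x"
    and "\<And>x. x \<in> carrier M \<Longrightarrow> \<zero>\<^bsub>M\<^esub> \<oplus>\<^bsub>M\<^esub> x = x"
    and "\<And>c x. x \<in> carrier M \<Longrightarrow> c \<odot>\<^bsub>M\<^esub> x \<in> carrier M"
    and l: "\<And>c d x. x \<in> carrier M \<Longrightarrow> (c + d) \<odot>\<^bsub>M\<^esub> x = c \<odot>\<^bsub>M\<^esub> x \<oplus>\<^bsub>M\<^esub> d \<odot>\<^bsub>M\<^esub> x"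
    and "\<And>c x y. x \<in> carrier M \<Longrightarrow> y \<in> carrier M \<Longrightarrow>
           c \<odot>\<^bsub>M\<^esub> (x \<oplus>\<^bsub>M\<^esub> y) = c \<odot>\<^bsub>M\<^esub> x \<oplus>\<^bsub>M\<^esub> c \<odot>\<^bsub>M\<^esub> y"
    and "\<And>c d x. x \<in> carrier M \<Longrightarrow> (c * d) \<odot>\<^bsub>M\<^esub> x = c \<odot>\<^bsub>M\<^esub> (d \<odot>\<^bsub>M\<^esub> x)"
    and one: "\<And>x. x \<in> carrier M \<Longrightarrow> 1 \<odot>\<^bsub>M\<^esub> x = x"
    and z: "\<And>x. x \<in> carrier M \<Longrightarrow> 0 \<odot>\<^bsub>M\<^esub> x = \<zero>\<^bsub>M\<^esub>"
  shows "vec M"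
proof (rule moduleI)
  show "cring complex_alg" by (rule cring_complex_alg)
  show "abelian_group M"
  proof (rule abelian_groupI)
    fix x assume x: "x \<in> carrier M"
    have "(- 1) \<odot>\<^bsub>M\<^esub> x \<oplus>\<^bsub>M\<^esub> x = \<zero>\<^bsub>M\<^esub>"
      using l[OF x, of "- 1" 1] z[OF x] one[OF x] by simp
    thus "\<exists>y\<in>carrier M. y \<oplus>\<^bsub>M\<^esub> x = \<zero>\<^bsub>M\<^esub>" using assms(6) x by blast
  qed (use assms in auto)
qed (use assms in auto)

lemma vec_abelian_group: "vec M \<Longrightarrow> abelian_group M"
  by (rule Module.module.axioms)

lemma vec_simps [simp]:
  assumes "vec M"
  shows "\<zero>\<^bsub>M\<^esub> \<in> carrier M"
    and "x \<in> carrier M \<Longrightarrow> y \<in> carrier M \<Longrightarrow> x \<oplus>\<^bsub>M\<^esub> y \<in> carrier M"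
    and "x \<in> carrier M \<Longrightarrow> c \<odot>\<^bsub>M\<^esub> x \<in> carrier M"
    and "x \<in> carrier M \<Longrightarrow> \<zero>\<^bsub>M\<^esub> \<oplus>\<^bsub>M\<^esub> x = x"
    and "x \<in> carrier M \<Longrightarrow> x \<oplus>\<^bsub>M\<^esub> \<zero>\<^bsub>M\<^esub> = x"
    and "x \<in> carrier M \<Longrightarrow> 1 \<odot>\<^bsub>M\<^esub> x = x"
    and "x \<in> carrier M \<Longrightarrow> 0 \<odot>\<^bsub>M\<^esub> x = \<zero>\<^bsub>M\<^esub>"
    and "c \<odot>\<^bsub>M\<^esub> \<zero>\<^bsub>M\<^esub> = \<zero>\<^bsub>M\<^esub>"
  using Module.module.smult_one[OF assms] Module.module.smult_l_null[OF assms]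
    Module.module.smult_r_null[OF assms] Module.module.smult_closed[OF assms]
    abelian_groupE(1-5)[OF vec_abelian_group[OF assms]]
    abelian_monoid.r_zero[OF abelian_group.axioms(1)[OF vec_abelian_group[OF assms]]]
  by simp_all

lemma vec_add_assoc:
  "vec M \<Longrightarrow> x \<in> carrier M \<Longrightarrow> y \<in> carrier M \<Longrightarrow> z \<in> carrier M \<Longrightarrow>
     x \<oplus>\<^bsub>M\<^esub> y \<oplus>\<^bsub>M\<^esub> z = x \<oplus>\<^bsub>M\<^esub> (y \<oplus>\<^bsub>M\<^esub> z)"
  using abelian_monoid.a_assoc[OF abelian_group.axioms(1)[OF vec_abelian_group]] .

lemma vec_add_commute:
  "vec M \<Longrightarrow> x \<in> carrier M \<Longrightarrow> y \<in> carrier M \<Longrightarrow> x \<oplus>\<^bsub>M\<^esub> y = y \<oplus>\<^bsub>M\<^esub> x"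
  using abelian_monoid.a_comm[OF abelian_group.axioms(1)[OF vec_abelian_group]] .

lemma vec_add_left_commute:
  "vec M \<Longrightarrow> x \<in> carrier M \<Longrightarrow> y \<in> carrier M \<Longrightarrow> z \<in> carrier M \<Longrightarrow>
     x \<oplus>\<^bsub>M\<^esub> (y \<oplus>\<^bsub>M\<^esub> z) = y \<oplus>\<^bsub>M\<^esub> (x \<oplus>\<^bsub>M\<^esub> z)"
  using abelian_monoid.a_lcomm[OF abelian_group.axioms(1)[OF vec_abelian_group]] .

lemmas vec_ac = vec_add_assoc vec_add_commute vec_add_left_commute

lemma vec_smult_add:
  "vec M \<Longrightarrow> x \<in> carrier M \<Longrightarrow> (c + d) \<odot>\<^bsub>M\<^esub> x = c \<odot>\<^bsub>M\<^esub> x \<oplus>\<^bsub>M\<^esub> d \<odot>\<^bsub>M\<^esub> x"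
  using Module.module.smult_l_distr[of complex_alg M c d x] by simp

lemma vec_smult_distrib:
  "vec M \<Longrightarrow> x \<in> carrier M \<Longrightarrow> y \<in> carrier M \<Longrightarrow>
     c \<odot>\<^bsub>M\<^esub> (x \<oplus>\<^bsub>M\<^esub> y) = c \<odot>\<^bsub>M\<^esub> x \<oplus>\<^bsub>M\<^esub> c \<odot>\<^bsub>M\<^esub> y"
  using Module.module.smult_r_distr[of complex_alg M c x y] by simp

lemma vec_smult_smult [simp]:
  "vec M \<Longrightarrow> x \<in> carrier M \<Longrightarrow> c \<odot>\<^bsub>M\<^esub> (d \<odot>\<^bsub>M\<^esub> x) = (c * d) \<odot>\<^bsub>M\<^esub> x"
  using Module.module.smult_assoc1[of complex_alg M c d x] by simp

text \<open>Differences are written with the scalar \<open>- 1\<close> rather than with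
  \<open>\<ominus>\<close>, so that a linear map passes through them by additivity and homogeneity
  alone.\<close>

lemma vec_diff_self [simp]:
  "vec M \<Longrightarrow> x \<in> carrier M \<Longrightarrow> x \<oplus>\<^bsub>M\<^esub> (- 1) \<odot>\<^bsub>M\<^esub> x = \<zero>\<^bsub>M\<^esub>"
  using vec_smult_add[of M x 1 "- 1"] by simp

lemma vec_diff_eq_zero:
  assumes "vec M" "x \<in> carrier M" "y \<in> carrier M" "x \<oplus>\<^bsub>M\<^esub> (- 1) \<odot>\<^bsub>M\<^esub> y = \<zero>\<^bsub>M\<^esub>"
  shows "x = y"
proof -
  have "x = x \<oplus>\<^bsub>M\<^esub> (y \<oplus>\<^bsub>M\<^esub> (- 1) \<odot>\<^bsub>M\<^esub> y)" using assms by simp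
  also have "\<dots> = (x \<oplus>\<^bsub>M\<^esub> (- 1) \<odot>\<^bsub>M\<^esub> y) \<oplus>\<^bsub>M\<^esub> y" using assms(1-3) by (simp add: vec_ac)
  finally show ?thesis using assms by simp
qed

lemma vec_minus_eq: "vec M \<Longrightarrow> x \<in> carrier M \<Longrightarrow> \<ominus>\<^bsub>M\<^esub> x = (- 1) \<odot>\<^bsub>M\<^esub> x"
  by (rule abelian_group.minus_equality[OF vec_abelian_group]) (auto simp: vec_add_commute)

text \<open>Unfolds the library notion, an additive subgroup closed under scalars, into plain
  closure conditions; negatives are multiples by \<open>- 1\<close>.\<close>

lemma lin_subspace_iff:
  assumes M: "vec M"
  shows "lin_subspace W M \<longleftrightarrow> W \<subseteq> carrier M \<and> \<zero>\<^bsub>M\<^esub> \<in> W \<and> (\<forall>x\<in>W. \<forall>y\<in>W. x \<oplus>\<^bsub>M\<^esub> y \<in> W) \<and>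
           (\<forall>c. \<forall>x\<in>W. c \<odot>\<^bsub>M\<^esub> x \<in> W)"
proof (intro iffI conjI ballI allI; (elim conjE)?)
  interpret M: Module.module complex_alg M by fact
  assume W: "lin_subspace W M"
  note E = M.submoduleE[OF W]
  show "W \<subseteq> carrier M" by (rule E)
  then show "\<zero>\<^bsub>M\<^esub> \<in> W" using E(2) E(4)[of 0] M by fastforce
  show "x \<oplus>\<^bsub>M\<^esub> y \<in> W" if "x \<in> W" "y \<in> W" for x y using E(5) that .
  show "c \<odot>\<^bsub>M\<^esub> x \<in> W" if "x \<in> W" for c x using E(4) that by simp
next
  interpret M: Module.module complex_alg M by fact
  assume *: "W \<subseteq> carrier M" "\<zero>\<^bsub>M\<^esub> \<in> W" "\<forall>x\<in>W. \<forall>y\<in>W. x \<oplus>\<^bsub>M\<^esub> y \<in> W"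
    "\<forall>c. \<forall>x\<in>W. c \<odot>\<^bsub>M\<^esub> x \<in> W"
  show "lin_subspace W M"
  proof (rule M.submoduleI)
    fix x assume "x \<in> W"
    thus "\<ominus>\<^bsub>M\<^esub> x \<in> W" using * vec_minus_eq[OF M, of x] by auto
  qed (use * in auto)
qed

lemma lin_subspaceI:
  assumes "vec M" "W \<subseteq> carrier M" "\<zero>\<^bsub>M\<^esub> \<in> W" "\<And>x y. x \<in> W \<Longrightarrow> y \<in> W \<Longrightarrow> x \<oplus>\<^bsub>M\<^esub> y \<in> W"
    "\<And>c x. x \<in> W \<Longrightarrow> c \<odot>\<^bsub>M\<^esub> x \<in> W"
  shows "lin_subspace W M"
  using assms by (simp add: lin_subspace_iff)

lemma lin_subspaceD:
  assumes "vec M" "lin_subspace W M"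
  shows "W \<subseteq> carrier M" "\<zero>\<^bsub>M\<^esub> \<in> W" "x \<in> W \<Longrightarrow> y \<in> W \<Longrightarrow> x \<oplus>\<^bsub>M\<^esub> y \<in> W" "x \<in> W \<Longrightarrow> c \<odot>\<^bsub>M\<^esub> x \<in> W"
    "x \<in> W \<Longrightarrow> x \<in> carrier M"
  using assms by (auto simp: lin_subspace_iff)

lemma vec_subspace: "vec M \<Longrightarrow> lin_subspace W M \<Longrightarrow> vec (M\<lparr>carrier := W\<rparr>)"
  by (rule submodule.submodule_is_module)

lemma lin_subspace_carrier: "vec M \<Longrightarrow> lin_subspace (carrier M) M"
  by (simp add: lin_subspace_iff)

lemma lin_span_subspace:
  assumes "vec M" "S \<subseteq> carrier M"
  shows "lin_subspace (lin_span M S) M"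
  unfolding lin_span_def
proof (rule lin_subspaceI[OF assms(1)])
  \<comment> \<open>As \<open>S \<subseteq> carrier M\<close>, the carrier is one of the intersected
    subspaces; over an empty family the intersection would be \<open>UNIV\<close>.\<close>
  show "\<Inter> {V. lin_subspace V M \<and> S \<subseteq> V} \<subseteq> carrier M"
    using assms lin_subspace_carrier by blast
qed (auto dest: lin_subspaceD[OF assms(1)])

lemma lin_span_superset: "S \<subseteq> lin_span M S"
  by (auto simp: lin_span_def)

lemma lin_span_base: "x \<in> S \<Longrightarrow> x \<in> lin_span M S"
  by (auto simp: lin_span_def)

lemma lin_span_minimal: "lin_subspace V M \<Longrightarrow> S \<subseteq> V \<Longrightarrow> lin_span M S \<subseteq> V"
  by (auto simp: lin_span_def)

text \<open>The vectors of the carrier that satisfy \<open>P\<close> form a subspace containing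
  \<open>S\<close>. Induction also covers antilinear maps such as \<open>star\<close>, to which a
  comparison of linear maps does not apply.\<close>

lemma lin_span_induct [consumes 3, case_names base zero add smult]:
  assumes "x \<in> lin_span M S" "vec M" "S \<subseteq> carrier M"
    and "\<And>s. s \<in> S \<Longrightarrow> P s" "P \<zero>\<^bsub>M\<^esub>"
    and "\<And>x y. x \<in> carrier M \<Longrightarrow> y \<in> carrier M \<Longrightarrow> P x \<Longrightarrow> P y \<Longrightarrow> P (x \<oplus>\<^bsub>M\<^esub> y)"
    and "\<And>c x. x \<in> carrier M \<Longrightarrow> P x \<Longrightarrow> P (c \<odot>\<^bsub>M\<^esub> x)"
  shows "P x"
proof -
  have "lin_subspace {x \<in> carrier M. P x} M"
    by (rule lin_subspaceI[OF assms(2)]) (use assms in auto)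
  from lin_span_minimal[OF this, of S] show ?thesis using assms by blast
qed

lemma lin_span_mono: "S \<subseteq> T \<Longrightarrow> lin_span M S \<subseteq> lin_span M T"
  by (auto simp: lin_span_def)

section \<open>Linear maps and their behaviour on subspaces and spans\<close>

lemma lin_mapsI:
  assumes "\<And>x. x \<in> carrier A \<Longrightarrow> f x \<in> carrier B"
    and "\<And>x y. x \<in> carrier A \<Longrightarrow> y \<in> carrier A \<Longrightarrow> f (x \<oplus>\<^bsub>A\<^esub> y) = f x \<oplus>\<^bsub>B\<^esub> f y"
    and "\<And>c x. x \<in> carrier A \<Longrightarrow> f (c \<odot>\<^bsub>A\<^esub> x) = c \<odot>\<^bsub>B\<^esub> f x"
  shows "f \<in> linear_maps A B"
  using assms by (auto simp: linear_maps_def)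

lemma lin_mapsD:
  assumes "f \<in> linear_maps A B"
  shows "x \<in> carrier A \<Longrightarrow> f x \<in> carrier B"
    and "x \<in> carrier A \<Longrightarrow> y \<in> carrier A \<Longrightarrow> f (x \<oplus>\<^bsub>A\<^esub> y) = f x \<oplus>\<^bsub>B\<^esub> f y"
    and "x \<in> carrier A \<Longrightarrow> f (c \<odot>\<^bsub>A\<^esub> x) = c \<odot>\<^bsub>B\<^esub> f x"
  using assms by (auto simp: linear_maps_def)

lemma lin_maps_zero:
  assumes "f \<in> linear_maps A B" "vec A" "vec B"
  shows "f \<zero>\<^bsub>A\<^esub> = \<zero>\<^bsub>B\<^esub>"
  using lin_mapsD(3)[OF assms(1), of "\<zero>\<^bsub>A\<^esub>" 0] lin_mapsD(1)[OF assms(1), of "\<zero>\<^bsub>A\<^esub>"] assms(2,3) by simp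

lemma lin_maps_id [intro]: "(\<lambda>x. x) \<in> linear_maps A A"
  by (auto simp: linear_maps_def)

lemma lin_maps_compose:
  "f \<in> linear_maps A B \<Longrightarrow> g \<in> linear_maps B C \<Longrightarrow> (\<lambda>x. g (f x)) \<in> linear_maps A C"
  by (rule lin_mapsI) (simp_all add: lin_mapsD)

lemma lin_maps_add:
  assumes "f \<in> linear_maps A B" "g \<in> linear_maps A B" "vec B"
  shows "(\<lambda>x. f x \<oplus>\<^bsub>B\<^esub> g x) \<in> linear_maps A B"
  using assms by (intro lin_mapsI) (auto simp: lin_mapsD vec_smult_distrib vec_ac)

lemma lin_maps_smult:
  assumes "f \<in> linear_maps A B" "vec B"
  shows "(\<lambda>x. c \<odot>\<^bsub>B\<^esub> f x) \<in> linear_maps A B"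
  using assms by (intro lin_mapsI) (auto simp: lin_mapsD vec_smult_distrib mult.commute)

lemma lin_maps_functional:
  assumes "f \<in> linear_maps A complex_alg" "v \<in> carrier B" "vec B"
  shows "(\<lambda>x. f x \<odot>\<^bsub>B\<^esub> v) \<in> linear_maps A B"
  using assms by (intro lin_mapsI) (auto simp: lin_mapsD vec_smult_add)

lemma lin_maps_diff:
  assumes "f \<in> linear_maps A B" "g \<in> linear_maps A B" "vec B"
  shows "(\<lambda>x. f x \<oplus>\<^bsub>B\<^esub> c \<odot>\<^bsub>B\<^esub> g x) \<in> linear_maps A B"
  using assms by (intro lin_maps_add lin_maps_smult)

lemma lin_maps_restrict: "f \<in> linear_maps A B \<Longrightarrow> F \<subseteq> carrier A \<Longrightarrow> f \<in> linear_maps (A\<lparr>carrier := F\<rparr>) B"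
  by (rule lin_mapsI) (auto simp: lin_mapsD subset_iff)

lemma lin_maps_corestrict:
  "f \<in> linear_maps A B \<Longrightarrow> (\<And>x. x \<in> carrier A \<Longrightarrow> f x \<in> F) \<Longrightarrow> f \<in> linear_maps A (B\<lparr>carrier := F\<rparr>)"
  by (auto simp: linear_maps_def)

lemma lin_maps_cong:
  "(\<And>x. x \<in> carrier A \<Longrightarrow> f x = g x) \<Longrightarrow> vec A \<Longrightarrow> f \<in> linear_maps A B \<longleftrightarrow> g \<in> linear_maps A B"
  by (auto simp: linear_maps_def Pi_iff)

lemma lin_subspace_vimage:
  assumes "f \<in> linear_maps A B" "vec A" "vec B" "lin_subspace W B"
  shows "lin_subspace {x \<in> carrier A. f x \<in> W} A"
  using lin_subspaceD[OF assms(3,4)] assms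
  by (intro lin_subspaceI) (auto simp: lin_mapsD lin_maps_zero)

lemma lin_subspace_image:
  assumes "f \<in> linear_maps A B" "vec A" "vec B" "lin_subspace W A"
  shows "lin_subspace (f ` W) B"
proof (rule lin_subspaceI[OF assms(3)])
  note W = lin_subspaceD[OF assms(2,4)]
  show "f ` W \<subseteq> carrier B" using W lin_mapsD[OF assms(1)] by auto
  show "\<zero>\<^bsub>B\<^esub> \<in> f ` W" using W(2) lin_maps_zero[OF assms(1-3)] by (metis imageI)
  show "x \<oplus>\<^bsub>B\<^esub> y \<in> f ` W" if xy: "x \<in> f ` W" "y \<in> f ` W" for x y
  proof -
    obtain a b where "a \<in> W" "b \<in> W" "x = f a" "y = f b" using xy by blast
    thus ?thesis using W(3)[of a b] W(5) lin_mapsD(2)[OF assms(1), of a b] by (metis imageI)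
  qed
  show "c \<odot>\<^bsub>B\<^esub> x \<in> f ` W" if x: "x \<in> f ` W" for c x
  proof -
    obtain a where "a \<in> W" "x = f a" using x by blast
    thus ?thesis using W(4)[of a c] W(5) lin_mapsD(3)[OF assms(1), of a c] by (metis imageI)
  qed
qed

text \<open>The vectors that \<open>f\<close> sends into \<open>W\<close> form a subspace, so only
  generators have to be inspected. This is the standard way below to prove membership in a
  subspace.\<close>

lemma lin_span_map_into:
  assumes "x \<in> lin_span A S" "f \<in> linear_maps A B" "vec A" "vec B" "S \<subseteq> carrier A"
    "lin_subspace W B" "\<And>s. s \<in> S \<Longrightarrow> f s \<in> W"
  shows "f x \<in> W"
  using lin_span_minimal[OF lin_subspace_vimage[OF assms(2-4,6)], of S] assms by blast

lemma lin_span_map_eq: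
  assumes "x \<in> lin_span A S" "f \<in> linear_maps A B" "g \<in> linear_maps A B" "vec A" "vec B"
    "S \<subseteq> carrier A" "\<And>s. s \<in> S \<Longrightarrow> f s = g s"
  shows "f x = g x"
  using assms(1,4,6)
  by (induction rule: lin_span_induct)
    (use assms in \<open>auto simp: lin_mapsD lin_maps_zero\<close>)

text \<open>Lifts a combination of values \<open>f s\<close> to the same combination of the
  \<open>s\<close>; this is how \<open>translation\<close> is found.\<close>

lemma lin_span_image_superset:
  assumes "f \<in> linear_maps A B" "vec A" "vec B" "S \<subseteq> carrier A"
  shows "lin_span B (f ` S) \<subseteq> f ` lin_span A S"
  by (rule lin_span_minimal) (use assms in \<open>auto intro!: lin_subspace_image lin_span_subspace imageI lin_span_base\<close>)

lemma a_kernel_eq: "a_kernel A B f = {x \<in> carrier A. f x = \<zero>\<^bsub>B\<^esub>}"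
  by (simp add: a_kernel_def')

section \<open>Star-algebras\<close>

lemma star_algI:
  assumes "vec A"
    and "\<And>x y. x \<in> carrier A \<Longrightarrow> y \<in> carrier A \<Longrightarrow> x \<otimes>\<^bsub>A\<^esub> y \<in> carrier A" "\<one>\<^bsub>A\<^esub> \<in> carrier A"
    and "\<And>x y z. x \<in> carrier A \<Longrightarrow> y \<in> carrier A \<Longrightarrow> z \<in> carrier A \<Longrightarrow>
           x \<otimes>\<^bsub>A\<^esub> y \<otimes>\<^bsub>A\<^esub> z = x \<otimes>\<^bsub>A\<^esub> (y \<otimes>\<^bsub>A\<^esub> z)"
    and "\<And>x. x \<in> carrier A \<Longrightarrow> \<one>\<^bsub>A\<^esub> \<otimes>\<^bsub>A\<^esub> x = x" "\<And>x. x \<in> carrier A \<Longrightarrow> x \<otimes>\<^bsub>A\<^esub> \<one>\<^bsub>A\<^esub> = x"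
    and "\<And>x y z. x \<in> carrier A \<Longrightarrow> y \<in> carrier A \<Longrightarrow> z \<in> carrier A \<Longrightarrow>
           (x \<oplus>\<^bsub>A\<^esub> y) \<otimes>\<^bsub>A\<^esub> z = x \<otimes>\<^bsub>A\<^esub> z \<oplus>\<^bsub>A\<^esub> y \<otimes>\<^bsub>A\<^esub> z"
    and "\<And>x y z. x \<in> carrier A \<Longrightarrow> y \<in> carrier A \<Longrightarrow> z \<in> carrier A \<Longrightarrow>
           z \<otimes>\<^bsub>A\<^esub> (x \<oplus>\<^bsub>A\<^esub> y) = z \<otimes>\<^bsub>A\<^esub> x \<oplus>\<^bsub>A\<^esub> z \<otimes>\<^bsub>A\<^esub> y"
    and "\<And>c x y. x \<in> carrier A \<Longrightarrow> y \<in> carrier A \<Longrightarrow> (c \<odot>\<^bsub>A\<^esub> x) \<otimes>\<^bsub>A\<^esub> y = c \<odot>\<^bsub>A\<^esub> (x \<otimes>\<^bsub>A\<^esub> y)"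
    and "\<And>c x y. x \<in> carrier A \<Longrightarrow> y \<in> carrier A \<Longrightarrow> x \<otimes>\<^bsub>A\<^esub> (c \<odot>\<^bsub>A\<^esub> y) = c \<odot>\<^bsub>A\<^esub> (x \<otimes>\<^bsub>A\<^esub> y)"
    and "\<And>x. x \<in> carrier A \<Longrightarrow> star A x \<in> carrier A"
    and "\<And>x. x \<in> carrier A \<Longrightarrow> star A (star A x) = x"
    and "\<And>x y. x \<in> carrier A \<Longrightarrow> y \<in> carrier A \<Longrightarrow> star A (x \<oplus>\<^bsub>A\<^esub> y) = star A x \<oplus>\<^bsub>A\<^esub> star A y"
    and "\<And>x y. x \<in> carrier A \<Longrightarrow> y \<in> carrier A \<Longrightarrow> star A (x \<otimes>\<^bsub>A\<^esub> y) = star A y \<otimes>\<^bsub>A\<^esub> star A x"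
    and "\<And>c x. x \<in> carrier A \<Longrightarrow> star A (c \<odot>\<^bsub>A\<^esub> x) = cnj c \<odot>\<^bsub>A\<^esub> star A x"
  shows "is_star_algebra A"
  unfolding is_star_algebra_def
proof (intro conjI allI ballI)
  show "ring A"
    by (rule ringI) (use assms vec_abelian_group in \<open>auto intro!: monoidI\<close>)
qed (use assms in auto)

lemma star_alg_vec [simp, intro]: "is_star_algebra A \<Longrightarrow> vec A"
  by (simp add: is_star_algebra_def)

lemma star_alg_ring: "is_star_algebra A \<Longrightarrow> ring A"
  by (simp add: is_star_algebra_def)

lemma star_alg_simps [simp]:
  assumes "is_star_algebra A"
  shows "\<one>\<^bsub>A\<^esub> \<in> carrier A"
    and "x \<in> carrier A \<Longrightarrow> y \<in> carrier A \<Longrightarrow> x \<otimes>\<^bsub>A\<^esub> y \<in> carrier A"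
    and "x \<in> carrier A \<Longrightarrow> star A x \<in> carrier A"
    and "x \<in> carrier A \<Longrightarrow> \<one>\<^bsub>A\<^esub> \<otimes>\<^bsub>A\<^esub> x = x"
    and "x \<in> carrier A \<Longrightarrow> x \<otimes>\<^bsub>A\<^esub> \<one>\<^bsub>A\<^esub> = x"
    and "x \<in> carrier A \<Longrightarrow> \<zero>\<^bsub>A\<^esub> \<otimes>\<^bsub>A\<^esub> x = \<zero>\<^bsub>A\<^esub>"
    and "x \<in> carrier A \<Longrightarrow> x \<otimes>\<^bsub>A\<^esub> \<zero>\<^bsub>A\<^esub> = \<zero>\<^bsub>A\<^esub>"
    and "x \<in> carrier A \<Longrightarrow> y \<in> carrier A \<Longrightarrow> (c \<odot>\<^bsub>A\<^esub> x) \<otimes>\<^bsub>A\<^esub> y = c \<odot>\<^bsub>A\<^esub> (x \<otimes>\<^bsub>A\<^esub> y)"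
    and "x \<in> carrier A \<Longrightarrow> y \<in> carrier A \<Longrightarrow> x \<otimes>\<^bsub>A\<^esub> (c \<odot>\<^bsub>A\<^esub> y) = c \<odot>\<^bsub>A\<^esub> (x \<otimes>\<^bsub>A\<^esub> y)"
    and "x \<in> carrier A \<Longrightarrow> star A (star A x) = x"
    and "x \<in> carrier A \<Longrightarrow> y \<in> carrier A \<Longrightarrow> star A (x \<oplus>\<^bsub>A\<^esub> y) = star A x \<oplus>\<^bsub>A\<^esub> star A y"
    and "x \<in> carrier A \<Longrightarrow> y \<in> carrier A \<Longrightarrow> star A (x \<otimes>\<^bsub>A\<^esub> y) = star A y \<otimes>\<^bsub>A\<^esub> star A x"
    and "x \<in> carrier A \<Longrightarrow> star A (c \<odot>\<^bsub>A\<^esub> x) = cnj c \<odot>\<^bsub>A\<^esub> star A x"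
  using assms ring.ring_simprules[OF star_alg_ring[OF assms]]
    monoid.r_one[OF ring.is_monoid[OF star_alg_ring[OF assms]]]
  unfolding is_star_algebra_def by auto

lemma star_alg_assoc:
  "is_star_algebra A \<Longrightarrow> x \<in> carrier A \<Longrightarrow> y \<in> carrier A \<Longrightarrow> z \<in> carrier A \<Longrightarrow>
     x \<otimes>\<^bsub>A\<^esub> y \<otimes>\<^bsub>A\<^esub> z = x \<otimes>\<^bsub>A\<^esub> (y \<otimes>\<^bsub>A\<^esub> z)"
  using monoid.m_assoc[OF ring.is_monoid[OF star_alg_ring]] .

lemma star_alg_distrib:
  assumes "is_star_algebra A" "x \<in> carrier A" "y \<in> carrier A" "z \<in> carrier A"
  shows "(x \<oplus>\<^bsub>A\<^esub> y) \<otimes>\<^bsub>A\<^esub> z = x \<otimes>\<^bsub>A\<^esub> z \<oplus>\<^bsub>A\<^esub> y \<otimes>\<^bsub>A\<^esub> z"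
    and "z \<otimes>\<^bsub>A\<^esub> (x \<oplus>\<^bsub>A\<^esub> y) = z \<otimes>\<^bsub>A\<^esub> x \<oplus>\<^bsub>A\<^esub> z \<otimes>\<^bsub>A\<^esub> y"
  using ring.ring_simprules[OF star_alg_ring[OF assms(1)]] assms by auto

lemma star_one [simp]:
  assumes A: "is_star_algebra A"
  shows "star A \<one>\<^bsub>A\<^esub> = \<one>\<^bsub>A\<^esub>"
proof -
  have "star A (star A \<one>\<^bsub>A\<^esub> \<otimes>\<^bsub>A\<^esub> \<one>\<^bsub>A\<^esub>) = star A \<one>\<^bsub>A\<^esub> \<otimes>\<^bsub>A\<^esub> star A (star A \<one>\<^bsub>A\<^esub>)"
    using A by (intro star_alg_simps) auto
  thus ?thesis using A by simp
qed

lemma star_zero [simp]: "is_star_algebra A \<Longrightarrow> star A \<zero>\<^bsub>A\<^esub> = \<zero>\<^bsub>A\<^esub>"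
  using star_alg_simps(13)[of A "\<zero>\<^bsub>A\<^esub>" 0] by simp

lemma lin_maps_mult_left:
  "is_star_algebra A \<Longrightarrow> a \<in> carrier A \<Longrightarrow> (\<lambda>x. a \<otimes>\<^bsub>A\<^esub> x) \<in> linear_maps A A"
  by (rule lin_mapsI) (auto simp: star_alg_distrib)

lemma lin_maps_mult_right:
  "is_star_algebra A \<Longrightarrow> a \<in> carrier A \<Longrightarrow> (\<lambda>x. x \<otimes>\<^bsub>A\<^esub> a) \<in> linear_maps A A"
  by (rule lin_mapsI) (auto simp: star_alg_distrib)

lemma is_star_algebra_complex_alg [simp]: "is_star_algebra complex_alg"
  by (intro star_algI vecI) (auto simp: algebra_simps)

lemma is_star_algebra_cong:
  assumes "is_star_algebra A" "carrier B = carrier A" "monoid.mult B = monoid.mult A" "one B = one A"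
    "ring.zero B = ring.zero A" "add B = add A" "smult B = smult A" "star B = star A"
  shows "is_star_algebra B"
  using assms(1)
  by (intro star_algI vecI)
    (auto simp: assms(2-8) star_alg_assoc star_alg_distrib vec_ac vec_smult_add vec_smult_distrib)

lemma star_alg_homD:
  assumes "f \<in> star_alg_hom A B"
  shows "f \<in> linear_maps A B"
    and "x \<in> carrier A \<Longrightarrow> y \<in> carrier A \<Longrightarrow> f (x \<otimes>\<^bsub>A\<^esub> y) = f x \<otimes>\<^bsub>B\<^esub> f y"
    and "f \<one>\<^bsub>A\<^esub> = \<one>\<^bsub>B\<^esub>"
    and "x \<in> carrier A \<Longrightarrow> f (star A x) = star B (f x)"
    and "x \<in> carrier A \<Longrightarrow> f x \<in> carrier B"
  using assms by (auto simp: star_alg_hom_def ring_hom_def linear_maps_def)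

lemma star_alg_homI:
  assumes "f \<in> linear_maps A B"
    and "\<And>x y. x \<in> carrier A \<Longrightarrow> y \<in> carrier A \<Longrightarrow> f (x \<otimes>\<^bsub>A\<^esub> y) = f x \<otimes>\<^bsub>B\<^esub> f y"
    and "f \<one>\<^bsub>A\<^esub> = \<one>\<^bsub>B\<^esub>"
    and "\<And>x. x \<in> carrier A \<Longrightarrow> f (star A x) = star B (f x)"
  shows "f \<in> star_alg_hom A B"
  using assms by (auto simp: star_alg_hom_def ring_hom_def linear_maps_def)

text \<open>Both sides of multiplicativity are bilinear, so the claim is extended from
  \<open>S\<close> in the second argument and then in the first. Compatibility with
  \<open>star\<close> is antilinear, hence the induction over the span.\<close>

lemma star_alg_hom_span:
  assumes A: "is_star_algebra A" and B: "is_star_algebra B" and f: "f \<in> linear_maps A B"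
    and S: "S \<subseteq> carrier A" "carrier A \<subseteq> lin_span A S"
    and m: "\<And>x y. x \<in> S \<Longrightarrow> y \<in> S \<Longrightarrow> f (x \<otimes>\<^bsub>A\<^esub> y) = f x \<otimes>\<^bsub>B\<^esub> f y"
    and o: "f \<one>\<^bsub>A\<^esub> = \<one>\<^bsub>B\<^esub>"
    and s: "\<And>x. x \<in> S \<Longrightarrow> f (star A x) = star B (f x)"
  shows "f \<in> star_alg_hom A B"
proof (rule star_alg_homI[OF f _ o])
  have vA: "vec A" and vB: "vec B" using A B by auto
  note fD = lin_mapsD[OF f]
  have 1: "f (x \<otimes>\<^bsub>A\<^esub> y) = f x \<otimes>\<^bsub>B\<^esub> f y" if x: "x \<in> S" and y: "y \<in> carrier A" for x y
  proof -
    have "y \<in> lin_span A S" using y S by auto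
    thus ?thesis
    proof (rule lin_span_map_eq[where f = "\<lambda>y. f (x \<otimes>\<^bsub>A\<^esub> y)" and g = "\<lambda>y. f x \<otimes>\<^bsub>B\<^esub> f y"])
      show "(\<lambda>y. f (x \<otimes>\<^bsub>A\<^esub> y)) \<in> linear_maps A B"
        by (rule lin_maps_compose[OF lin_maps_mult_left[OF A] f]) (use x S in auto)
      show "(\<lambda>y. f x \<otimes>\<^bsub>B\<^esub> f y) \<in> linear_maps A B"
        by (rule lin_maps_compose[OF f lin_maps_mult_left[OF B]]) (use x S fD(1) in auto)
    qed (use x m S vA vB in auto)
  qed
  show "f (x \<otimes>\<^bsub>A\<^esub> y) = f x \<otimes>\<^bsub>B\<^esub> f y" if x: "x \<in> carrier A" and y: "y \<in> carrier A" for x y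
  proof -
    have "x \<in> lin_span A S" using x S by auto
    thus ?thesis
    proof (rule lin_span_map_eq[where f = "\<lambda>x. f (x \<otimes>\<^bsub>A\<^esub> y)" and g = "\<lambda>x. f x \<otimes>\<^bsub>B\<^esub> f y"])
      show "(\<lambda>x. f (x \<otimes>\<^bsub>A\<^esub> y)) \<in> linear_maps A B"
        by (rule lin_maps_compose[OF lin_maps_mult_right[OF A] f]) (use y in auto)
      show "(\<lambda>x. f x \<otimes>\<^bsub>B\<^esub> f y) \<in> linear_maps A B"
        by (rule lin_maps_compose[OF f lin_maps_mult_right[OF B]]) (use y fD(1) in auto)
    qed (use y 1 S vA vB in auto)
  qed
  show "f (star A x) = star B (f x)" if x: "x \<in> carrier A" for x
  proof -
    have "x \<in> lin_span A S" using x S by auto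
    thus ?thesis using vA S(1)
      by (induction rule: lin_span_induct)
        (use A B vA vB s fD lin_maps_zero[OF f vA vB] in auto)
  qed
qed

lemma star_subalgebraI:
  assumes A: "is_star_algebra A" and B: "lin_subspace B A" "\<one>\<^bsub>A\<^esub> \<in> B"
    "\<And>x y. x \<in> B \<Longrightarrow> y \<in> B \<Longrightarrow> x \<otimes>\<^bsub>A\<^esub> y \<in> B" "\<And>x. x \<in> B \<Longrightarrow> star A x \<in> B"
  shows "star_subalgebra B A"
  unfolding star_subalgebra_def
proof (intro conjI)
  have vA: "vec A" using A by auto
  note W = lin_subspaceD[OF vA B(1)]
  show "subring B A"
    by (rule ring.subringI[OF star_alg_ring[OF A]]) (use W B vec_minus_eq[OF vA] in auto)
qed (use assms in auto)

lemma star_subalgebraD: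
  assumes "is_star_algebra A" "star_subalgebra B A"
  shows "lin_subspace B A" "B \<subseteq> carrier A" "\<one>\<^bsub>A\<^esub> \<in> B" "x \<in> B \<Longrightarrow> y \<in> B \<Longrightarrow> x \<otimes>\<^bsub>A\<^esub> y \<in> B"
    "x \<in> B \<Longrightarrow> y \<in> B \<Longrightarrow> x \<oplus>\<^bsub>A\<^esub> y \<in> B" "x \<in> B \<Longrightarrow> c \<odot>\<^bsub>A\<^esub> x \<in> B" "x \<in> B \<Longrightarrow> star A x \<in> B"
    "\<zero>\<^bsub>A\<^esub> \<in> B"
proof -
  have vA: "vec A" using assms by auto
  have r: "subring B A" and l: "lin_subspace B A" and s: "star A ` B \<subseteq> B"
    using assms(2) by (auto simp: star_subalgebra_def)
  note W = lin_subspaceD[OF vA l]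
  show "lin_subspace B A" "B \<subseteq> carrier A" "x \<in> B \<Longrightarrow> y \<in> B \<Longrightarrow> x \<oplus>\<^bsub>A\<^esub> y \<in> B" "x \<in> B \<Longrightarrow> c \<odot>\<^bsub>A\<^esub> x \<in> B"
    "x \<in> B \<Longrightarrow> star A x \<in> B" "\<zero>\<^bsub>A\<^esub> \<in> B"
    using l W s by auto
  show "\<one>\<^bsub>A\<^esub> \<in> B" "x \<in> B \<Longrightarrow> y \<in> B \<Longrightarrow> x \<otimes>\<^bsub>A\<^esub> y \<in> B"
    using subringE[OF r] by auto
qed

lemma is_star_algebra_subalgebra:
  assumes A: "is_star_algebra A" and B: "star_subalgebra B A"
  shows "is_star_algebra (A\<lparr>carrier := B\<rparr>)"
proof -
  note D = star_subalgebraD[OF A B]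
  have c: "x \<in> carrier A" if "x \<in> B" for x using D(2) that by auto
  show ?thesis
    by (intro star_algI vec_subspace D(1)) (use A D c in \<open>auto simp: star_alg_assoc star_alg_distrib\<close>)
qed

text \<open>Products of combinations expand into combinations of products. It is applied to words of
  prescribed degrees and to powers of \<open>\<xi>\<close>.\<close>

lemma star_subalgebra_lin_span:
  assumes A: "is_star_algebra A" and S: "S \<subseteq> carrier A" "\<one>\<^bsub>A\<^esub> \<in> S"
    "\<And>x y. x \<in> S \<Longrightarrow> y \<in> S \<Longrightarrow> x \<otimes>\<^bsub>A\<^esub> y \<in> S" "\<And>x. x \<in> S \<Longrightarrow> star A x \<in> S"
  shows "star_subalgebra (lin_span A S) A"
proof (rule star_subalgebraI[OF A])
  have vA: "vec A" using A by auto
  show W: "lin_subspace (lin_span A S) A" using vA S by (intro lin_span_subspace)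
  note WD = lin_subspaceD[OF vA W]
  show "\<one>\<^bsub>A\<^esub> \<in> lin_span A S" using S by (intro lin_span_base)
  have 1: "x \<otimes>\<^bsub>A\<^esub> y \<in> lin_span A S" if x: "x \<in> S" and y: "y \<in> lin_span A S" for x y
    using y lin_maps_mult_left[OF A, of x] vA vA S(1) W
    by (rule lin_span_map_into) (use x S in \<open>auto intro: lin_span_base\<close>)
  show "x \<otimes>\<^bsub>A\<^esub> y \<in> lin_span A S" if x: "x \<in> lin_span A S" and y: "y \<in> lin_span A S" for x y
    using x lin_maps_mult_right[OF A, of y] vA vA S(1) W
    by (rule lin_span_map_into) (use y S 1 WD in auto)
  show "star A x \<in> lin_span A S" if "x \<in> lin_span A S" for x
    using that vA S(1)
    by (induction rule: lin_span_induct) (use A WD S in \<open>auto intro: lin_span_base\<close>)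
qed

lemma gen_star_subalgebra_minimal: "star_subalgebra B A \<Longrightarrow> S \<subseteq> B \<Longrightarrow> gen_star_subalgebra A S \<subseteq> B"
  by (auto simp: gen_star_subalgebra_def)

lemma gen_star_subalgebra_greatest:
  assumes "\<And>B. star_subalgebra B A \<Longrightarrow> S \<subseteq> B \<Longrightarrow> V \<subseteq> B"
  shows "V \<subseteq> gen_star_subalgebra A S"
  using assms by (auto simp: gen_star_subalgebra_def)

section \<open>Quotients\<close>

definition selfadjoint_ideal :: "'a set \<Rightarrow> ('a, 'x) star_algebra_scheme \<Rightarrow> bool" where
  "selfadjoint_ideal I A \<longleftrightarrow> is_star_algebra A \<and> ideal I A \<and> star A ` I \<subseteq> I"

lemma selfadjoint_idealI:
  assumes "is_star_algebra A" "lin_subspace I A"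
    and "\<And>a x. a \<in> I \<Longrightarrow> x \<in> carrier A \<Longrightarrow> x \<otimes>\<^bsub>A\<^esub> a \<in> I"
    and "\<And>a x. a \<in> I \<Longrightarrow> x \<in> carrier A \<Longrightarrow> a \<otimes>\<^bsub>A\<^esub> x \<in> I"
    and "\<And>a. a \<in> I \<Longrightarrow> star A a \<in> I"
  shows "selfadjoint_ideal I A"
  unfolding selfadjoint_ideal_def
  using assms by (auto intro!: idealI star_alg_ring submodule.axioms(1))

text \<open>A ring ideal absorbs scalars because
  \<open>c \<odot> x = (c \<odot> \<one>) \<otimes> x\<close>.\<close>

lemma ideal_lin_subspace:
  assumes A: "is_star_algebra A" and I: "ideal I A"
  shows "lin_subspace I A"
proof -
  interpret ideal I A by fact
  have I': "x \<in> carrier A" if "x \<in> I" for x using that by simp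
  have "c \<odot>\<^bsub>A\<^esub> x \<in> I" if "x \<in> I" for c x
    using I_l_closed[OF that, of "c \<odot>\<^bsub>A\<^esub> \<one>\<^bsub>A\<^esub>"] A I'[OF that] by simp
  thus ?thesis
    by (intro lin_subspaceI) (use A I' additive_subgroup.zero_closed[OF is_additive_subgroup] in auto)
qed

context
  fixes I :: "'a set" and A :: "('a, 'x) star_algebra_scheme"
  assumes I: "selfadjoint_ideal I A"
begin

private lemma A: "is_star_algebra A" and idl: "ideal I A" and I_star: "x \<in> I \<Longrightarrow> star A x \<in> I"
  using I by (auto simp: selfadjoint_ideal_def)

private lemma sub: "lin_subspace I A"
  by (rule ideal_lin_subspace[OF A idl])

interpretation A: ideal I A by (rule idl)

private lemma I_carrier: "x \<in> I \<Longrightarrow> x \<in> carrier A"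
  by simp

private lemma mem_coset: "x \<in> carrier A \<Longrightarrow> y \<in> I +>\<^bsub>A\<^esub> x \<longleftrightarrow> (\<exists>i\<in>I. y = i \<oplus>\<^bsub>A\<^esub> x)"
  by (auto simp: a_r_coset_def')

lemma star_quot_class_eq:
  assumes "x \<in> carrier A" "y \<in> carrier A"
  shows "I +>\<^bsub>A\<^esub> x = I +>\<^bsub>A\<^esub> y \<longleftrightarrow> x \<oplus>\<^bsub>A\<^esub> (- 1) \<odot>\<^bsub>A\<^esub> y \<in> I"
proof -
  have "I +>\<^bsub>A\<^esub> x = I +>\<^bsub>A\<^esub> y \<longleftrightarrow> x \<in> I +>\<^bsub>A\<^esub> y"
    using A.a_repr_independenceD[of x y] A.a_repr_independence'[of x y] assms by auto
  also have "\<dots> \<longleftrightarrow> x \<oplus>\<^bsub>A\<^esub> \<ominus>\<^bsub>A\<^esub> y \<in> I"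
    by (rule A.a_rcos_module) (use assms in auto)
  finally show ?thesis using assms by (simp add: vec_minus_eq star_alg_vec[OF A])
qed

lemma star_quot_class_add:
  assumes "x \<in> carrier A" "i \<in> I"
  shows "I +>\<^bsub>A\<^esub> (i \<oplus>\<^bsub>A\<^esub> x) = I +>\<^bsub>A\<^esub> x"
proof -
  have "i \<oplus>\<^bsub>A\<^esub> x \<oplus>\<^bsub>A\<^esub> (- 1) \<odot>\<^bsub>A\<^esub> x = i"
    using assms I_carrier[of i] A by (simp add: vec_add_assoc)
  thus ?thesis using assms I_carrier[of i] A by (simp add: star_quot_class_eq)
qed

lemma star_quot_carrier: "carrier (star_quot A I) = (\<lambda>x. I +>\<^bsub>A\<^esub> x) ` carrier A"
  by (auto simp: star_quot_def A_RCOSETS_def')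

lemma star_quot_zero_eq: "\<zero>\<^bsub>star_quot A I\<^esub> = I +>\<^bsub>A\<^esub> \<zero>\<^bsub>A\<^esub>"
  using A.a_rcos_const[of "\<zero>\<^bsub>A\<^esub>"] by (simp add: star_quot_def)

lemma star_quot_one: "\<one>\<^bsub>star_quot A I\<^esub> = I +>\<^bsub>A\<^esub> \<one>\<^bsub>A\<^esub>"
  by (simp add: star_quot_def)

lemma star_quot_ops:
  assumes x: "x \<in> carrier A"
  shows "y \<in> carrier A \<Longrightarrow> (I +>\<^bsub>A\<^esub> x) \<oplus>\<^bsub>star_quot A I\<^esub> (I +>\<^bsub>A\<^esub> y) = I +>\<^bsub>A\<^esub> (x \<oplus>\<^bsub>A\<^esub> y)"
    and "y \<in> carrier A \<Longrightarrow> (I +>\<^bsub>A\<^esub> x) \<otimes>\<^bsub>star_quot A I\<^esub> (I +>\<^bsub>A\<^esub> y) = I +>\<^bsub>A\<^esub> (x \<otimes>\<^bsub>A\<^esub> y)"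
    and "c \<odot>\<^bsub>star_quot A I\<^esub> (I +>\<^bsub>A\<^esub> x) = I +>\<^bsub>A\<^esub> (c \<odot>\<^bsub>A\<^esub> x)"
    and "star (star_quot A I) (I +>\<^bsub>A\<^esub> x) = I +>\<^bsub>A\<^esub> star A x"
proof -
  have vA: "vec A" using A by auto
  note W = lin_subspaceD[OF vA sub]
  show "y \<in> carrier A \<Longrightarrow> (I +>\<^bsub>A\<^esub> x) \<oplus>\<^bsub>star_quot A I\<^esub> (I +>\<^bsub>A\<^esub> y) = I +>\<^bsub>A\<^esub> (x \<oplus>\<^bsub>A\<^esub> y)"
    using A.a_rcos_sum x by (simp add: star_quot_def)
  show "y \<in> carrier A \<Longrightarrow> (I +>\<^bsub>A\<^esub> x) \<otimes>\<^bsub>star_quot A I\<^esub> (I +>\<^bsub>A\<^esub> y) = I +>\<^bsub>A\<^esub> (x \<otimes>\<^bsub>A\<^esub> y)"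
    using A.rcoset_mult_add x by (simp add: star_quot_def)
  \<comment> \<open>Scaling of a coset is defined as a union over its representatives; they all
    yield the same coset, so the union is that coset.\<close>
  have "I +>\<^bsub>A\<^esub> (c \<odot>\<^bsub>A\<^esub> y) = I +>\<^bsub>A\<^esub> (c \<odot>\<^bsub>A\<^esub> x)" if y: "y \<in> I +>\<^bsub>A\<^esub> x" for y
  proof -
    obtain i where "i \<in> I" "y = i \<oplus>\<^bsub>A\<^esub> x" using y mem_coset[OF x] by auto
    thus ?thesis using x vA W(4)[of i c] I_carrier[of i]
      by (simp add: vec_smult_distrib star_quot_class_add)
  qed
  moreover have "x \<in> I +>\<^bsub>A\<^esub> x" using A.a_rcos_self x by simp
  ultimately have "(\<Union>y\<in>I +>\<^bsub>A\<^esub> x. I +>\<^bsub>A\<^esub> (c \<odot>\<^bsub>A\<^esub> y)) = I +>\<^bsub>A\<^esub> (c \<odot>\<^bsub>A\<^esub> x)" by blast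
  thus "c \<odot>\<^bsub>star_quot A I\<^esub> (I +>\<^bsub>A\<^esub> x) = I +>\<^bsub>A\<^esub> (c \<odot>\<^bsub>A\<^esub> x)" by (simp add: star_quot_def)
  have "star A ` (I +>\<^bsub>A\<^esub> x) = I +>\<^bsub>A\<^esub> star A x"
  proof (intro Set.set_eqI iffI)
    fix y assume "y \<in> star A ` (I +>\<^bsub>A\<^esub> x)"
    then obtain i where "i \<in> I" "y = star A (i \<oplus>\<^bsub>A\<^esub> x)" using mem_coset[OF x] by auto
    thus "y \<in> I +>\<^bsub>A\<^esub> star A x" using A x I_star[of i] I_carrier[of i] mem_coset[of "star A x"] by auto
  next
    fix y assume "y \<in> I +>\<^bsub>A\<^esub> star A x"
    then obtain i where i: "i \<in> I" "y = i \<oplus>\<^bsub>A\<^esub> star A x" using mem_coset[of "star A x"] x A by auto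
    \<comment> \<open>\<open>star\<close> is involutive, so the element
      \<open>star A i \<oplus> x\<close> of the coset is the preimage; \<open>star A i\<close> is
      again in \<open>I\<close>.\<close>
    have "star A i \<oplus>\<^bsub>A\<^esub> x \<in> I +>\<^bsub>A\<^esub> x" "y = star A (star A i \<oplus>\<^bsub>A\<^esub> x)"
      using i A x I_star[of i] I_carrier[of i] mem_coset[of x] by auto
    thus "y \<in> star A ` (I +>\<^bsub>A\<^esub> x)" by auto
  qed
  thus "star (star_quot A I) (I +>\<^bsub>A\<^esub> x) = I +>\<^bsub>A\<^esub> star A x" by (simp add: star_quot_def)
qed

lemma is_star_algebra_star_quot: "is_star_algebra (star_quot A I)"
proof -
  have vA: "vec A" using A by auto
  show ?thesis
    by (intro star_algI vecI)
      (auto simp: star_quot_carrier star_quot_ops star_quot_zero_eq star_quot_one A vA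
        star_alg_assoc[OF A] star_alg_distrib[OF A] vec_ac[OF vA] vec_smult_add[OF vA]
        vec_smult_distrib[OF vA])
qed

lemma star_quot_class_hom: "(\<lambda>x. I +>\<^bsub>A\<^esub> x) \<in> star_alg_hom A (star_quot A I)"
  by (intro star_alg_homI lin_mapsI) (auto simp: star_quot_carrier star_quot_ops star_quot_one)

lemma star_quot_class_eq_zero: "x \<in> carrier A \<Longrightarrow> I +>\<^bsub>A\<^esub> x = \<zero>\<^bsub>star_quot A I\<^esub> \<longleftrightarrow> x \<in> I"
  using star_quot_class_eq[of x "\<zero>\<^bsub>A\<^esub>"] A by (simp add: star_quot_zero_eq)

text \<open>\<open>g\<close> evaluates \<open>f\<close> at a chosen representative. Two
  representatives differ by an element of \<open>I\<close>, which \<open>f\<close> kills.\<close>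

lemma star_quot_lift:
  assumes f: "f \<in> linear_maps A M" and M: "vec M" and k: "\<And>x. x \<in> I \<Longrightarrow> f x = \<zero>\<^bsub>M\<^esub>"
  obtains g where "g \<in> linear_maps (star_quot A I) M" "\<And>x. x \<in> carrier A \<Longrightarrow> g (I +>\<^bsub>A\<^esub> x) = f x"
proof -
  have vA: "vec A" using A by auto
  define g where "g = (\<lambda>C. f (SOME x. x \<in> carrier A \<and> C = I +>\<^bsub>A\<^esub> x))"
  have g: "g (I +>\<^bsub>A\<^esub> x) = f x" if x: "x \<in> carrier A" for x
  proof -
    define y where "y = (SOME y. y \<in> carrier A \<and> I +>\<^bsub>A\<^esub> x = I +>\<^bsub>A\<^esub> y)"
    have y: "y \<in> carrier A \<and> I +>\<^bsub>A\<^esub> x = I +>\<^bsub>A\<^esub> y"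
      unfolding y_def by (rule someI[of _ x]) (use x in auto)
    hence "x \<oplus>\<^bsub>A\<^esub> (- 1) \<odot>\<^bsub>A\<^esub> y \<in> I" using star_quot_class_eq x by auto
    from k[OF this] have "f x \<oplus>\<^bsub>M\<^esub> (- 1) \<odot>\<^bsub>M\<^esub> f y = \<zero>\<^bsub>M\<^esub>"
      using lin_mapsD[OF f] x y vA by simp
    hence "f x = f y"
      by (rule vec_diff_eq_zero[rotated -1]) (use lin_mapsD[OF f] x y M in auto)
    thus ?thesis by (simp add: g_def y_def)
  qed
  have "g \<in> linear_maps (star_quot A I) M"
    by (rule lin_mapsI) (auto simp: star_quot_carrier star_quot_ops g vA lin_mapsD[OF f])
  thus ?thesis using g that by blast
qed

end

section \<open>Monoid algebras\<close>

lemma pm_sum_singles: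
  fixes p :: "'a \<Rightarrow>\<^sub>0 'b::comm_monoid_add"
  assumes "finite U" "Poly_Mapping.keys p \<subseteq> U"
  shows "p = (\<Sum>u\<in>U. Poly_Mapping.single u (Poly_Mapping.lookup p u))"
  by (rule poly_mapping_eqI)
    (use assms in \<open>auto simp: lookup_sum lookup_single when_def sum.delta in_keys_iff subset_iff\<close>)

lemma pm_induct [consumes 1, case_names zero single add]:
  fixes p :: "'a \<Rightarrow>\<^sub>0 'b::comm_monoid_add"
  assumes "Poly_Mapping.keys p \<subseteq> C" "P 0"
    and "\<And>u c. u \<in> C \<Longrightarrow> P (Poly_Mapping.single u c)"
    and "\<And>p p'. Poly_Mapping.keys p \<subseteq> C \<Longrightarrow> Poly_Mapping.keys p' \<subseteq> C \<Longrightarrow> P p \<Longrightarrow> P p' \<Longrightarrow> P (p + p')"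
  shows "P p"
proof -
  \<comment> \<open>The bound on the support is carried along because the additive case of the rule
    requires it.\<close>
  have "finite U \<Longrightarrow> U \<subseteq> C \<Longrightarrow>
    P (\<Sum>u\<in>U. Poly_Mapping.single u (Poly_Mapping.lookup p u)) \<and>
    Poly_Mapping.keys (\<Sum>u\<in>U. Poly_Mapping.single u (Poly_Mapping.lookup p u)) \<subseteq> C" for U
  proof (induction U rule: finite_induct)
    case (insert x F)
    have "Poly_Mapping.keys (Poly_Mapping.single x (Poly_Mapping.lookup p x)) \<subseteq> C"
      using insert.prems by auto
    with insert show ?case
      by (auto intro!: assms(3,4) dest!: subsetD[OF Poly_Mapping.keys_add])
  qed (use assms(2) in auto)
  from this[of "Poly_Mapping.keys p"] assms(1) pm_sum_singles[of "Poly_Mapping.keys p" p]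
  show ?thesis by auto
qed

lemma lookup_pm_scale [simp]:
  "Poly_Mapping.lookup (Poly_Mapping.map ((*) c) p) k = c * Poly_Mapping.lookup p (k :: 'a)"
  for c :: "'b::mult_zero"
  by (simp add: map.rep_eq when_def)

lemma pm_scale_sum: "Poly_Mapping.map ((*) (c::complex)) (sum f Z) = (\<Sum>x\<in>Z. Poly_Mapping.map ((*) c) (f x))"
  by (rule poly_mapping_eqI) (simp add: lookup_sum sum_distrib_left)

lemma monoid_alg_simps [simp]:
  "carrier (monoid_alg G s) = {p. Poly_Mapping.keys p \<subseteq> carrier G}"
  "\<zero>\<^bsub>monoid_alg G s\<^esub> = 0" "p \<oplus>\<^bsub>monoid_alg G s\<^esub> p' = p + p'"
  "c \<odot>\<^bsub>monoid_alg G s\<^esub> p = Poly_Mapping.map ((*) c) p"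
  "\<one>\<^bsub>monoid_alg G s\<^esub> = Poly_Mapping.single \<one>\<^bsub>G\<^esub> 1"
  by (simp_all add: monoid_alg_def)

lemma keys_pm_scale: "Poly_Mapping.keys (Poly_Mapping.map ((*) (c::complex)) p) \<subseteq> Poly_Mapping.keys p"
  by (auto simp: in_keys_iff)

lemma vec_monoid_alg [simp]: "vec (monoid_alg G s)"
proof (rule vecI)
  show "x \<oplus>\<^bsub>monoid_alg G s\<^esub> y \<in> carrier (monoid_alg G s)"
    if "x \<in> carrier (monoid_alg G s)" "y \<in> carrier (monoid_alg G s)" for x y
    using that Poly_Mapping.keys_add[of x y] by auto
  show "c \<odot>\<^bsub>monoid_alg G s\<^esub> x \<in> carrier (monoid_alg G s)" if "x \<in> carrier (monoid_alg G s)" for c x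
    using that keys_pm_scale[of c x] by auto
qed (auto intro!: poly_mapping_eqI simp: lookup_add algebra_simps)

text \<open>Defining relations are written with the minus of the type class; this translates it into
  the operations that \<open>linear_maps\<close> refers to.\<close>

lemma monoid_alg_diff: "p - p' = p \<oplus>\<^bsub>monoid_alg G s\<^esub> (- 1) \<odot>\<^bsub>monoid_alg G s\<^esub> p'"
  by (auto intro!: poly_mapping_eqI simp: lookup_add lookup_minus)

lemma monoid_alg_carrier_diff:
  "p \<in> carrier (monoid_alg G s) \<Longrightarrow> p' \<in> carrier (monoid_alg G s) \<Longrightarrow> p - p' \<in> carrier (monoid_alg G s)"
  by (subst monoid_alg_diff[of _ _ G s]) (simp del: monoid_alg_simps)

lemma lin_maps_monoid_alg_diff:
  assumes "f \<in> linear_maps (monoid_alg G s) M" "p \<in> carrier (monoid_alg G s)" "p' \<in> carrier (monoid_alg G s)"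
  shows "f (p - p') = f p \<oplus>\<^bsub>M\<^esub> (- 1) \<odot>\<^bsub>M\<^esub> f p'"
  using lin_mapsD[OF assms(1)] assms(2,3)
  by (subst monoid_alg_diff[of _ _ G s]) (simp del: monoid_alg_simps)

lemma monoid_alg_span:
  "carrier (monoid_alg G s) = lin_span (monoid_alg G s) ((\<lambda>u. Poly_Mapping.single u 1) ` carrier G)"
    (is "_ = lin_span ?A ?S")
proof
  have S: "?S \<subseteq> carrier ?A" by auto
  note W = lin_subspaceD[OF vec_monoid_alg lin_span_subspace[OF vec_monoid_alg S]]
  show "lin_span ?A ?S \<subseteq> carrier ?A" using W(1) .
  have "p \<in> lin_span ?A ?S" if "Poly_Mapping.keys p \<subseteq> carrier G" for p
    using that
  proof (induction p rule: pm_induct)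
    case zero show ?case using W(2) by simp
  next
    case (single u c)
    have "Poly_Mapping.single u 1 \<in> lin_span ?A ?S" using single by (intro lin_span_base) auto
    from W(4)[OF this, of c] show ?case by simp
  next
    case (add p p') thus ?case using W(3)[of p p'] by simp
  qed
  thus "carrier ?A \<subseteq> lin_span ?A ?S" by auto
qed

definition lin_ext :: "('b, 'y) star_algebra_scheme \<Rightarrow> ('a \<Rightarrow> 'b) \<Rightarrow> ('a \<Rightarrow>\<^sub>0 complex) \<Rightarrow> 'b" where
  "lin_ext M f p = finsum M (\<lambda>u. Poly_Mapping.lookup p u \<odot>\<^bsub>M\<^esub> f u) (Poly_Mapping.keys p)"

text \<open>The support of a sum depends on cancellation. Additivity is therefore compared over one
  finite index set that contains all supports involved.\<close>

lemma lin_ext_superset: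
  assumes "vec M" "f \<in> carrier G \<rightarrow> carrier M" "finite U" "U \<subseteq> carrier G" "Poly_Mapping.keys p \<subseteq> U"
  shows "lin_ext M f p = finsum M (\<lambda>u. Poly_Mapping.lookup p u \<odot>\<^bsub>M\<^esub> f u) U"
proof -
  interpret M: abelian_group M by (rule vec_abelian_group) fact
  have c: "f u \<in> carrier M" if "u \<in> U" for u using assms that by auto
  show ?thesis unfolding lin_ext_def
    by (rule M.add.finprod_mono_neutral_cong_left) (use assms c in \<open>auto simp: in_keys_iff\<close>)
qed

lemma lin_ext_linear:
  assumes M: "vec M" and f: "f \<in> carrier G \<rightarrow> carrier M"
  shows "lin_ext M f \<in> linear_maps (monoid_alg G s) M"
proof (rule lin_mapsI)
  interpret M: abelian_group M by (rule vec_abelian_group) fact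
  fix p assume p: "p \<in> carrier (monoid_alg G s)"
  hence c: "f u \<in> carrier M" if "u \<in> Poly_Mapping.keys p" for u using f that by auto
  show "lin_ext M f p \<in> carrier M" unfolding lin_ext_def
    by (rule M.finsum_closed) (use M c in auto)
  show "lin_ext M f (d \<odot>\<^bsub>monoid_alg G s\<^esub> p) = d \<odot>\<^bsub>M\<^esub> lin_ext M f p" for d
  proof -
    have "lin_ext M f (d \<odot>\<^bsub>monoid_alg G s\<^esub> p) =
        finsum M (\<lambda>u. Poly_Mapping.lookup (Poly_Mapping.map ((*) d) p) u \<odot>\<^bsub>M\<^esub> f u) (Poly_Mapping.keys p)"
      using p keys_pm_scale[of d p] by (simp only: monoid_alg_simps) (rule lin_ext_superset[OF M f], auto)
    also have "\<dots> = finsum M (\<lambda>u. d \<odot>\<^bsub>M\<^esub> (Poly_Mapping.lookup p u \<odot>\<^bsub>M\<^esub> f u)) (Poly_Mapping.keys p)"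
      by (rule M.finsum_cong') (use M c in auto)
    also have "\<dots> = d \<odot>\<^bsub>M\<^esub> lin_ext M f p"
      unfolding lin_ext_def
      by (rule Module.module.finsum_smult_ldistr[OF M, symmetric]) (use M c in auto)
    finally show ?thesis .
  qed
  fix p' assume p': "p' \<in> carrier (monoid_alg G s)"
  define U where "U = Poly_Mapping.keys p \<union> Poly_Mapping.keys p'"
  have U: "finite U" "U \<subseteq> carrier G" "Poly_Mapping.keys (p + p') \<subseteq> U" "Poly_Mapping.keys p \<subseteq> U"
    "Poly_Mapping.keys p' \<subseteq> U"
    using p p' Poly_Mapping.keys_add[of p p'] by (auto simp: U_def)
  have c: "f u \<in> carrier M" if "u \<in> U" for u using f that U by auto
  have "lin_ext M f (p + p') = finsum M (\<lambda>u. Poly_Mapping.lookup p u \<odot>\<^bsub>M\<^esub> f u \<oplus>\<^bsub>M\<^esub> Poly_Mapping.lookup p' u \<odot>\<^bsub>M\<^esub> f u) U"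
    unfolding lin_ext_superset[OF M f U(1,2,3)] lookup_add
    by (rule M.finsum_cong') (use M c in \<open>auto simp: vec_smult_add\<close>)
  also have "\<dots> = lin_ext M f p \<oplus>\<^bsub>M\<^esub> lin_ext M f p'"
    unfolding lin_ext_superset[OF M f U(1,2,4)] lin_ext_superset[OF M f U(1,2,5)]
    by (rule M.finsum_addf) (use M c in auto)
  finally show "lin_ext M f (p \<oplus>\<^bsub>monoid_alg G s\<^esub> p') = lin_ext M f p \<oplus>\<^bsub>M\<^esub> lin_ext M f p'" by simp
qed

lemma lin_ext_single:
  assumes "vec M" "f u \<in> carrier M"
  shows "lin_ext M f (Poly_Mapping.single u c) = c \<odot>\<^bsub>M\<^esub> f u"
proof -
  interpret M: abelian_group M by (rule vec_abelian_group) fact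
  show ?thesis using assms by (cases "c = 0") (auto simp: lin_ext_def)
qed

definition inv_monoid :: "('a, 'x) monoid_scheme \<Rightarrow> ('a \<Rightarrow> 'a) \<Rightarrow> bool" where
  "inv_monoid G s \<longleftrightarrow> Group.monoid G \<and> s \<in> carrier G \<rightarrow> carrier G \<and> (\<forall>x\<in>carrier G. s (s x) = x) \<and>
     (\<forall>x\<in>carrier G. \<forall>y\<in>carrier G. s (x \<otimes>\<^bsub>G\<^esub> y) = s y \<otimes>\<^bsub>G\<^esub> s x)"

text \<open>With index sets larger than the supports, bilinearity of the product becomes a
  rearrangement of finite sums.\<close>

lemma monoid_alg_mult_superset:
  assumes "finite U" "finite V" "Poly_Mapping.keys p \<subseteq> U" "Poly_Mapping.keys p' \<subseteq> V"
  shows "p \<otimes>\<^bsub>monoid_alg G s\<^esub> p' = (\<Sum>u\<in>U. \<Sum>v\<in>V.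
     Poly_Mapping.single (u \<otimes>\<^bsub>G\<^esub> v) (Poly_Mapping.lookup p u * Poly_Mapping.lookup p' v))"
proof -
  have "p \<otimes>\<^bsub>monoid_alg G s\<^esub> p' = (\<Sum>u\<in>Poly_Mapping.keys p. \<Sum>v\<in>V.
     Poly_Mapping.single (u \<otimes>\<^bsub>G\<^esub> v) (Poly_Mapping.lookup p u * Poly_Mapping.lookup p' v))"
    unfolding monoid_alg_def using assms
    by (simp, intro sum.cong refl sum.mono_neutral_left) (auto simp: in_keys_iff)
  also have "\<dots> = (\<Sum>u\<in>U. \<Sum>v\<in>V.
     Poly_Mapping.single (u \<otimes>\<^bsub>G\<^esub> v) (Poly_Mapping.lookup p u * Poly_Mapping.lookup p' v))"
    using assms by (intro sum.mono_neutral_left) (auto simp: in_keys_iff)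
  finally show ?thesis .
qed

lemma monoid_alg_mult_single [simp]:
  "Poly_Mapping.single u c \<otimes>\<^bsub>monoid_alg G s\<^esub> Poly_Mapping.single v d = Poly_Mapping.single (u \<otimes>\<^bsub>G\<^esub> v) (c * d)"
  by (subst monoid_alg_mult_superset[of "{u}" "{v}"]) auto

lemma monoid_alg_mult_zero [simp]:
  "0 \<otimes>\<^bsub>monoid_alg G s\<^esub> p = 0" "p \<otimes>\<^bsub>monoid_alg G s\<^esub> 0 = 0"
  by (simp_all add: monoid_alg_def)

lemma monoid_alg_mult_add:
  "(p + p') \<otimes>\<^bsub>monoid_alg G s\<^esub> r = p \<otimes>\<^bsub>monoid_alg G s\<^esub> r + p' \<otimes>\<^bsub>monoid_alg G s\<^esub> r" (is ?A)
  "r \<otimes>\<^bsub>monoid_alg G s\<^esub> (p + p') = r \<otimes>\<^bsub>monoid_alg G s\<^esub> p + r \<otimes>\<^bsub>monoid_alg G s\<^esub> p'" (is ?B)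
  "(p - p') \<otimes>\<^bsub>monoid_alg G s\<^esub> r = p \<otimes>\<^bsub>monoid_alg G s\<^esub> r - p' \<otimes>\<^bsub>monoid_alg G s\<^esub> r" (is ?C)
  "r \<otimes>\<^bsub>monoid_alg G s\<^esub> (p - p') = r \<otimes>\<^bsub>monoid_alg G s\<^esub> p - r \<otimes>\<^bsub>monoid_alg G s\<^esub> p'" (is ?D)
proof -
  define U where "U = Poly_Mapping.keys p \<union> Poly_Mapping.keys p'"
  have U: "finite U" "Poly_Mapping.keys (p + p') \<subseteq> U" "Poly_Mapping.keys p \<subseteq> U"
    "Poly_Mapping.keys p' \<subseteq> U" "Poly_Mapping.keys (p - p') \<subseteq> U"
    using Poly_Mapping.keys_add[of p p'] keys_diff[of p p'] by (auto simp: U_def)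
  note * = monoid_alg_mult_superset[of U "Poly_Mapping.keys r"]
    monoid_alg_mult_superset[of "Poly_Mapping.keys r" U]
  show ?A ?B ?C ?D using U
    by (simp_all add: * lookup_add lookup_minus algebra_simps single_add single_diff sum.distrib sum_subtractf)
qed

lemma monoid_alg_mult_scale:
  "Poly_Mapping.map ((*) c) p \<otimes>\<^bsub>monoid_alg G s\<^esub> r = Poly_Mapping.map ((*) c) (p \<otimes>\<^bsub>monoid_alg G s\<^esub> r)" (is ?A)
  "r \<otimes>\<^bsub>monoid_alg G s\<^esub> Poly_Mapping.map ((*) c) p = Poly_Mapping.map ((*) c) (r \<otimes>\<^bsub>monoid_alg G s\<^esub> p)" (is ?B)
proof -
  show ?A ?B using keys_pm_scale[of c p]
    by (simp_all add: monoid_alg_mult_superset[of "Poly_Mapping.keys p" "Poly_Mapping.keys r"]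
      monoid_alg_mult_superset[of "Poly_Mapping.keys r" "Poly_Mapping.keys p"] pm_scale_sum algebra_simps)
qed

lemma monoid_alg_star_superset:
  assumes "finite U" "Poly_Mapping.keys p \<subseteq> U"
  shows "star (monoid_alg G s) p = (\<Sum>u\<in>U. Poly_Mapping.single (s u) (cnj (Poly_Mapping.lookup p u)))"
  unfolding monoid_alg_def using assms
  by (auto intro!: sum.mono_neutral_left simp: in_keys_iff)

lemma monoid_alg_star_single [simp]:
  "star (monoid_alg G s) (Poly_Mapping.single u c) = Poly_Mapping.single (s u) (cnj c)"
  by (subst monoid_alg_star_superset[of "{u}"]) auto

lemma monoid_alg_star_zero [simp]: "star (monoid_alg G s) 0 = 0"
  by (simp add: monoid_alg_def)

lemma monoid_alg_star_add:
  "star (monoid_alg G s) (p + p') = star (monoid_alg G s) p + star (monoid_alg G s) p'" (is ?A)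
  "star (monoid_alg G s) (p - p') = star (monoid_alg G s) p - star (monoid_alg G s) p'" (is ?B)
proof -
  define U where "U = Poly_Mapping.keys p \<union> Poly_Mapping.keys p'"
  have U: "finite U" "Poly_Mapping.keys (p + p') \<subseteq> U" "Poly_Mapping.keys p \<subseteq> U"
    "Poly_Mapping.keys p' \<subseteq> U" "Poly_Mapping.keys (p - p') \<subseteq> U"
    using Poly_Mapping.keys_add[of p p'] keys_diff[of p p'] by (auto simp: U_def)
  show ?A ?B using U
    by (simp_all add: monoid_alg_star_superset[of U] lookup_add lookup_minus single_add single_diff sum.distrib sum_subtractf)
qed

lemma monoid_alg_star_scale:
  "star (monoid_alg G s) (Poly_Mapping.map ((*) c) p) = Poly_Mapping.map ((*) (cnj c)) (star (monoid_alg G s) p)"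
proof -
  show ?thesis using keys_pm_scale[of c p]
    by (simp add: monoid_alg_star_superset[of "Poly_Mapping.keys p"] pm_scale_sum)
qed

lemma monoid_alg_mult_closed:
  assumes "Group.monoid G" "Poly_Mapping.keys p \<subseteq> carrier G" "Poly_Mapping.keys r \<subseteq> carrier G"
  shows "Poly_Mapping.keys (p \<otimes>\<^bsub>monoid_alg G s\<^esub> r) \<subseteq> carrier G"
proof -
  interpret Group.monoid G by fact
  show ?thesis
    unfolding monoid_alg_mult_superset[OF finite_keys finite_keys order.refl order.refl]
    by (intro order.trans[OF Poly_Mapping.keys_sum] UN_least) (use assms(2,3) in auto)
qed

lemma monoid_alg_star_closed:
  assumes "s \<in> carrier G \<rightarrow> carrier G" "Poly_Mapping.keys p \<subseteq> carrier G"
  shows "Poly_Mapping.keys (star (monoid_alg G s) p) \<subseteq> carrier G"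
  unfolding monoid_alg_star_superset[OF finite_keys order.refl]
  by (intro order.trans[OF Poly_Mapping.keys_sum] UN_least) (use assms in auto)

lemma is_star_algebra_monoid_alg:
  assumes G: "inv_monoid G s"
  shows "is_star_algebra (monoid_alg G s)"
proof -
  let ?A = "monoid_alg G s" and ?k = "Poly_Mapping.keys :: ('a \<Rightarrow>\<^sub>0 complex) \<Rightarrow> _"
  have mon: "Group.monoid G" and sc: "s \<in> carrier G \<rightarrow> carrier G"
    and ss: "\<And>x. x \<in> carrier G \<Longrightarrow> s (s x) = x"
    and sm: "\<And>x y. x \<in> carrier G \<Longrightarrow> y \<in> carrier G \<Longrightarrow> s (x \<otimes>\<^bsub>G\<^esub> y) = s y \<otimes>\<^bsub>G\<^esub> s x"
    using G by (auto simp: inv_monoid_def)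
  interpret Group.monoid G by (rule mon)
  have one: "Poly_Mapping.single \<one>\<^bsub>G\<^esub> 1 \<otimes>\<^bsub>?A\<^esub> p = p" "p \<otimes>\<^bsub>?A\<^esub> Poly_Mapping.single \<one>\<^bsub>G\<^esub> 1 = p"
    if "?k p \<subseteq> carrier G" for p
    using that by (induction p rule: pm_induct) (auto simp: monoid_alg_mult_add)
  \<comment> \<open>Associativity starts from basis elements in the first two factors;
    \<open>as2\<close> frees the second factor and \<open>as\<close> the first, each time by
    induction over the support.\<close>
  have as1: "Poly_Mapping.single u c \<otimes>\<^bsub>?A\<^esub> Poly_Mapping.single v d \<otimes>\<^bsub>?A\<^esub> r =
      Poly_Mapping.single u c \<otimes>\<^bsub>?A\<^esub> (Poly_Mapping.single v d \<otimes>\<^bsub>?A\<^esub> r)"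
    if "u \<in> carrier G" "v \<in> carrier G" "?k r \<subseteq> carrier G" for u v c d r
    using that(3) by (induction r rule: pm_induct)
      (use that in \<open>auto simp: monoid_alg_mult_add m_assoc simp del: monoid_alg_mult_single\<close>,
       use that in \<open>auto simp: monoid_alg_mult_add m_assoc mult.assoc\<close>)
  have as2: "Poly_Mapping.single u c \<otimes>\<^bsub>?A\<^esub> p \<otimes>\<^bsub>?A\<^esub> r = Poly_Mapping.single u c \<otimes>\<^bsub>?A\<^esub> (p \<otimes>\<^bsub>?A\<^esub> r)"
    if "u \<in> carrier G" "?k p \<subseteq> carrier G" "?k r \<subseteq> carrier G" for u c p r
    using that(2)
  proof (induction p rule: pm_induct)
    case (single v d) show ?case by (rule as1) (use single that in auto)
  qed (auto simp: monoid_alg_mult_add)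
  have as: "x \<otimes>\<^bsub>?A\<^esub> p \<otimes>\<^bsub>?A\<^esub> r = x \<otimes>\<^bsub>?A\<^esub> (p \<otimes>\<^bsub>?A\<^esub> r)"
    if "?k x \<subseteq> carrier G" "?k p \<subseteq> carrier G" "?k r \<subseteq> carrier G" for x p r
    using that(1)
  proof (induction x rule: pm_induct)
    case (single v d) show ?case by (rule as2) (use single that in auto)
  qed (auto simp: monoid_alg_mult_add)
  have st: "star ?A (star ?A p) = p" if "?k p \<subseteq> carrier G" for p
    using that by (induction p rule: pm_induct) (auto simp: monoid_alg_star_add ss)
  have sm1: "star ?A (Poly_Mapping.single u c \<otimes>\<^bsub>?A\<^esub> p) = star ?A p \<otimes>\<^bsub>?A\<^esub> star ?A (Poly_Mapping.single u c)"
    if "u \<in> carrier G" "?k p \<subseteq> carrier G" for u c p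
    using that(2)
  proof (induction p rule: pm_induct)
    case (single v d) thus ?case using that by (simp add: sm mult.commute)
  next
    case (add p p') thus ?case by (simp add: monoid_alg_star_add monoid_alg_mult_add del: monoid_alg_star_single)
  qed auto
  have sm2: "star ?A (r \<otimes>\<^bsub>?A\<^esub> p) = star ?A p \<otimes>\<^bsub>?A\<^esub> star ?A r"
    if "?k r \<subseteq> carrier G" "?k p \<subseteq> carrier G" for r p
    using that(1)
  proof (induction r rule: pm_induct)
    case (single v d) show ?case by (rule sm1) (use single that in auto)
  qed (auto simp: monoid_alg_star_add monoid_alg_mult_add)
  show ?thesis
    by (rule star_algI)
      (use mon sc in \<open>simp_all add: one as st sm2 monoid_alg_mult_closed monoid_alg_star_closed
         monoid_alg_mult_add monoid_alg_mult_scale monoid_alg_star_add monoid_alg_star_scale\<close>)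
qed

section \<open>Tensor products\<close>

lemma inv_monoid_pairs:
  assumes "is_star_algebra A" "is_star_algebra B"
  shows "inv_monoid (A \<times>\<times> B) (map_prod (star A) (star B))"
  unfolding inv_monoid_def
  using assms by (auto intro!: DirProd_monoid ring.is_monoid star_alg_ring)

lemma bilinear_relationsI:
  "x \<in> carrier A \<Longrightarrow> y \<in> carrier A \<Longrightarrow> b \<in> carrier B \<Longrightarrow>
     Poly_Mapping.single (x \<oplus>\<^bsub>A\<^esub> y, b) 1 - Poly_Mapping.single (x, b) 1 - Poly_Mapping.single (y, b) 1
       \<in> bilinear_relations A B"
  "a \<in> carrier A \<Longrightarrow> u \<in> carrier B \<Longrightarrow> v \<in> carrier B \<Longrightarrow>
     Poly_Mapping.single (a, u \<oplus>\<^bsub>B\<^esub> v) 1 - Poly_Mapping.single (a, u) 1 - Poly_Mapping.single (a, v) 1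
       \<in> bilinear_relations A B"
  "a \<in> carrier A \<Longrightarrow> b \<in> carrier B \<Longrightarrow>
     Poly_Mapping.single (c \<odot>\<^bsub>A\<^esub> a, b) 1 - Poly_Mapping.single (a, b) c \<in> bilinear_relations A B"
  "a \<in> carrier A \<Longrightarrow> b \<in> carrier B \<Longrightarrow>
     Poly_Mapping.single (a, c \<odot>\<^bsub>B\<^esub> b) 1 - Poly_Mapping.single (a, b) c \<in> bilinear_relations A B"
  unfolding bilinear_relations_def by blast+

lemma bilinear_relations_cases:
  assumes "p \<in> bilinear_relations A B"
  obtains
    (add_left) x y b where "x \<in> carrier A" "y \<in> carrier A" "b \<in> carrier B"
      "p = Poly_Mapping.single (x \<oplus>\<^bsub>A\<^esub> y, b) 1 - Poly_Mapping.single (x, b) 1 - Poly_Mapping.single (y, b) 1"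
  | (add_right) a x y where "a \<in> carrier A" "x \<in> carrier B" "y \<in> carrier B"
      "p = Poly_Mapping.single (a, x \<oplus>\<^bsub>B\<^esub> y) 1 - Poly_Mapping.single (a, x) 1 - Poly_Mapping.single (a, y) 1"
  | (smult_left) c a b where "a \<in> carrier A" "b \<in> carrier B"
      "p = Poly_Mapping.single (c \<odot>\<^bsub>A\<^esub> a, b) 1 - Poly_Mapping.single (a, b) c"
  | (smult_right) c a b where "a \<in> carrier A" "b \<in> carrier B"
      "p = Poly_Mapping.single (a, c \<odot>\<^bsub>B\<^esub> b) 1 - Poly_Mapping.single (a, b) c"
  using assms unfolding bilinear_relations_def by blast

definition bilin ::
    "('a, 'x) star_algebra_scheme \<Rightarrow> ('b, 'y) star_algebra_scheme \<Rightarrow> ('c, 'z) star_algebra_scheme \<Rightarrow>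
     ('a \<Rightarrow> 'b \<Rightarrow> 'c) \<Rightarrow> bool" where
  "bilin A B M \<phi> \<longleftrightarrow> (\<forall>a\<in>carrier A. \<phi> a \<in> linear_maps B M) \<and>
     (\<forall>b\<in>carrier B. (\<lambda>a. \<phi> a b) \<in> linear_maps A M)"

lemma bilinI:
  assumes "\<And>a. a \<in> carrier A \<Longrightarrow> \<phi> a \<in> linear_maps B M"
    and "\<And>b. b \<in> carrier B \<Longrightarrow> (\<lambda>a. \<phi> a b) \<in> linear_maps A M"
  shows "bilin A B M \<phi>"
  using assms by (auto simp: bilin_def)

context
  fixes A :: "('a, 'x) star_algebra_scheme" and B :: "('b, 'y) star_algebra_scheme"
  assumes A: "is_star_algebra A" and B: "is_star_algebra B"
begin

private lemma F: "is_star_algebra (free_pairs A B)"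
  unfolding free_pairs_def by (rule is_star_algebra_monoid_alg[OF inv_monoid_pairs[OF A B]])

private lemma vF: "vec (free_pairs A B)"
  using F by auto

private lemma single_carrier:
  "a \<in> carrier A \<Longrightarrow> b \<in> carrier B \<Longrightarrow> Poly_Mapping.single (a, b) c \<in> carrier (free_pairs A B)"
  by (auto simp: free_pairs_def)

private lemma diff_carrier:
  "p \<in> carrier (free_pairs A B) \<Longrightarrow> p' \<in> carrier (free_pairs A B) \<Longrightarrow> p - p' \<in> carrier (free_pairs A B)"
  unfolding free_pairs_def by (rule monoid_alg_carrier_diff)

private lemma rel_carrier: "bilinear_relations A B \<subseteq> carrier (free_pairs A B)"
proof
  fix p assume "p \<in> bilinear_relations A B"
  thus "p \<in> carrier (free_pairs A B)"
    by (cases rule: bilinear_relations_cases) (use A B in \<open>auto intro!: diff_carrier single_carrier\<close>)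
qed

private lemma free_span:
  "carrier (free_pairs A B) = lin_span (free_pairs A B)
     ((\<lambda>u. Poly_Mapping.single u 1) ` (carrier A \<times> carrier B))"
  unfolding free_pairs_def using monoid_alg_span[of "A \<times>\<times> B" "map_prod (star A) (star B)"] by simp

private lemma gens_carrier:
  "(\<lambda>u. Poly_Mapping.single u 1) ` (carrier A \<times> carrier B) \<subseteq> carrier (free_pairs A B)"
  using single_carrier by auto

private lemma null_sub: "lin_subspace (tensor_null A B) (free_pairs A B)"
  unfolding tensor_null_def by (rule lin_span_subspace[OF vF rel_carrier])

text \<open>The reason why a mere linear span is a two-sided ideal: the relations are stable under
  multiplication by basis pairs, and these span the free space.\<close>

private lemma rel_mult:
  assumes p: "p \<in> bilinear_relations A B" and a: "a' \<in> carrier A" and b: "b' \<in> carrier B"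
  shows "Poly_Mapping.single (a', b') 1 \<otimes>\<^bsub>free_pairs A B\<^esub> p \<in> bilinear_relations A B"
    and "p \<otimes>\<^bsub>free_pairs A B\<^esub> Poly_Mapping.single (a', b') 1 \<in> bilinear_relations A B"
proof -
  show "Poly_Mapping.single (a', b') 1 \<otimes>\<^bsub>free_pairs A B\<^esub> p \<in> bilinear_relations A B"
    using p by (cases rule: bilinear_relations_cases)
      (use A B a b in \<open>auto simp: free_pairs_def monoid_alg_mult_add star_alg_distrib intro!: bilinear_relationsI\<close>)
  show "p \<otimes>\<^bsub>free_pairs A B\<^esub> Poly_Mapping.single (a', b') 1 \<in> bilinear_relations A B"
    using p by (cases rule: bilinear_relations_cases)
      (use A B a b in \<open>auto simp: free_pairs_def monoid_alg_mult_add star_alg_distrib intro!: bilinear_relationsI\<close>)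
qed

private lemma rel_star:
  assumes p: "p \<in> bilinear_relations A B"
  shows "star (free_pairs A B) p \<in> bilinear_relations A B"
proof -
  show ?thesis
    using p by (cases rule: bilinear_relations_cases)
      (use A B in \<open>auto simp: free_pairs_def monoid_alg_star_add intro!: bilinear_relationsI\<close>)
qed

private lemma null_mult:
  assumes x: "x \<in> tensor_null A B" and p: "p \<in> carrier (free_pairs A B)"
  shows "p \<otimes>\<^bsub>free_pairs A B\<^esub> x \<in> tensor_null A B" "x \<otimes>\<^bsub>free_pairs A B\<^esub> p \<in> tensor_null A B"
proof -
  let ?F = "free_pairs A B" and ?G = "(\<lambda>u. Poly_Mapping.single u 1) ` (carrier A \<times> carrier B)"
  have base: "s \<otimes>\<^bsub>?F\<^esub> x \<in> tensor_null A B \<and> x \<otimes>\<^bsub>?F\<^esub> s \<in> tensor_null A B" if s: "s \<in> ?G" for s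
  proof
    have sc: "s \<in> carrier ?F" using s gens_carrier by auto
    have x': "x \<in> lin_span ?F (bilinear_relations A B)" using x by (simp add: tensor_null_def)
    show "s \<otimes>\<^bsub>?F\<^esub> x \<in> tensor_null A B"
      by (rule lin_span_map_into[OF x' lin_maps_mult_left[OF F sc] vF vF rel_carrier null_sub])
        (use s rel_mult in \<open>auto simp: tensor_null_def intro!: lin_span_base\<close>)
    show "x \<otimes>\<^bsub>?F\<^esub> s \<in> tensor_null A B"
      by (rule lin_span_map_into[OF x' lin_maps_mult_right[OF F sc] vF vF rel_carrier null_sub])
        (use s rel_mult in \<open>auto simp: tensor_null_def intro!: lin_span_base\<close>)
  qed
  have xc: "x \<in> carrier ?F" using lin_subspaceD(5)[OF vF null_sub x] .
  have p': "p \<in> lin_span ?F ?G" using p free_span by simp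
  show "p \<otimes>\<^bsub>?F\<^esub> x \<in> tensor_null A B"
    by (rule lin_span_map_into[OF p' lin_maps_mult_right[OF F xc] vF vF gens_carrier null_sub])
      (use base in auto)
  show "x \<otimes>\<^bsub>?F\<^esub> p \<in> tensor_null A B"
    by (rule lin_span_map_into[OF p' lin_maps_mult_left[OF F xc] vF vF gens_carrier null_sub])
      (use base in auto)
qed

private lemma null_ideal: "selfadjoint_ideal (tensor_null A B) (free_pairs A B)"
proof (rule selfadjoint_idealI[OF F null_sub])
  fix x assume "x \<in> tensor_null A B"
  hence "x \<in> lin_span (free_pairs A B) (bilinear_relations A B)" by (simp add: tensor_null_def)
  thus "star (free_pairs A B) x \<in> tensor_null A B"
    using vF rel_carrier
    by (induction rule: lin_span_induct)
      (use F vF lin_subspaceD[OF vF null_sub] rel_star in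
        \<open>auto simp: tensor_null_def intro: lin_span_base\<close>)
qed (use null_mult in auto)

lemma is_star_algebra_tensor: "is_star_algebra (tensor A B)"
  unfolding tensor_def by (rule is_star_algebra_star_quot[OF null_ideal])

lemma tens_closed: "a \<in> carrier A \<Longrightarrow> b \<in> carrier B \<Longrightarrow> tens A B a b \<in> carrier (tensor A B)"
  using single_carrier by (auto simp: tens_def tensor_def star_quot_carrier[OF null_ideal])

lemma tens_mult:
  assumes "a \<in> carrier A" "b \<in> carrier B" "a' \<in> carrier A" "b' \<in> carrier B"
  shows "tens A B a b \<otimes>\<^bsub>tensor A B\<^esub> tens A B a' b' = tens A B (a \<otimes>\<^bsub>A\<^esub> a') (b \<otimes>\<^bsub>B\<^esub> b')"
proof -
  have "Poly_Mapping.single (a, b) 1 \<otimes>\<^bsub>free_pairs A B\<^esub> Poly_Mapping.single (a', b') 1 =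
      Poly_Mapping.single (a \<otimes>\<^bsub>A\<^esub> a', b \<otimes>\<^bsub>B\<^esub> b') 1"
    by (simp add: free_pairs_def)
  thus ?thesis
    using assms single_carrier by (simp add: tens_def tensor_def star_quot_ops[OF null_ideal])
qed

lemma tens_star:
  assumes "a \<in> carrier A" "b \<in> carrier B"
  shows "star (tensor A B) (tens A B a b) = tens A B (star A a) (star B b)"
proof -
  have "star (free_pairs A B) (Poly_Mapping.single (a, b) 1) = Poly_Mapping.single (star A a, star B b) 1"
    by (simp add: free_pairs_def)
  thus ?thesis
    using assms single_carrier by (simp add: tens_def tensor_def star_quot_ops[OF null_ideal])
qed

lemma tensor_one: "\<one>\<^bsub>tensor A B\<^esub> = tens A B \<one>\<^bsub>A\<^esub> \<one>\<^bsub>B\<^esub>"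
  by (simp add: tens_def tensor_def star_quot_one[OF null_ideal]) (simp add: free_pairs_def)

private lemma class_rel:
  assumes "p - p' \<in> bilinear_relations A B" "p \<in> carrier (free_pairs A B)" "p' \<in> carrier (free_pairs A B)"
  shows "tensor_null A B +>\<^bsub>free_pairs A B\<^esub> p = tensor_null A B +>\<^bsub>free_pairs A B\<^esub> p'"
proof -
  have "p \<oplus>\<^bsub>free_pairs A B\<^esub> (- 1) \<odot>\<^bsub>free_pairs A B\<^esub> p' = p - p'"
    unfolding free_pairs_def by (rule monoid_alg_diff[symmetric])
  also have "\<dots> \<in> tensor_null A B" unfolding tensor_null_def by (rule lin_span_base[OF assms(1)])
  finally show ?thesis using star_quot_class_eq[OF null_ideal assms(2,3)] by simp
qed

lemma tens_bilin:
  "a \<in> carrier A \<Longrightarrow> tens A B a \<in> linear_maps B (tensor A B)"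
  "b \<in> carrier B \<Longrightarrow> (\<lambda>a. tens A B a b) \<in> linear_maps A (tensor A B)"
proof -
  have sum: "tens A B a b \<oplus>\<^bsub>tensor A B\<^esub> tens A B a' b' =
      tensor_null A B +>\<^bsub>free_pairs A B\<^esub> (Poly_Mapping.single (a, b) 1 + Poly_Mapping.single (a', b') 1)"
    if "a \<in> carrier A" "b \<in> carrier B" "a' \<in> carrier A" "b' \<in> carrier B" for a b a' b'
  proof -
    have "Poly_Mapping.single (a, b) 1 \<oplus>\<^bsub>free_pairs A B\<^esub> Poly_Mapping.single (a', b') 1 =
      Poly_Mapping.single (a, b) 1 + Poly_Mapping.single (a', b') 1" by (simp add: free_pairs_def)
    thus ?thesis using that single_carrier
      by (simp add: tens_def tensor_def star_quot_ops[OF null_ideal])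
  qed
  have sm: "c \<odot>\<^bsub>tensor A B\<^esub> tens A B a b = tensor_null A B +>\<^bsub>free_pairs A B\<^esub> Poly_Mapping.single (a, b) c"
    if "a \<in> carrier A" "b \<in> carrier B" for a b c
  proof -
    have "c \<odot>\<^bsub>free_pairs A B\<^esub> Poly_Mapping.single (a, b) 1 = Poly_Mapping.single (a, b) c"
      by (simp add: free_pairs_def)
    thus ?thesis using that single_carrier
      by (simp add: tens_def tensor_def star_quot_ops[OF null_ideal])
  qed
  have pc: "Poly_Mapping.single (a, b) 1 + Poly_Mapping.single (a', b') 1 \<in> carrier (free_pairs A B)"
    if "a \<in> carrier A" "b \<in> carrier B" "a' \<in> carrier A" "b' \<in> carrier B" for a b a' b'
    using vec_simps(2)[OF vF single_carrier[OF that(1,2), of 1] single_carrier[OF that(3,4), of 1]]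
    by (simp add: free_pairs_def)
  show "tens A B a \<in> linear_maps B (tensor A B)" if a: "a \<in> carrier A"
  proof (rule lin_mapsI)
    show "tens A B a (x \<oplus>\<^bsub>B\<^esub> y) = tens A B a x \<oplus>\<^bsub>tensor A B\<^esub> tens A B a y"
      if "x \<in> carrier B" "y \<in> carrier B" for x y
      unfolding sum[OF a that(1) a that(2)]
      unfolding tens_def
      by (rule class_rel) (use A B a that bilinear_relationsI(2)[of a A x B y] in
        \<open>auto intro: single_carrier pc simp: diff_diff_eq\<close>)
    show "tens A B a (c \<odot>\<^bsub>B\<^esub> x) = c \<odot>\<^bsub>tensor A B\<^esub> tens A B a x" if "x \<in> carrier B" for c x
      unfolding sm[OF a that(1)]
      unfolding tens_def
      by (rule class_rel) (use A B a that in \<open>auto intro: single_carrier bilinear_relationsI\<close>)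
  qed (use a tens_closed in auto)
  show "(\<lambda>a. tens A B a b) \<in> linear_maps A (tensor A B)" if b: "b \<in> carrier B"
  proof (rule lin_mapsI)
    show "tens A B (x \<oplus>\<^bsub>A\<^esub> y) b = tens A B x b \<oplus>\<^bsub>tensor A B\<^esub> tens A B y b"
      if "x \<in> carrier A" "y \<in> carrier A" for x y
      unfolding sum[OF that(1) b that(2) b]
      unfolding tens_def
      by (rule class_rel) (use A B b that bilinear_relationsI(1)[of x A y b B] in
        \<open>auto intro: single_carrier pc simp: diff_diff_eq\<close>)
    show "tens A B (c \<odot>\<^bsub>A\<^esub> x) b = c \<odot>\<^bsub>tensor A B\<^esub> tens A B x b" if "x \<in> carrier A" for c x
      unfolding sm[OF that(1) b]
      unfolding tens_def
      by (rule class_rel) (use A B b that in \<open>auto intro: single_carrier bilinear_relationsI\<close>)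
  qed (use b tens_closed in auto)
qed

lemma tensor_span:
  "carrier (tensor A B) = lin_span (tensor A B) ((\<lambda>(a, b). tens A B a b) ` (carrier A \<times> carrier B))"
    (is "_ = lin_span _ ?S")
proof
  let ?T = "tensor A B" and ?q = "\<lambda>p. tensor_null A B +>\<^bsub>free_pairs A B\<^esub> p"
  have S: "?S \<subseteq> carrier ?T" using tens_closed by auto
  have vT: "vec ?T" using is_star_algebra_tensor by auto
  have W: "lin_subspace (lin_span ?T ?S) ?T" by (rule lin_span_subspace[OF vT S])
  show "lin_span ?T ?S \<subseteq> carrier ?T" by (rule lin_subspaceD(1)[OF vT W])
  have q: "?q \<in> linear_maps (free_pairs A B) ?T"
    unfolding tensor_def using star_alg_homD(1)[OF star_quot_class_hom[OF null_ideal]] .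
  show "carrier ?T \<subseteq> lin_span ?T ?S"
  proof
    fix t assume "t \<in> carrier ?T"
    then obtain p where p: "p \<in> carrier (free_pairs A B)" "t = ?q p"
      by (auto simp: tensor_def star_quot_carrier[OF null_ideal])
    have "p \<in> lin_span (free_pairs A B) ((\<lambda>u. Poly_Mapping.single u 1) ` (carrier A \<times> carrier B))"
      using p(1) free_span by simp
    hence "?q p \<in> lin_span ?T ?S"
      using q vF vT gens_carrier W
      by (rule lin_span_map_into) (auto simp: tens_def intro!: lin_span_base image_eqI[where x = "(a, b)" for a b])
    thus "t \<in> lin_span ?T ?S" using p by simp
  qed
qed

text \<open>Uniqueness in the universal property of the tensor product.\<close>

lemma tensor_eqI:
  assumes "f \<in> linear_maps (tensor A B) M" "g \<in> linear_maps (tensor A B) M" "vec M"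
    and "\<And>a b. a \<in> carrier A \<Longrightarrow> b \<in> carrier B \<Longrightarrow> f (tens A B a b) = g (tens A B a b)"
    and "x \<in> carrier (tensor A B)"
  shows "f x = g x"
proof -
  have "x \<in> lin_span (tensor A B) ((\<lambda>(a, b). tens A B a b) ` (carrier A \<times> carrier B))"
    using assms(5) tensor_span by simp
  thus ?thesis
    by (rule lin_span_map_eq[OF _ assms(1,2)])
      (use assms tens_closed is_star_algebra_tensor in auto)
qed

lemma tensor_intoI:
  assumes "f \<in> linear_maps (tensor A B) M" "vec M" "lin_subspace W M"
    and "\<And>a b. a \<in> carrier A \<Longrightarrow> b \<in> carrier B \<Longrightarrow> f (tens A B a b) \<in> W"
    and "x \<in> carrier (tensor A B)"
  shows "f x \<in> W"
proof -
  have "x \<in> lin_span (tensor A B) ((\<lambda>(a, b). tens A B a b) ` (carrier A \<times> carrier B))"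
    using assms(5) tensor_span by simp
  thus ?thesis
    by (rule lin_span_map_into[OF _ assms(1)])
      (use assms tens_closed is_star_algebra_tensor in auto)
qed

text \<open>\<open>tensor_lift\<close> is a definite description, so existence and uniqueness both
  have to be supplied. The linear extension of \<open>\<phi>\<close> to the free space kills the
  bilinear relations and therefore descends; pure tensors span, which gives uniqueness.\<close>

lemma tensor_lift:
  assumes M: "vec M" and \<phi>: "bilin A B M \<phi>"
  shows "tensor_lift A B M \<phi> \<in> linear_maps (tensor A B) M"
    and "a \<in> carrier A \<Longrightarrow> b \<in> carrier B \<Longrightarrow> tensor_lift A B M \<phi> (tens A B a b) = \<phi> a b"
proof -
  have \<phi>1: "\<phi> a \<in> linear_maps B M" if "a \<in> carrier A" for a using \<phi> that by (simp add: bilin_def)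
  have \<phi>2: "(\<lambda>a. \<phi> a b) \<in> linear_maps A M" if "b \<in> carrier B" for b using \<phi> that by (simp add: bilin_def)
  have \<phi>c: "\<phi> a b \<in> carrier M" if "a \<in> carrier A" "b \<in> carrier B" for a b
    using lin_mapsD(1)[OF \<phi>1] that by auto
  define e where "e = lin_ext M (case_prod \<phi>)"
  have e: "e \<in> linear_maps (free_pairs A B) M"
    unfolding e_def free_pairs_def by (rule lin_ext_linear[OF M]) (use \<phi>c in auto)
  have es: "e (Poly_Mapping.single (a, b) c) = c \<odot>\<^bsub>M\<^esub> \<phi> a b" if "a \<in> carrier A" "b \<in> carrier B" for a b c
    unfolding e_def using lin_ext_single[OF M, of "case_prod \<phi>" "(a, b)"] \<phi>c that by simp
  have ed: "e (p - p') = e p \<oplus>\<^bsub>M\<^esub> (- 1) \<odot>\<^bsub>M\<^esub> e p'"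
    if "p \<in> carrier (free_pairs A B)" "p' \<in> carrier (free_pairs A B)" for p p'
    using lin_maps_monoid_alg_diff[OF e[unfolded free_pairs_def]] that by (simp add: free_pairs_def)
  have zsub: "lin_subspace {\<zero>\<^bsub>M\<^esub>} M" using M by (intro lin_subspaceI) auto
  \<comment> \<open>The shape in which the rewrite rules \<open>vec_ac\<close> leave an additivity
    relation after evaluation by \<open>e\<close>.\<close>
  have cancel: "x \<oplus>\<^bsub>M\<^esub> (y \<oplus>\<^bsub>M\<^esub> ((- 1) \<odot>\<^bsub>M\<^esub> x \<oplus>\<^bsub>M\<^esub> (- 1) \<odot>\<^bsub>M\<^esub> y)) = \<zero>\<^bsub>M\<^esub>"
    if "x \<in> carrier M" "y \<in> carrier M" for x y
    using vec_diff_self[OF M vec_simps(2)[OF M that]] that M by (simp add: vec_smult_distrib vec_add_assoc)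
  have "e p = \<zero>\<^bsub>M\<^esub>" if "p \<in> bilinear_relations A B" for p
    using that
  proof (cases rule: bilinear_relations_cases)
    case (add_left x y b)
    thus ?thesis using cancel[of "\<phi> x b" "\<phi> y b"] A B M \<phi>c lin_mapsD[OF \<phi>2, of b]
      by (simp add: ed es single_carrier diff_carrier vec_smult_distrib vec_ac)
  next
    case (add_right a x y)
    thus ?thesis using cancel[of "\<phi> a x" "\<phi> a y"] A B M \<phi>c lin_mapsD[OF \<phi>1, of a]
      by (simp add: ed es single_carrier diff_carrier vec_smult_distrib vec_ac)
  next
    case (smult_left c a b)
    thus ?thesis using A B M \<phi>c lin_mapsD[OF \<phi>2, of b]
      by (simp add: ed es single_carrier diff_carrier vec_smult_add[symmetric])
  next
    case (smult_right c a b)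
    thus ?thesis using A B M \<phi>c lin_mapsD[OF \<phi>1, of a]
      by (simp add: ed es single_carrier diff_carrier vec_smult_add[symmetric])
  qed
  hence "e p = \<zero>\<^bsub>M\<^esub>" if "p \<in> tensor_null A B" for p
    using lin_span_map_into[OF that[unfolded tensor_null_def] e vF M rel_carrier zsub] by auto
  then obtain g where g: "g \<in> linear_maps (tensor A B) M"
      "\<And>p. p \<in> carrier (free_pairs A B) \<Longrightarrow> g (tensor_null A B +>\<^bsub>free_pairs A B\<^esub> p) = e p"
    unfolding tensor_def using star_quot_lift[OF null_ideal e M] by metis
  have gt: "g (tens A B a b) = \<phi> a b" if "a \<in> carrier A" "b \<in> carrier B" for a b
    using g(2)[OF single_carrier[OF that]] es[OF that] M \<phi>c[OF that] by (simp add: tens_def)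
  \<comment> \<open>The description fixes the values outside the carrier through
    \<open>extensional\<close>; without this the function would not be unique.\<close>
  define g' where "g' = restrict g (carrier (tensor A B))"
  have vT: "vec (tensor A B)" using is_star_algebra_tensor by auto
  have g': "g' \<in> extensional (carrier (tensor A B))" "g' \<in> linear_maps (tensor A B) M"
     "\<forall>a\<in>carrier A. \<forall>b\<in>carrier B. g' (tens A B a b) = \<phi> a b"
    using g(1) gt tens_closed vT by (auto simp: g'_def linear_maps_def)
  have "tensor_lift A B M \<phi> = g'"
    unfolding tensor_lift_def
  proof (rule the_equality)
    fix h assume h: "h \<in> extensional (carrier (tensor A B)) \<and> h \<in> linear_maps (tensor A B) M \<and>
      (\<forall>a\<in>carrier A. \<forall>b\<in>carrier B. h (tens A B a b) = \<phi> a b)"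
    show "h = g'"
    proof (rule extensionalityI)
      fix x assume "x \<in> carrier (tensor A B)"
      thus "h x = g' x" by (rule tensor_eqI[of h M g', rotated -1]) (use h g' M in auto)
    qed (use h g' in auto)
  qed (use g' in auto)
  with g' show "tensor_lift A B M \<phi> \<in> linear_maps (tensor A B) M"
    "a \<in> carrier A \<Longrightarrow> b \<in> carrier B \<Longrightarrow> tensor_lift A B M \<phi> (tens A B a b) = \<phi> a b"
    by auto
qed

end

lemma tensor_simps [simp]:
  assumes "is_star_algebra A" "is_star_algebra B"
  shows "is_star_algebra (tensor A B)"
    and "a \<in> carrier A \<Longrightarrow> b \<in> carrier B \<Longrightarrow> tens A B a b \<in> carrier (tensor A B)"
    and "a \<in> carrier A \<Longrightarrow> b \<in> carrier B \<Longrightarrow> a' \<in> carrier A \<Longrightarrow> b' \<in> carrier B \<Longrightarrow>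
      tens A B a b \<otimes>\<^bsub>tensor A B\<^esub> tens A B a' b' = tens A B (a \<otimes>\<^bsub>A\<^esub> a') (b \<otimes>\<^bsub>B\<^esub> b')"
    and "a \<in> carrier A \<Longrightarrow> b \<in> carrier B \<Longrightarrow>
      star (tensor A B) (tens A B a b) = tens A B (star A a) (star B b)"
    and "a \<in> carrier A \<Longrightarrow> b \<in> carrier B \<Longrightarrow> tens A B (c \<odot>\<^bsub>A\<^esub> a) b = c \<odot>\<^bsub>tensor A B\<^esub> tens A B a b"
    and "a \<in> carrier A \<Longrightarrow> b \<in> carrier B \<Longrightarrow> tens A B a (c \<odot>\<^bsub>B\<^esub> b) = c \<odot>\<^bsub>tensor A B\<^esub> tens A B a b"
  using is_star_algebra_tensor[OF assms] tens_closed[OF assms] tens_mult[OF assms] tens_star[OF assms]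
    lin_mapsD(3)[OF tens_bilin(1)[OF assms]] lin_mapsD(3)[OF tens_bilin(2)[OF assms]] by auto

lemma tens_add:
  assumes "is_star_algebra A" "is_star_algebra B"
  shows "a \<in> carrier A \<Longrightarrow> a' \<in> carrier A \<Longrightarrow> b \<in> carrier B \<Longrightarrow>
      tens A B (a \<oplus>\<^bsub>A\<^esub> a') b = tens A B a b \<oplus>\<^bsub>tensor A B\<^esub> tens A B a' b"
    and "a \<in> carrier A \<Longrightarrow> b \<in> carrier B \<Longrightarrow> b' \<in> carrier B \<Longrightarrow>
      tens A B a (b \<oplus>\<^bsub>B\<^esub> b') = tens A B a b \<oplus>\<^bsub>tensor A B\<^esub> tens A B a b'"
  using lin_mapsD(2)[OF tens_bilin(1)[OF assms]] lin_mapsD(2)[OF tens_bilin(2)[OF assms]] by auto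

lemma tensor_map:
  assumes "is_star_algebra A" "is_star_algebra B" "is_star_algebra A'" "is_star_algebra B'"
    and f: "f \<in> linear_maps A A'" and g: "g \<in> linear_maps B B'"
  shows "tensor_map A B A' B' f g \<in> linear_maps (tensor A B) (tensor A' B')"
    and "a \<in> carrier A \<Longrightarrow> b \<in> carrier B \<Longrightarrow>
      tensor_map A B A' B' f g (tens A B a b) = tens A' B' (f a) (g b)"
proof -
  have b: "bilin A B (tensor A' B') (\<lambda>a b. tens A' B' (f a) (g b))"
  proof (rule bilinI)
    show "(\<lambda>b. tens A' B' (f a) (g b)) \<in> linear_maps B (tensor A' B')" if "a \<in> carrier A" for a
      by (rule lin_maps_compose[OF g tens_bilin(1)]) (use assms lin_mapsD(1)[OF f that] in auto)
    show "(\<lambda>a. tens A' B' (f a) (g b)) \<in> linear_maps A (tensor A' B')" if "b \<in> carrier B" for b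
      by (rule lin_maps_compose[OF f tens_bilin(2)]) (use assms lin_mapsD(1)[OF g that] in auto)
  qed
  have v: "vec (tensor A' B')" using assms by auto
  show "tensor_map A B A' B' f g \<in> linear_maps (tensor A B) (tensor A' B')"
    and "a \<in> carrier A \<Longrightarrow> b \<in> carrier B \<Longrightarrow>
      tensor_map A B A' B' f g (tens A B a b) = tens A' B' (f a) (g b)"
    unfolding tensor_map_def using tensor_lift[OF assms(1,2) v b] by auto
qed

lemma mult_map:
  assumes A: "is_star_algebra A"
  shows "mult_map A \<in> linear_maps (tensor A A) A"
    and "a \<in> carrier A \<Longrightarrow> b \<in> carrier A \<Longrightarrow> mult_map A (tens A A a b) = a \<otimes>\<^bsub>A\<^esub> b"
proof -
  have b: "bilin A A A (\<lambda>a b. a \<otimes>\<^bsub>A\<^esub> b)"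
    by (rule bilinI) (auto intro!: lin_maps_mult_left lin_maps_mult_right A)
  show "mult_map A \<in> linear_maps (tensor A A) A"
    and "a \<in> carrier A \<Longrightarrow> b \<in> carrier A \<Longrightarrow> mult_map A (tens A A a b) = a \<otimes>\<^bsub>A\<^esub> b"
    unfolding mult_map_def using tensor_lift[OF A A _ b] A by auto
qed

lemma tensor_assoc:
  assumes A: "is_star_algebra A" and B: "is_star_algebra B" and C: "is_star_algebra C"
  shows "tensor_assoc A B C \<in> linear_maps (tensor (tensor A B) C) (tensor A (tensor B C))"
    and "a \<in> carrier A \<Longrightarrow> b \<in> carrier B \<Longrightarrow> c \<in> carrier C \<Longrightarrow>
      tensor_assoc A B C (tens (tensor A B) C (tens A B a b) c) = tens A (tensor B C) a (tens B C b c)"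
proof -
  let ?T = "tensor A (tensor B C)"
  let ?\<phi> = "\<lambda>c a b. tens A (tensor B C) a (tens B C b c)"
  let ?L = "\<lambda>c. tensor_lift A B ?T (?\<phi> c)"
  have vT: "vec ?T" using A B C by auto
  have BC: "is_star_algebra (tensor B C)" using B C by auto
  have b: "bilin A B ?T (?\<phi> c)" if c: "c \<in> carrier C" for c
  proof (rule bilinI)
    show "(\<lambda>b. tens A (tensor B C) a (tens B C b c)) \<in> linear_maps B ?T" if "a \<in> carrier A" for a
      by (rule lin_maps_compose[OF tens_bilin(2)[OF B C c] tens_bilin(1)[OF A BC that]])
    show "(\<lambda>a. tens A (tensor B C) a (tens B C b c)) \<in> linear_maps A ?T" if "b \<in> carrier B" for b
      by (rule tens_bilin(2)[OF A BC]) (use that c B C in auto)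
  qed
  note L = tensor_lift[OF A B vT b]
  have b': "bilin (tensor A B) C ?T (\<lambda>x c. ?L c x)"
  proof (rule bilinI)
    fix x assume x: "x \<in> carrier (tensor A B)"
    show "(\<lambda>c. ?L c x) \<in> linear_maps C ?T"
    \<comment> \<open>Linearity of the inner lift in \<open>c\<close> is an equality of linear maps
      in \<open>x\<close>, so it may be checked on pure tensors \<open>x\<close>.\<close>
    proof (rule lin_mapsI)
      show "?L (c \<oplus>\<^bsub>C\<^esub> d) x = ?L c x \<oplus>\<^bsub>?T\<^esub> ?L d x" if "c \<in> carrier C" "d \<in> carrier C" for c d
        by (rule tensor_eqI[OF A B L(1) lin_maps_add[OF L(1) L(1)] vT _ x])
          (use that A B C vT in \<open>auto simp: L tens_add\<close>)
      show "?L (k \<odot>\<^bsub>C\<^esub> c) x = k \<odot>\<^bsub>?T\<^esub> ?L c x" if "c \<in> carrier C" for k c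
        by (rule tensor_eqI[OF A B L(1) lin_maps_smult[OF L(1)] vT _ x])
          (use that A B C vT in \<open>auto simp: L\<close>)
    qed (use lin_mapsD(1)[OF L(1)] x in auto)
  qed (use L in auto)
  have AB: "is_star_algebra (tensor A B)" using A B by auto
  note L' = tensor_lift[OF AB C vT b']
  show "tensor_assoc A B C \<in> linear_maps (tensor (tensor A B) C) (tensor A (tensor B C))"
    unfolding tensor_assoc_def by (rule L'(1))
  show "tensor_assoc A B C (tens (tensor A B) C (tens A B a b) c) = tens A (tensor B C) a (tens B C b c)"
    if "a \<in> carrier A" "b \<in> carrier B" "c \<in> carrier C"
    unfolding tensor_assoc_def using that A B by (simp add: L'(2) L(2))
qed

lemma tensor_incl:
  assumes A: "is_star_algebra A'" and B: "is_star_algebra B'"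
    and F: "is_star_algebra (A'\<lparr>carrier := F\<rparr>)" "F \<subseteq> carrier A'"
    and K: "is_star_algebra (B'\<lparr>carrier := K\<rparr>)" "K \<subseteq> carrier B'"
  shows "tensor_incl (A'\<lparr>carrier := F\<rparr>) (B'\<lparr>carrier := K\<rparr>) A' B' \<in>
      linear_maps (tensor (A'\<lparr>carrier := F\<rparr>) (B'\<lparr>carrier := K\<rparr>)) (tensor A' B')"
    and "a \<in> F \<Longrightarrow> b \<in> K \<Longrightarrow> tensor_incl (A'\<lparr>carrier := F\<rparr>) (B'\<lparr>carrier := K\<rparr>) A' B'
      (tens (A'\<lparr>carrier := F\<rparr>) (B'\<lparr>carrier := K\<rparr>) a b) = tens A' B' a b"
proof -
  have f: "(\<lambda>x. x) \<in> linear_maps (A'\<lparr>carrier := F\<rparr>) A'" "(\<lambda>x. x) \<in> linear_maps (B'\<lparr>carrier := K\<rparr>) B'"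
    by (rule lin_maps_restrict[OF lin_maps_id F(2)], rule lin_maps_restrict[OF lin_maps_id K(2)])
  show "tensor_incl (A'\<lparr>carrier := F\<rparr>) (B'\<lparr>carrier := K\<rparr>) A' B' \<in>
      linear_maps (tensor (A'\<lparr>carrier := F\<rparr>) (B'\<lparr>carrier := K\<rparr>)) (tensor A' B')"
    and "a \<in> F \<Longrightarrow> b \<in> K \<Longrightarrow> tensor_incl (A'\<lparr>carrier := F\<rparr>) (B'\<lparr>carrier := K\<rparr>) A' B'
      (tens (A'\<lparr>carrier := F\<rparr>) (B'\<lparr>carrier := K\<rparr>) a b) = tens A' B' a b"
    unfolding tensor_incl_def
    using tensor_map[OF F(1) K(1) A B f] by auto
qed

section \<open>Hopf algebras spanned by group-like elements\<close>

text \<open>The Laurent polynomials, as the group algebra of the integers, with unitary generator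
  \<open>Poly_Mapping.single 1 1\<close>.\<close>

definition int_alg :: "(int \<Rightarrow>\<^sub>0 complex) star_algebra" where
  "int_alg = monoid_alg \<lparr>carrier = UNIV, monoid.mult = (+), one = 0\<rparr> uminus"

lemma is_star_algebra_int_alg [simp]: "is_star_algebra int_alg"
  unfolding int_alg_def
  by (rule is_star_algebra_monoid_alg) (auto simp: inv_monoid_def intro!: monoidI)

lemma int_alg_simps [simp]:
  "carrier int_alg = UNIV" "\<zero>\<^bsub>int_alg\<^esub> = 0" "p \<oplus>\<^bsub>int_alg\<^esub> p' = p + p'"
  "c \<odot>\<^bsub>int_alg\<^esub> p = Poly_Mapping.map ((*) c) p" "\<one>\<^bsub>int_alg\<^esub> = Poly_Mapping.single 0 1"
  "Poly_Mapping.single m c \<otimes>\<^bsub>int_alg\<^esub> Poly_Mapping.single n d = Poly_Mapping.single (m + n) (c * d)"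
  "star int_alg (Poly_Mapping.single m c) = Poly_Mapping.single (- m) (cnj c)"
  by (simp_all add: int_alg_def)

text \<open>The coordinate map \<open>\<kappa>\<close> encodes linear independence of the
  \<open>g k\<close>: composed with \<open>lin_ext\<close> it allows linear maps on \<open>H\<close>
  to be prescribed on the \<open>g k\<close>. The locale is instantiated both for the circle and for
  its quotient.\<close>

locale group_like_basis =
  fixes H :: "('h, 'y) hopf_algebra_scheme" and g :: "int \<Rightarrow> 'h" and \<kappa> :: "'h \<Rightarrow> int \<Rightarrow>\<^sub>0 complex"
  assumes H [simp]: "is_star_algebra H"
    and g_closed [simp]: "g k \<in> carrier H"
    and g_span: "carrier H \<subseteq> lin_span H (range g)"
    and g_zero: "g 0 = \<one>\<^bsub>H\<^esub>"
    and g_add: "g (k + m) = g k \<otimes>\<^bsub>H\<^esub> g m"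
    and g_star: "star H (g k) = g (- k)"
    and \<kappa>: "\<kappa> \<in> linear_maps H int_alg"
    and \<kappa>_g: "\<kappa> (g k) = Poly_Mapping.single k 1"
    and comult: "comult H \<in> linear_maps H (tensor H H)" "comult H (g k) = tens H H (g k) (g k)"
    and counit: "counit H \<in> linear_maps H complex_alg" "counit H (g k) = 1"
    and antipode: "antipode H \<in> linear_maps H H" "antipode H (g k) = g (- k)"
begin

lemma g_mult [simp]: "g k \<otimes>\<^bsub>H\<^esub> g m = g (k + m)"
  by (simp add: g_add)

lemma vH [simp]: "vec H"
  using H by auto

lemma H_eqI:
  assumes "f \<in> linear_maps H M" "f' \<in> linear_maps H M" "vec M" "\<And>k. f (g k) = f' (g k)" "h \<in> carrier H"
  shows "f h = f' h"
  by (rule lin_span_map_eq[OF subsetD[OF g_span assms(5)] assms(1,2)]) (use assms in auto)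

lemma H_star_alg_hom:
  assumes "f \<in> linear_maps H B" "is_star_algebra B" "f (g 0) = \<one>\<^bsub>B\<^esub>"
    "\<And>k m. f (g (k + m)) = f (g k) \<otimes>\<^bsub>B\<^esub> f (g m)" "\<And>k. f (g (- k)) = star B (f (g k))"
  shows "f \<in> star_alg_hom H B"
  by (rule star_alg_hom_span[OF H assms(2,1) _ g_span]) (use assms in \<open>auto simp: g_star g_zero\<close>)

lemma counit_one [simp]: "counit H \<one>\<^bsub>H\<^esub> = 1"
  using counit(2)[of 0] by (simp add: g_zero)

lemma bilin_counit:
  assumes "is_star_algebra A"
  shows "bilin A H A (\<lambda>x h. counit H h \<odot>\<^bsub>A\<^esub> x)"
  by (rule bilinI) (use assms in \<open>auto intro!: lin_maps_functional counit lin_maps_smult lin_maps_id\<close>)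

text \<open>Each axiom for the coalgebra structure and the antipode equates two linear functions of
  \<open>h\<close>, so it is checked on the \<open>g k\<close>, where group-likeness makes it
  immediate.\<close>

lemma hopf_star_algebra: "hopf_star_algebra H"
  unfolding hopf_star_algebra_def
proof (intro conjI ballI)
  let ?HH = "tensor H H"
  have HH [simp]: "is_star_algebra ?HH" by simp
  have [simp]: "vec ?HH" "vec (tensor ?HH H)" "vec (tensor H ?HH)" by (auto intro!: star_alg_vec)
  note id = lin_maps_id[of H]
  show "is_star_algebra H" by simp
  show "comult H \<in> star_alg_hom H ?HH"
    by (rule H_star_alg_hom[OF comult(1)]) (auto simp: comult(2) tensor_one g_zero[symmetric] g_star)
  show "counit H \<in> star_alg_hom H complex_alg"
    by (rule H_star_alg_hom[OF counit(1)]) (auto simp: counit(2))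
  show "antipode H \<in> linear_maps H H" by (rule antipode)
  fix h assume h: "h \<in> carrier H"
  note m1 = tensor_map[OF H H HH H comult(1) id] and m2 = tensor_map[OF H H H HH id comult(1)]
  show "tensor_assoc H H H (tensor_map H H ?HH H (comult H) (\<lambda>x. x) (comult H h)) =
        tensor_map H H H ?HH (\<lambda>x. x) (comult H) (comult H h)"
  proof (rule H_eqI[OF _ lin_maps_compose[OF comult(1) m2(1)] _ _ h])
    show "(\<lambda>h. tensor_assoc H H H (tensor_map H H ?HH H (comult H) (\<lambda>x. x) (comult H h)))
      \<in> linear_maps H (tensor H ?HH)"
      by (rule lin_maps_compose[OF lin_maps_compose[OF comult(1) m1(1)] tensor_assoc(1)]) auto
  qed (auto simp: comult(2) m1(2) m2(2) tensor_assoc(2))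
  note c2 = tensor_lift[OF H H vH bilin_counit[OF H]]
  show "tensor_lift H H H (\<lambda>x y. counit H y \<odot>\<^bsub>H\<^esub> x) (comult H h) = h"
    by (rule H_eqI[OF lin_maps_compose[OF comult(1) c2(1)] id _ _ h]) (auto simp: comult(2) c2(2) counit(2))
  have b1: "bilin H H H (\<lambda>x y. counit H x \<odot>\<^bsub>H\<^esub> y)"
    using bilin_counit[OF H] by (simp add: bilin_def)
  note c1 = tensor_lift[OF H H vH b1]
  show "tensor_lift H H H (\<lambda>x y. counit H x \<odot>\<^bsub>H\<^esub> y) (comult H h) = h"
    by (rule H_eqI[OF lin_maps_compose[OF comult(1) c1(1)] id _ _ h]) (auto simp: comult(2) c1(2) counit(2))
  have co: "(\<lambda>h. counit H h \<odot>\<^bsub>H\<^esub> \<one>\<^bsub>H\<^esub>) \<in> linear_maps H H"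
    by (rule lin_maps_functional[OF counit(1)]) auto
  have Sc: "antipode H x \<in> carrier H" if "x \<in> carrier H" for x using lin_mapsD(1)[OF antipode(1) that] .
  have b3: "bilin H H H (\<lambda>x y. antipode H x \<otimes>\<^bsub>H\<^esub> y)"
  proof (rule bilinI)
    show "(\<lambda>a. antipode H a \<otimes>\<^bsub>H\<^esub> b) \<in> linear_maps H H" if "b \<in> carrier H" for b
      by (rule lin_maps_compose[OF antipode(1) lin_maps_mult_right[OF H that]])
  qed (auto intro!: lin_maps_mult_left Sc)
  note c3 = tensor_lift[OF H H vH b3]
  show "tensor_lift H H H (\<lambda>x y. antipode H x \<otimes>\<^bsub>H\<^esub> y) (comult H h) = counit H h \<odot>\<^bsub>H\<^esub> \<one>\<^bsub>H\<^esub>"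
    by (rule H_eqI[OF lin_maps_compose[OF comult(1) c3(1)] co _ _ h])
      (auto simp: comult(2) c3(2) counit(2) antipode(2) g_zero[symmetric])
  have b4: "bilin H H H (\<lambda>x y. x \<otimes>\<^bsub>H\<^esub> antipode H y)"
  proof (rule bilinI)
    show "(\<lambda>b. a \<otimes>\<^bsub>H\<^esub> antipode H b) \<in> linear_maps H H" if "a \<in> carrier H" for a
      by (rule lin_maps_compose[OF antipode(1) lin_maps_mult_left[OF H that]])
  qed (auto intro!: lin_maps_mult_right Sc)
  note c4 = tensor_lift[OF H H vH b4]
  show "tensor_lift H H H (\<lambda>x y. x \<otimes>\<^bsub>H\<^esub> antipode H y) (comult H h) = counit H h \<odot>\<^bsub>H\<^esub> \<one>\<^bsub>H\<^esub>"
    by (rule H_eqI[OF lin_maps_compose[OF comult(1) c4(1)] co _ _ h])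
      (auto simp: comult(2) c4(2) counit(2) antipode(2) g_zero[symmetric])
qed

end

section \<open>Comodule algebras graded by the integers\<close>

text \<open>The grading is no separate datum: an element has degree \<open>k\<close> if
  \<open>\<delta>\<close> maps it to its tensor with \<open>g k\<close>, and such elements are
  assumed to span. The comodule axioms follow from this.\<close>

locale graded_comodule = group_like_basis H g \<kappa>
  for H :: "('h, 'y) hopf_algebra_scheme" and g \<kappa> +
  fixes A :: "('a, 'x) star_algebra_scheme" and \<delta> :: "'a \<Rightarrow> (('a \<times> 'h) \<Rightarrow>\<^sub>0 complex) set"
  assumes A [simp]: "is_star_algebra A"
    and \<delta>: "\<delta> \<in> star_alg_hom A (tensor A H)"
    and A_span: "carrier A \<subseteq> lin_span A (\<Union>k. {a \<in> carrier A. \<delta> a = tens A H a (g k)})"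
begin

definition component :: "int \<Rightarrow> 'a set" where
  "component k = {a \<in> carrier A. \<delta> a = tens A H a (g k)}"

abbreviation "AA \<equiv> tensor A A"
abbreviation "AH \<equiv> tensor A H"

lemma vecs [simp]: "vec A" "vec AA" "vec AH" "is_star_algebra AA" "is_star_algebra AH"
  by (auto intro!: star_alg_vec)

lemma componentD: "a \<in> component k \<Longrightarrow> a \<in> carrier A" "a \<in> component k \<Longrightarrow> \<delta> a = tens A H a (g k)"
  by (auto simp: component_def)

lemma component_subset: "(\<Union>k. component k) \<subseteq> carrier A"
  by (auto simp: component_def)

lemma component_span: "a \<in> carrier A \<Longrightarrow> a \<in> lin_span A (\<Union>k. component k)"
  using A_span by (auto simp: component_def)

lemma \<delta>_lin: "\<delta> \<in> linear_maps A AH"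
  using star_alg_homD(1)[OF \<delta>] .

lemma component_mult: "a \<in> component k \<Longrightarrow> b \<in> component m \<Longrightarrow> a \<otimes>\<^bsub>A\<^esub> b \<in> component (k + m)"
  using star_alg_homD(2)[OF \<delta>] by (auto simp: component_def)

lemma component_star: "a \<in> component k \<Longrightarrow> star A a \<in> component (- k)"
  using star_alg_homD(4)[OF \<delta>] by (auto simp: component_def g_star)

lemma component_subspace: "lin_subspace (component k) A"
  by (rule lin_subspaceI)
    (use lin_mapsD[OF \<delta>_lin] lin_maps_zero[OF \<delta>_lin]
      lin_maps_zero[OF tens_bilin(2)[OF A H g_closed[of k]]] in
      \<open>auto simp: component_def tens_add\<close>)

lemma component_one: "\<one>\<^bsub>A\<^esub> \<in> component 0"
  using star_alg_homD(3)[OF \<delta>] by (auto simp: component_def tensor_one g_zero)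

lemma component_zero_subalgebra: "star_subalgebra (component 0) A"
  using component_mult[of _ 0 _ 0] component_star[of _ 0]
  by (intro star_subalgebraI component_subspace component_one) auto

lemma coinvariants_eq: "coinvariants A H \<delta> = component 0"
  by (simp add: coinvariants_def component_def g_zero)

lemma A_eqI:
  assumes "f \<in> linear_maps A M" "f' \<in> linear_maps A M" "vec M"
    "\<And>k a. a \<in> component k \<Longrightarrow> f a = f' a" "a \<in> carrier A"
  shows "f a = f' a"
  by (rule lin_span_map_eq[OF component_span[OF assms(5)] assms(1,2)])
    (use assms component_subset in auto)

text \<open>Homogeneity is imposed on the second factor only, as this is the factor to which
  \<open>ver\<close> applies the coaction.\<close>

lemma AA_intoI:
  assumes "f \<in> linear_maps AA M" "vec M" "lin_subspace W M"
    "\<And>k a b. a \<in> carrier A \<Longrightarrow> b \<in> component k \<Longrightarrow> f (tens A A a b) \<in> W" "x \<in> carrier AA"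
  shows "f x \<in> W"
proof (rule tensor_intoI[OF A A assms(1-3) _ assms(5)])
  fix a b assume a: "a \<in> carrier A" and b: "b \<in> carrier A"
  show "f (tens A A a b) \<in> W"
    by (rule lin_span_map_into[OF component_span[OF b] lin_maps_compose[OF tens_bilin(1)[OF A A a] assms(1)]])
      (use assms a component_subset in auto)
qed

lemma AA_eqI:
  assumes "f \<in> linear_maps AA M" "f' \<in> linear_maps AA M" "vec M"
    "\<And>k a b. a \<in> carrier A \<Longrightarrow> b \<in> component k \<Longrightarrow> f (tens A A a b) = f' (tens A A a b)" "x \<in> carrier AA"
  shows "f x = f' x"
proof (rule tensor_eqI[OF A A assms(1-3) _ assms(5)])
  fix a b assume a: "a \<in> carrier A" and b: "b \<in> carrier A"
  show "f (tens A A a b) = f' (tens A A a b)"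
    by (rule A_eqI[OF lin_maps_compose[OF tens_bilin(1)[OF A A a] assms(1)]
        lin_maps_compose[OF tens_bilin(1)[OF A A a] assms(2)] assms(3) _ b]) (use assms(4) a in auto)
qed

lemma AH_eqI:
  assumes "f \<in> linear_maps AH M" "f' \<in> linear_maps AH M" "vec M"
    "\<And>k a. a \<in> carrier A \<Longrightarrow> f (tens A H a (g k)) = f' (tens A H a (g k))" "x \<in> carrier AH"
  shows "f x = f' x"
proof (rule tensor_eqI[OF A H assms(1-3) _ assms(5)])
  fix a h assume a: "a \<in> carrier A" and h: "h \<in> carrier H"
  show "f (tens A H a h) = f' (tens A H a h)"
    by (rule H_eqI[OF lin_maps_compose[OF tens_bilin(1)[OF A H a] assms(1)]
        lin_maps_compose[OF tens_bilin(1)[OF A H a] assms(2)] assms(3) _ h]) (use assms(4) a in auto)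
qed

text \<open>The map \<open>id \<otimes> \<epsilon>\<close>; its kernel is the space
  \<open>A \<otimes> ker \<epsilon>\<close>, see \<open>tensor_augmentation_eq\<close>.\<close>

definition augment :: "(('a \<times> 'h) \<Rightarrow>\<^sub>0 complex) set \<Rightarrow> 'a" where
  "augment = tensor_lift A H A (\<lambda>x h. counit H h \<odot>\<^bsub>A\<^esub> x)"

lemma augment:
  "augment \<in> linear_maps AH A"
  "a \<in> carrier A \<Longrightarrow> h \<in> carrier H \<Longrightarrow> augment (tens A H a h) = counit H h \<odot>\<^bsub>A\<^esub> a"
  unfolding augment_def using tensor_lift[OF A H vecs(1) bilin_counit[OF A]] by auto

text \<open>On an element of degree \<open>k\<close> both comodule axioms reduce to properties of
  the group-like element \<open>g k\<close>.\<close>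

lemma comodule: "comodule_star_algebra A H \<delta>"
  unfolding comodule_star_algebra_def augment_def[symmetric]
proof (intro conjI ballI)
  let ?HH = "tensor H H"
  have HH [simp]: "is_star_algebra ?HH" by simp
  have [simp]: "vec (tensor A ?HH)" by (auto intro!: star_alg_vec)
  fix a assume a: "a \<in> carrier A"
  note m1 = tensor_map[OF A H vecs(5) H \<delta>_lin lin_maps_id] and m2 = tensor_map[OF A H A HH lin_maps_id comult(1)]
  show "tensor_assoc A H H (tensor_map A H AH H \<delta> (\<lambda>x. x) (\<delta> a)) =
        tensor_map A H A ?HH (\<lambda>x. x) (comult H) (\<delta> a)"
  proof (rule A_eqI[OF _ lin_maps_compose[OF \<delta>_lin m2(1)] _ _ a])
    show "(\<lambda>a. tensor_assoc A H H (tensor_map A H AH H \<delta> (\<lambda>x. x) (\<delta> a))) \<in> linear_maps A (tensor A ?HH)"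
      by (rule lin_maps_compose[OF lin_maps_compose[OF \<delta>_lin m1(1)] tensor_assoc(1)]) auto
  qed (auto simp: componentD comult(2) m1(2) m2(2) tensor_assoc(2))
  show "augment (\<delta> a) = a"
    by (rule A_eqI[OF lin_maps_compose[OF \<delta>_lin augment(1)] lin_maps_id _ _ a])
      (auto simp: componentD augment(2) counit(2))
qed (use \<delta> in auto)

section \<open>The vertical map, horizontal forms and the augmentation\<close>

lemma bilin_ver: "bilin A A AH (\<lambda>a b. tens A H a \<one>\<^bsub>H\<^esub> \<otimes>\<^bsub>AH\<^esub> \<delta> b)"
proof (rule bilinI)
  show "(\<lambda>b. tens A H a \<one>\<^bsub>H\<^esub> \<otimes>\<^bsub>AH\<^esub> \<delta> b) \<in> linear_maps A AH" if "a \<in> carrier A" for a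
    by (rule lin_maps_compose[OF \<delta>_lin lin_maps_mult_left]) (use that in auto)
  show "(\<lambda>a. tens A H a \<one>\<^bsub>H\<^esub> \<otimes>\<^bsub>AH\<^esub> \<delta> b) \<in> linear_maps A AH" if "b \<in> carrier A" for b
    by (rule lin_maps_compose[OF tens_bilin(2) lin_maps_mult_right])
      (use that lin_mapsD(1)[OF \<delta>_lin] in auto)
qed

lemma ver:
  "ver A H \<delta> \<in> linear_maps AA AH"
  "a \<in> carrier A \<Longrightarrow> b \<in> carrier A \<Longrightarrow> ver A H \<delta> (tens A A a b) = tens A H a \<one>\<^bsub>H\<^esub> \<otimes>\<^bsub>AH\<^esub> \<delta> b"
  "a \<in> carrier A \<Longrightarrow> b \<in> component k \<Longrightarrow> ver A H \<delta> (tens A A a b) = tens A H (a \<otimes>\<^bsub>A\<^esub> b) (g k)"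
  unfolding ver_def using tensor_lift[OF A A vecs(3) bilin_ver]
  by (auto simp: componentD)

abbreviation "A0 \<equiv> A\<lparr>carrier := component 0\<rparr>"

lemma A0 [simp]: "is_star_algebra A0"
  by (rule is_star_algebra_subalgebra[OF A component_zero_subalgebra])

lemma component_zero_carrier: "component 0 \<subseteq> carrier A"
  by (auto simp: component_def)

lemmas incl = tensor_incl[OF A A A0 component_zero_carrier A0 component_zero_carrier]

abbreviation "horizontal \<equiv> horizontal_forms A (component 0)"

lemma universal_forms_iff: "\<omega> \<in> universal_forms A \<longleftrightarrow> \<omega> \<in> carrier AA \<and> mult_map A \<omega> = \<zero>\<^bsub>A\<^esub>"
  by (simp add: universal_forms_def a_kernel_eq)

lemma universal_forms_zero_iff:
  "\<omega> \<in> universal_forms A0 \<longleftrightarrow> \<omega> \<in> carrier (tensor A0 A0) \<and> mult_map A0 \<omega> = \<zero>\<^bsub>A\<^esub>"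
  by (simp add: universal_forms_def a_kernel_eq)

lemma zero_subspace: "vec M \<Longrightarrow> lin_subspace {\<zero>\<^bsub>M\<^esub>} M"
  by (rule lin_subspaceI) auto

lemma universal_forms_subspace: "lin_subspace (universal_forms A) AA"
  using lin_subspace_vimage[OF mult_map(1)[OF A] vecs(2,1) zero_subspace[OF vecs(1)]]
  by (simp add: universal_forms_def a_kernel_eq)

lemma horizontal_carrier:
  "{tens A A a \<one>\<^bsub>A\<^esub> \<otimes>\<^bsub>AA\<^esub> tensor_incl A0 A0 A A \<omega> \<otimes>\<^bsub>AA\<^esub> tens A A \<one>\<^bsub>A\<^esub> b
      | a \<omega> b. a \<in> carrier A \<and> \<omega> \<in> universal_forms A0 \<and> b \<in> carrier A} \<subseteq> carrier AA"
  using lin_mapsD(1)[OF incl(1)] by (auto simp: universal_forms_zero_iff)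

lemma horizontal_subspace: "lin_subspace horizontal AA"
  unfolding horizontal_forms_def by (rule lin_span_subspace[OF vecs(2) horizontal_carrier])

lemma incl_sandwich_linear:
  assumes "a \<in> carrier A" "b \<in> carrier A"
  shows "(\<lambda>\<omega>. tens A A a \<one>\<^bsub>A\<^esub> \<otimes>\<^bsub>AA\<^esub> tensor_incl A0 A0 A A \<omega> \<otimes>\<^bsub>AA\<^esub> tens A A \<one>\<^bsub>A\<^esub> b)
    \<in> linear_maps (tensor A0 A0) AA"
  by (rule lin_maps_compose[OF lin_maps_compose[OF incl(1) lin_maps_mult_left] lin_maps_mult_right])
    (use assms in auto)

lemma incl_sandwich_tens:
  assumes "a \<in> carrier A" "b \<in> carrier A" "x \<in> component 0" "y \<in> component 0"
  shows "tens A A a \<one>\<^bsub>A\<^esub> \<otimes>\<^bsub>AA\<^esub> tensor_incl A0 A0 A A (tens A0 A0 x y) \<otimes>\<^bsub>AA\<^esub> tens A A \<one>\<^bsub>A\<^esub> b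
    = tens A A (a \<otimes>\<^bsub>A\<^esub> x) (y \<otimes>\<^bsub>A\<^esub> b)"
  using assms component_zero_carrier by (auto simp: incl(2) subset_iff)

text \<open>If \<open>f\<close> sees \<open>x\<close> and \<open>y\<close> in
  \<open>a x \<otimes> y b\<close> only through the product \<open>x y\<close>, then it sends a
  generator \<open>a \<omega> b\<close> to \<open>h a b\<close> applied to
  \<open>mult_map A0 \<omega>\<close>, which is zero for a universal form
  \<open>\<omega>\<close>.\<close>

lemma horizontal_kills:
  assumes f: "f \<in> linear_maps AA M" and M: "vec M"
    and h: "\<And>a b. a \<in> carrier A \<Longrightarrow> b \<in> carrier A \<Longrightarrow> h a b \<in> linear_maps A M"
    and eq: "\<And>a b x y. a \<in> carrier A \<Longrightarrow> b \<in> carrier A \<Longrightarrow> x \<in> component 0 \<Longrightarrow> y \<in> component 0 \<Longrightarrow>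
      f (tens A A (a \<otimes>\<^bsub>A\<^esub> x) (y \<otimes>\<^bsub>A\<^esub> b)) = h a b (x \<otimes>\<^bsub>A\<^esub> y)"
    and \<omega>: "\<omega> \<in> horizontal"
  shows "f \<omega> = \<zero>\<^bsub>M\<^esub>"
proof -
  have vA0: "vec A0" by (auto intro!: star_alg_vec)
  have "f \<omega> \<in> {\<zero>\<^bsub>M\<^esub>}"
  proof (rule lin_span_map_into[OF \<omega>[unfolded horizontal_forms_def] f vecs(2) M horizontal_carrier
        zero_subspace[OF M]])
    fix s assume "s \<in> {tens A A a \<one>\<^bsub>A\<^esub> \<otimes>\<^bsub>AA\<^esub> tensor_incl A0 A0 A A \<omega> \<otimes>\<^bsub>AA\<^esub> tens A A \<one>\<^bsub>A\<^esub> b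
      | a \<omega> b. a \<in> carrier A \<and> \<omega> \<in> universal_forms A0 \<and> b \<in> carrier A}"
    then obtain a \<omega> b where s: "s = tens A A a \<one>\<^bsub>A\<^esub> \<otimes>\<^bsub>AA\<^esub> tensor_incl A0 A0 A A \<omega> \<otimes>\<^bsub>AA\<^esub> tens A A \<one>\<^bsub>A\<^esub> b"
      "a \<in> carrier A" "b \<in> carrier A" "\<omega> \<in> universal_forms A0" by auto
    have \<omega>': "\<omega> \<in> carrier (tensor A0 A0)" "mult_map A0 \<omega> = \<zero>\<^bsub>A\<^esub>"
      using s(4) by (auto simp: universal_forms_zero_iff)
    have "f s = h a b (mult_map A0 \<omega>)"
      unfolding s(1)
    proof (rule tensor_eqI[OF A0 A0 lin_maps_compose[OF incl_sandwich_linear[OF s(2,3)] f] _ M _ \<omega>'(1)])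
      show "(\<lambda>\<omega>. h a b (mult_map A0 \<omega>)) \<in> linear_maps (tensor A0 A0) M"
        by (rule lin_maps_compose[OF mult_map(1)[OF A0] lin_maps_restrict[OF h[OF s(2,3)] component_zero_carrier]])
    qed (use s incl_sandwich_tens eq mult_map(2)[OF A0] in auto)
    also have "\<dots> = \<zero>\<^bsub>M\<^esub>" using \<omega>' lin_maps_zero[OF h[OF s(2,3)] vecs(1) M] by simp
    finally show "f s \<in> {\<zero>\<^bsub>M\<^esub>}" by simp
  qed
  thus ?thesis by simp
qed

text \<open>An instance of \<open>horizontal_kills\<close>: multiplication sends
  \<open>a x \<otimes> y b\<close> to \<open>a (x y) b\<close>.\<close>

lemma horizontal_universal: "horizontal \<subseteq> universal_forms A"
proof
  fix \<omega> assume \<omega>: "\<omega> \<in> horizontal"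
  have "mult_map A \<omega> = \<zero>\<^bsub>A\<^esub>"
  proof (rule horizontal_kills[OF mult_map(1)[OF A] vecs(1) _ _ \<omega>, where h = "\<lambda>a b z. a \<otimes>\<^bsub>A\<^esub> z \<otimes>\<^bsub>A\<^esub> b"])
    show "(\<lambda>z. a \<otimes>\<^bsub>A\<^esub> z \<otimes>\<^bsub>A\<^esub> b) \<in> linear_maps A A" if "a \<in> carrier A" "b \<in> carrier A" for a b
      by (rule lin_maps_compose[OF lin_maps_mult_left lin_maps_mult_right]) (use that in auto)
  qed (auto simp: mult_map(2) componentD star_alg_assoc)
  thus "\<omega> \<in> universal_forms A"
    using lin_subspaceD(5)[OF vecs(2) horizontal_subspace \<omega>] by (simp add: universal_forms_iff)
qed

text \<open>Coinvariance of \<open>y\<close> gives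
  \<open>\<delta> (y b) = (y \<otimes> 1) \<delta> b\<close>, so that \<open>ver\<close> depends on
  \<open>x\<close> and \<open>y\<close> only through \<open>x y\<close>.\<close>

lemma ver_horizontal: "\<omega> \<in> horizontal \<Longrightarrow> ver A H \<delta> \<omega> = \<zero>\<^bsub>AH\<^esub>"
proof (rule horizontal_kills[OF ver(1) vecs(3), where h = "\<lambda>a b z. tens A H (a \<otimes>\<^bsub>A\<^esub> z) \<one>\<^bsub>H\<^esub> \<otimes>\<^bsub>AH\<^esub> \<delta> b"])
  fix a b assume ab: "a \<in> carrier A" "b \<in> carrier A"
  show "(\<lambda>z. tens A H (a \<otimes>\<^bsub>A\<^esub> z) \<one>\<^bsub>H\<^esub> \<otimes>\<^bsub>AH\<^esub> \<delta> b) \<in> linear_maps A AH"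
    by (rule lin_maps_compose[OF lin_maps_compose[OF lin_maps_mult_left tens_bilin(2)] lin_maps_mult_right])
      (use ab lin_mapsD(1)[OF \<delta>_lin] in auto)
  fix x y assume xy: "x \<in> component 0" "y \<in> component 0"
  have xy': "x \<in> carrier A" "y \<in> carrier A" using xy componentD by auto
  have "\<delta> (y \<otimes>\<^bsub>A\<^esub> b) = tens A H y \<one>\<^bsub>H\<^esub> \<otimes>\<^bsub>AH\<^esub> \<delta> b"
    using star_alg_homD(2)[OF \<delta>] xy' ab componentD(2)[OF xy(2)] by (simp add: g_zero)
  thus "ver A H \<delta> (tens A A (a \<otimes>\<^bsub>A\<^esub> x) (y \<otimes>\<^bsub>A\<^esub> b)) = tens A H (a \<otimes>\<^bsub>A\<^esub> (x \<otimes>\<^bsub>A\<^esub> y)) \<one>\<^bsub>H\<^esub> \<otimes>\<^bsub>AH\<^esub> \<delta> b"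
    using xy' ab lin_mapsD(1)[OF \<delta>_lin] by (simp add: ver(2) star_alg_assoc[symmetric])
qed auto

text \<open>Because \<open>\<epsilon> (g k) = 1\<close>, applying the counit after
  \<open>ver\<close> forgets the degree. This links the kernel of multiplication with the kernel of
  the augmentation.\<close>

lemma augment_ver: "\<omega> \<in> carrier AA \<Longrightarrow> augment (ver A H \<delta> \<omega>) = mult_map A \<omega>"
  by (rule AA_eqI[OF lin_maps_compose[OF ver(1) augment(1)] mult_map(1)[OF A]])
    (auto simp: ver(3) augment(2) counit(2) mult_map(2) componentD)

lemma augmentation_carrier: "{tens A H a k |a k. a \<in> carrier A \<and> k \<in> carrier H \<and> counit H k = 0} \<subseteq> carrier AH"
  by auto

lemma augmentation_subspace: "lin_subspace (tensor_augmentation A H) AH"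
  unfolding tensor_augmentation_def by (rule lin_span_subspace[OF vecs(3) augmentation_carrier])

text \<open>Describes the span as a kernel. The nontrivial inclusion subtracts from
  \<open>\<zeta>\<close> the tensor of \<open>augment \<zeta>\<close> with the unit, which is zero
  on the kernel.\<close>

lemma tensor_augmentation_eq: "tensor_augmentation A H = {\<zeta> \<in> carrier AH. augment \<zeta> = \<zero>\<^bsub>A\<^esub>}"
proof (intro equalityI subsetI)
  fix \<zeta> assume \<zeta>: "\<zeta> \<in> tensor_augmentation A H"
  have "augment \<zeta> \<in> {\<zero>\<^bsub>A\<^esub>}"
    by (rule lin_span_map_into[OF \<zeta>[unfolded tensor_augmentation_def] augment(1) vecs(3,1)
          augmentation_carrier zero_subspace[OF vecs(1)]]) (auto simp: augment(2))
  thus "\<zeta> \<in> {\<zeta> \<in> carrier AH. augment \<zeta> = \<zero>\<^bsub>A\<^esub>}"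
    using lin_subspaceD(5)[OF vecs(3) augmentation_subspace \<zeta>] by simp
next
  fix \<zeta> assume \<zeta>: "\<zeta> \<in> {\<zeta> \<in> carrier AH. augment \<zeta> = \<zero>\<^bsub>A\<^esub>}"
  \<comment> \<open>On a pure tensor the difference is
    \<open>a \<otimes> (h - \<epsilon>(h) 1)\<close>, and \<open>h - \<epsilon>(h) 1\<close> lies in
    the kernel of the counit.\<close>
  have "\<zeta> \<oplus>\<^bsub>AH\<^esub> (- 1) \<odot>\<^bsub>AH\<^esub> tens A H (augment \<zeta>) \<one>\<^bsub>H\<^esub> \<in> tensor_augmentation A H"
  proof (rule tensor_intoI[OF A H _ vecs(3) augmentation_subspace,
        where f = "\<lambda>\<zeta>. \<zeta> \<oplus>\<^bsub>AH\<^esub> (- 1) \<odot>\<^bsub>AH\<^esub> tens A H (augment \<zeta>) \<one>\<^bsub>H\<^esub>"])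
    show "(\<lambda>\<zeta>. \<zeta> \<oplus>\<^bsub>AH\<^esub> (- 1) \<odot>\<^bsub>AH\<^esub> tens A H (augment \<zeta>) \<one>\<^bsub>H\<^esub>) \<in> linear_maps AH AH"
      by (rule lin_maps_diff[OF lin_maps_id lin_maps_compose[OF augment(1) tens_bilin(2)]]) auto
    fix a h assume a: "a \<in> carrier A" and h: "h \<in> carrier H"
    have "tens A H a h \<oplus>\<^bsub>AH\<^esub> (- 1) \<odot>\<^bsub>AH\<^esub> tens A H (augment (tens A H a h)) \<one>\<^bsub>H\<^esub> =
      tens A H a (h \<oplus>\<^bsub>H\<^esub> (- counit H h) \<odot>\<^bsub>H\<^esub> \<one>\<^bsub>H\<^esub>)"
      using a h by (simp add: augment(2) tens_add)
    moreover have "counit H (h \<oplus>\<^bsub>H\<^esub> (- counit H h) \<odot>\<^bsub>H\<^esub> \<one>\<^bsub>H\<^esub>) = 0"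
      using h lin_mapsD[OF counit(1)] by simp
    ultimately show "tens A H a h \<oplus>\<^bsub>AH\<^esub> (- 1) \<odot>\<^bsub>AH\<^esub> tens A H (augment (tens A H a h)) \<one>\<^bsub>H\<^esub> \<in> tensor_augmentation A H"
      unfolding tensor_augmentation_def using a h
      by (intro lin_span_base CollectI exI[of _ a] exI[of _ "h \<oplus>\<^bsub>H\<^esub> (- counit H h) \<odot>\<^bsub>H\<^esub> \<one>\<^bsub>H\<^esub>"]) simp
  qed (use \<zeta> in auto)
  thus "\<zeta> \<in> tensor_augmentation A H"
    using \<zeta> lin_maps_zero[OF tens_bilin(2)[OF A H, of "\<one>\<^bsub>H\<^esub>"]] by simp
qed

end

section \<open>Strong gradings and the splitting of the vertical map\<close>

locale strongly_graded_comodule = graded_comodule H g \<kappa> A \<delta>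
  for H :: "('h, 'y) hopf_algebra_scheme" and g \<kappa> and A :: "('a, 'x) star_algebra_scheme" and \<delta> +
  assumes strong: "\<one>\<^bsub>A\<^esub> \<in> lin_span A {a \<otimes>\<^bsub>A\<^esub> b | a b. a \<in> component (- k) \<and> b \<in> component k}"
begin

definition opposite :: "int \<Rightarrow> (('a \<times> 'a) \<Rightarrow>\<^sub>0 complex) set set" where
  "opposite k = (\<lambda>(a, b). tens A A a b) ` (component (- k) \<times> component k)"

lemma opposite_carrier: "opposite k \<subseteq> carrier AA"
  using componentD(1) by (auto simp: opposite_def)

lemma opposite_span: "lin_span AA (opposite k) \<subseteq> carrier AA"
  by (rule lin_subspaceD(1)[OF vecs(2) lin_span_subspace[OF vecs(2) opposite_carrier]])

text \<open>The preimages of \<open>1 \<otimes> g k\<close> under the canonical map.\<close>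

definition translation :: "int \<Rightarrow> (('a \<times> 'a) \<Rightarrow>\<^sub>0 complex) set" where
  "translation k = (SOME t. t \<in> lin_span AA (opposite k) \<and> mult_map A t = \<one>\<^bsub>A\<^esub>)"

text \<open>\<open>strong\<close> writes the unit as a combination of products \<open>a b\<close>;
  the same combination of the tensors \<open>a \<otimes> b\<close> is a candidate.\<close>

lemma translation: "translation k \<in> lin_span AA (opposite k)" "mult_map A (translation k) = \<one>\<^bsub>A\<^esub>"
proof -
  have m: "mult_map A (tens A A a b) = a \<otimes>\<^bsub>A\<^esub> b" if "a \<in> component (- k)" "b \<in> component k" for a b
    using mult_map(2)[OF A] componentD(1) that by auto
  have "{a \<otimes>\<^bsub>A\<^esub> b | a b. a \<in> component (- k) \<and> b \<in> component k} \<subseteq> mult_map A ` opposite k"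
  proof clarify
    fix a b assume ab: "a \<in> component (- k)" "b \<in> component k"
    have "tens A A a b \<in> opposite k" unfolding opposite_def using ab by (intro image_eqI[of _ _ "(a, b)"]) auto
    thus "a \<otimes>\<^bsub>A\<^esub> b \<in> mult_map A ` opposite k" using m[OF ab] by (metis imageI)
  qed
  from lin_span_mono[OF this]
  have "\<one>\<^bsub>A\<^esub> \<in> mult_map A ` lin_span AA (opposite k)"
    using strong[of k] lin_span_image_superset[OF mult_map(1)[OF A] vecs(2,1) opposite_carrier[of k]] by auto
  hence "\<exists>t. t \<in> lin_span AA (opposite k) \<and> mult_map A t = \<one>\<^bsub>A\<^esub>" by auto
  from someI_ex[OF this]
  show "translation k \<in> lin_span AA (opposite k)" "mult_map A (translation k) = \<one>\<^bsub>A\<^esub>"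
    by (auto simp: translation_def)
qed

lemma translation_carrier: "translation k \<in> carrier AA"
  using translation(1) opposite_span by auto

text \<open>The chosen tensors are indexed by integers; the coordinates \<open>\<kappa>\<close> turn
  this family into a linear map on \<open>H\<close>.\<close>

definition translation_map :: "'h \<Rightarrow> (('a \<times> 'a) \<Rightarrow>\<^sub>0 complex) set" where
  "translation_map h = lin_ext AA translation (\<kappa> h)"

lemma translation_map: "translation_map \<in> linear_maps H AA" "translation_map (g k) = translation k"
proof -
  have "lin_ext AA translation \<in> linear_maps int_alg AA"
    unfolding int_alg_def by (rule lin_ext_linear) (use translation_carrier in auto)
  from lin_maps_compose[OF \<kappa> this]
  show "translation_map \<in> linear_maps H AA" by (simp add: translation_map_def[abs_def])
  show "translation_map (g k) = translation k"
    using translation_carrier by (simp add: translation_map_def \<kappa>_g lin_ext_single)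
qed

definition splitting :: "(('a \<times> 'h) \<Rightarrow>\<^sub>0 complex) set \<Rightarrow> (('a \<times> 'a) \<Rightarrow>\<^sub>0 complex) set" where
  "splitting = tensor_lift A H AA (\<lambda>a h. tens A A a \<one>\<^bsub>A\<^esub> \<otimes>\<^bsub>AA\<^esub> translation_map h)"

lemma splitting:
  "splitting \<in> linear_maps AH AA"
  "a \<in> carrier A \<Longrightarrow> splitting (tens A H a (g k)) = tens A A a \<one>\<^bsub>A\<^esub> \<otimes>\<^bsub>AA\<^esub> translation k"
proof -
  have b: "bilin A H AA (\<lambda>a h. tens A A a \<one>\<^bsub>A\<^esub> \<otimes>\<^bsub>AA\<^esub> translation_map h)"
  proof (rule bilinI)
    show "(\<lambda>h. tens A A a \<one>\<^bsub>A\<^esub> \<otimes>\<^bsub>AA\<^esub> translation_map h) \<in> linear_maps H AA" if "a \<in> carrier A" for a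
      by (rule lin_maps_compose[OF translation_map(1) lin_maps_mult_left]) (use that in auto)
    show "(\<lambda>a. tens A A a \<one>\<^bsub>A\<^esub> \<otimes>\<^bsub>AA\<^esub> translation_map h) \<in> linear_maps A AA" if "h \<in> carrier H" for h
      by (rule lin_maps_compose[OF tens_bilin(2) lin_maps_mult_right])
        (use that lin_mapsD(1)[OF translation_map(1)] in auto)
  qed
  show "splitting \<in> linear_maps AH AA"
    "a \<in> carrier A \<Longrightarrow> splitting (tens A H a (g k)) = tens A A a \<one>\<^bsub>A\<^esub> \<otimes>\<^bsub>AA\<^esub> translation k"
    unfolding splitting_def using tensor_lift[OF A H vecs(2) b] by (auto simp: translation_map(2))
qed

text \<open>Every term of \<open>translation k\<close> has its second factor in degree
  \<open>k\<close>, so \<open>ver\<close> sends \<open>x \<cdot> translation k\<close> to the tensor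
  of \<open>x \<cdot> mult_map A (translation k) = x\<close> with \<open>g k\<close>.\<close>

lemma ver_splitting:
  assumes "\<zeta> \<in> carrier AH"
  shows "ver A H \<delta> (splitting \<zeta>) = \<zeta>"
proof (rule AH_eqI[OF lin_maps_compose[OF splitting(1) ver(1)] lin_maps_id vecs(3) _ assms])
  fix k x assume x: "x \<in> carrier A"
  have "ver A H \<delta> (tens A A x \<one>\<^bsub>A\<^esub> \<otimes>\<^bsub>AA\<^esub> translation k) = tens A H (x \<otimes>\<^bsub>A\<^esub> mult_map A (translation k)) (g k)"
  proof (rule lin_span_map_eq[OF translation(1) _ _ vecs(2,3) opposite_carrier])
    show "(\<lambda>t. ver A H \<delta> (tens A A x \<one>\<^bsub>A\<^esub> \<otimes>\<^bsub>AA\<^esub> t)) \<in> linear_maps AA AH"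
      by (rule lin_maps_compose[OF lin_maps_mult_left ver(1)]) (use x in auto)
    show "(\<lambda>t. tens A H (x \<otimes>\<^bsub>A\<^esub> mult_map A t) (g k)) \<in> linear_maps AA AH"
      by (rule lin_maps_compose[OF lin_maps_compose[OF mult_map(1) lin_maps_mult_left] tens_bilin(2)])
        (use x in auto)
  qed (use x in \<open>auto simp: opposite_def ver(3) mult_map(2) componentD star_alg_assoc\<close>)
  thus "ver A H \<delta> (splitting (tens A H x (g k))) = tens A H x (g k)"
    using x by (simp add: splitting(2) translation(2))
qed

text \<open>The identity \<open>x \<otimes> y a b - x y a \<otimes> b = (x \<otimes> 1) (1 \<otimes> y a - y a \<otimes> 1) (1 \<otimes> b)\<close>, in which
  \<open>y a\<close> has degree zero.\<close>

lemma horizontal_exchange: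
  assumes x: "x \<in> carrier A" and y: "y \<in> component k" and t: "t \<in> lin_span AA (opposite k)"
  shows "tens A A x (y \<otimes>\<^bsub>A\<^esub> mult_map A t) \<oplus>\<^bsub>AA\<^esub> (- 1) \<odot>\<^bsub>AA\<^esub> (tens A A (x \<otimes>\<^bsub>A\<^esub> y) \<one>\<^bsub>A\<^esub> \<otimes>\<^bsub>AA\<^esub> t)
    \<in> horizontal"
proof (rule lin_span_map_into[OF t _ vecs(2,2) opposite_carrier horizontal_subspace])
  have yc: "y \<in> carrier A" using y componentD by auto
  show "(\<lambda>t. tens A A x (y \<otimes>\<^bsub>A\<^esub> mult_map A t) \<oplus>\<^bsub>AA\<^esub> (- 1) \<odot>\<^bsub>AA\<^esub> (tens A A (x \<otimes>\<^bsub>A\<^esub> y) \<one>\<^bsub>A\<^esub> \<otimes>\<^bsub>AA\<^esub> t))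
    \<in> linear_maps AA AA"
    by (rule lin_maps_diff[OF lin_maps_compose[OF lin_maps_compose[OF mult_map(1) lin_maps_mult_left] tens_bilin(1)]
          lin_maps_mult_left]) (use x yc in auto)
  fix s assume "s \<in> opposite k"
  then obtain a b where ab: "s = tens A A a b" "a \<in> component (- k)" "b \<in> component k"
    by (auto simp: opposite_def)
  have abc: "a \<in> carrier A" "b \<in> carrier A" using ab componentD by auto
  have ya: "y \<otimes>\<^bsub>A\<^esub> a \<in> component 0" using component_mult[OF y ab(2)] by simp
  have o: "\<one>\<^bsub>A\<^esub> \<in> component 0" by (rule component_one)
  define \<omega> where "\<omega> = tens A0 A0 \<one>\<^bsub>A\<^esub> (y \<otimes>\<^bsub>A\<^esub> a) \<oplus>\<^bsub>tensor A0 A0\<^esub>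
    (- 1) \<odot>\<^bsub>tensor A0 A0\<^esub> tens A0 A0 (y \<otimes>\<^bsub>A\<^esub> a) \<one>\<^bsub>A\<^esub>"
  have A00: "is_star_algebra (tensor A0 A0)" by (rule is_star_algebra_tensor[OF A0 A0])
  have v00: "vec (tensor A0 A0)" by (rule star_alg_vec[OF A00])
  have tc: "tens A0 A0 \<one>\<^bsub>A\<^esub> (y \<otimes>\<^bsub>A\<^esub> a) \<in> carrier (tensor A0 A0)"
    "tens A0 A0 (y \<otimes>\<^bsub>A\<^esub> a) \<one>\<^bsub>A\<^esub> \<in> carrier (tensor A0 A0)"
    using ya o by (auto intro!: tens_closed)
  have mc: "mult_map A0 (tens A0 A0 \<one>\<^bsub>A\<^esub> (y \<otimes>\<^bsub>A\<^esub> a)) = y \<otimes>\<^bsub>A\<^esub> a"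
    "mult_map A0 (tens A0 A0 (y \<otimes>\<^bsub>A\<^esub> a) \<one>\<^bsub>A\<^esub>) = y \<otimes>\<^bsub>A\<^esub> a"
    using mult_map(2)[OF A0] ya o yc abc by auto
  have \<omega>: "\<omega> \<in> universal_forms A0"
    unfolding universal_forms_zero_iff
  proof
    show "\<omega> \<in> carrier (tensor A0 A0)" unfolding \<omega>_def using v00 tc by simp
    have "mult_map A0 \<omega> = (y \<otimes>\<^bsub>A\<^esub> a) \<oplus>\<^bsub>A\<^esub> (- 1) \<odot>\<^bsub>A\<^esub> (y \<otimes>\<^bsub>A\<^esub> a)"
      unfolding \<omega>_def
      using lin_mapsD[OF mult_map(1)[OF A0]] tc v00 mc by simp
    thus "mult_map A0 \<omega> = \<zero>\<^bsub>A\<^esub>" using yc abc by simp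
  qed
  have "tens A A x \<one>\<^bsub>A\<^esub> \<otimes>\<^bsub>AA\<^esub> tensor_incl A0 A0 A A \<omega> \<otimes>\<^bsub>AA\<^esub> tens A A \<one>\<^bsub>A\<^esub> b
      = tens A A x (y \<otimes>\<^bsub>A\<^esub> (a \<otimes>\<^bsub>A\<^esub> b)) \<oplus>\<^bsub>AA\<^esub> (- 1) \<odot>\<^bsub>AA\<^esub> tens A A (x \<otimes>\<^bsub>A\<^esub> y \<otimes>\<^bsub>A\<^esub> a) b"
    unfolding \<omega>_def
    using lin_mapsD[OF incl_sandwich_linear[OF x abc(2)]] tc v00
      incl_sandwich_tens[OF x abc(2) o ya] incl_sandwich_tens[OF x abc(2) ya o] x yc abc
    by (simp add: star_alg_assoc)
  moreover have "tens A A x \<one>\<^bsub>A\<^esub> \<otimes>\<^bsub>AA\<^esub> tensor_incl A0 A0 A A \<omega> \<otimes>\<^bsub>AA\<^esub> tens A A \<one>\<^bsub>A\<^esub> b \<in> horizontal"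
    unfolding horizontal_forms_def by (rule lin_span_base) (use x \<omega> abc in blast)
  ultimately show "tens A A x (y \<otimes>\<^bsub>A\<^esub> mult_map A s) \<oplus>\<^bsub>AA\<^esub>
      (- 1) \<odot>\<^bsub>AA\<^esub> (tens A A (x \<otimes>\<^bsub>A\<^esub> y) \<one>\<^bsub>A\<^esub> \<otimes>\<^bsub>AA\<^esub> s) \<in> horizontal"
    using x yc abc by (simp add: ab(1) mult_map(2))
qed

text \<open>For \<open>y\<close> of degree \<open>k\<close> the splitting of
  \<open>ver (x \<otimes> y)\<close> is \<open>x y \<cdot> translation k\<close>. As the factors of
  \<open>translation k\<close> multiply to the unit, the difference is the one treated in
  \<open>horizontal_exchange\<close>.\<close>

lemma splitting_ver:
  assumes "\<omega> \<in> carrier AA"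
  shows "\<omega> \<oplus>\<^bsub>AA\<^esub> (- 1) \<odot>\<^bsub>AA\<^esub> splitting (ver A H \<delta> \<omega>) \<in> horizontal"
proof (rule AA_intoI[OF _ vecs(2) horizontal_subspace _ assms])
  show "(\<lambda>\<omega>. \<omega> \<oplus>\<^bsub>AA\<^esub> (- 1) \<odot>\<^bsub>AA\<^esub> splitting (ver A H \<delta> \<omega>)) \<in> linear_maps AA AA"
    by (rule lin_maps_diff[OF lin_maps_id lin_maps_compose[OF ver(1) splitting(1)] vecs(2)])
  fix k x y assume x: "x \<in> carrier A" and y: "y \<in> component k"
  show "tens A A x y \<oplus>\<^bsub>AA\<^esub> (- 1) \<odot>\<^bsub>AA\<^esub> splitting (ver A H \<delta> (tens A A x y)) \<in> horizontal"
    using horizontal_exchange[OF x y translation(1)] x componentD(1)[OF y]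
    by (simp add: ver(3)[OF x y] splitting(2) translation(2))
qed

theorem quantum_principal_bundle: "quantum_principal_bundle A H \<delta> (component 0)"
  unfolding quantum_principal_bundle_def short_exact_def
proof (intro conjI)
  show "hopf_star_algebra H" "comodule_star_algebra A H \<delta>" "component 0 = coinvariants A H \<delta>"
    using hopf_star_algebra comodule coinvariants_eq by auto
  show "vec (AA\<lparr>carrier := horizontal\<rparr>)" "vec (AA\<lparr>carrier := universal_forms A\<rparr>)"
    "vec (AH\<lparr>carrier := tensor_augmentation A H\<rparr>)"
    using horizontal_subspace universal_forms_subspace augmentation_subspace by (auto intro!: vec_subspace)
  show "(\<lambda>\<omega>. \<omega>) \<in> linear_maps (AA\<lparr>carrier := horizontal\<rparr>) (AA\<lparr>carrier := universal_forms A\<rparr>)"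
    using horizontal_universal by (auto simp: linear_maps_def)
  have into: "ver A H \<delta> \<omega> \<in> tensor_augmentation A H" if "\<omega> \<in> universal_forms A" for \<omega>
    using that augment_ver[of \<omega>] lin_mapsD(1)[OF ver(1)] by (simp add: tensor_augmentation_eq universal_forms_iff)
  have sub: "universal_forms A \<subseteq> carrier AA" by (auto simp: universal_forms_iff)
  show "ver A H \<delta> \<in> linear_maps (AA\<lparr>carrier := universal_forms A\<rparr>) (AH\<lparr>carrier := tensor_augmentation A H\<rparr>)"
    by (rule lin_maps_corestrict[OF lin_maps_restrict[OF ver(1) sub]]) (use into in simp)
  show "inj_on (\<lambda>\<omega>. \<omega>) (carrier (AA\<lparr>carrier := horizontal\<rparr>))" by simp
  \<comment> \<open>If \<open>ver\<close> kills \<open>\<omega>\<close>, the correction term in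
    \<open>splitting_ver\<close> is the splitting of zero, and \<open>\<omega>\<close> itself is
    horizontal.\<close>
  have "\<omega> \<in> horizontal" if "\<omega> \<in> carrier AA" "ver A H \<delta> \<omega> = \<zero>\<^bsub>AH\<^esub>" for \<omega>
    using splitting_ver[OF that(1)] that lin_maps_zero[OF splitting(1)] by simp
  thus "(\<lambda>\<omega>. \<omega>) ` carrier (AA\<lparr>carrier := horizontal\<rparr>) =
      a_kernel (AA\<lparr>carrier := universal_forms A\<rparr>) (AH\<lparr>carrier := tensor_augmentation A H\<rparr>) (ver A H \<delta>)"
    using horizontal_universal ver_horizontal by (auto simp: a_kernel_eq universal_forms_iff)
  \<comment> \<open>The preimage is \<open>splitting \<zeta>\<close>. It is a universal form
    because, by \<open>augment_ver\<close>, its product is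
    \<open>augment \<zeta> = \<zero>\<close>.\<close>
  have "\<exists>\<omega>\<in>universal_forms A. \<zeta> = ver A H \<delta> \<omega>" if \<zeta>: "\<zeta> \<in> tensor_augmentation A H" for \<zeta>
  proof
    have \<zeta>': "\<zeta> \<in> carrier AH" "augment \<zeta> = \<zero>\<^bsub>A\<^esub>" using \<zeta> by (auto simp: tensor_augmentation_eq)
    show "\<zeta> = ver A H \<delta> (splitting \<zeta>)" using ver_splitting[OF \<zeta>'(1)] by simp
    show "splitting \<zeta> \<in> universal_forms A"
      using \<zeta>' lin_mapsD(1)[OF splitting(1)] augment_ver[of "splitting \<zeta>"] ver_splitting[OF \<zeta>'(1)]
      by (simp add: universal_forms_iff)
  qed
  thus "ver A H \<delta> ` carrier (AA\<lparr>carrier := universal_forms A\<rparr>) =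
      carrier (AH\<lparr>carrier := tensor_augmentation A H\<rparr>)"
    using into by auto
qed

end

text \<open>The isomorphism matches \<open>g k\<close> with \<open>g' k\<close>. The coordinate maps
  of the two algebras make both directions linear, and all compatibilities are checked on these
  elements.\<close>

lemma (in group_like_basis) hopf_star_iso_nonempty:
  fixes K :: "('k, 'z) hopf_algebra_scheme"
  assumes "group_like_basis K g' \<kappa>'"
  shows "hopf_star_iso H K \<noteq> {}"
proof -
  interpret K: group_like_basis K g' \<kappa>' by fact
  define f where "f = (\<lambda>h. lin_ext K g' (\<kappa> h))"
  define f' where "f' = (\<lambda>h. lin_ext H g (\<kappa>' h))"
  have "lin_ext K g' \<in> linear_maps int_alg K" "lin_ext H g \<in> linear_maps int_alg H"
    unfolding int_alg_def by (auto intro!: lin_ext_linear)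
  hence f: "f \<in> linear_maps H K" and f': "f' \<in> linear_maps K H"
    unfolding f_def f'_def using lin_maps_compose[OF \<kappa>] lin_maps_compose[OF K.\<kappa>] by auto
  have fg: "f (g k) = g' k" and f'g: "f' (g' k) = g k" for k
    by (simp_all add: f_def f'_def \<kappa>_g K.\<kappa>_g lin_ext_single)
  note fD = lin_mapsD[OF f] and f'D = lin_mapsD[OF f']
  have "f' (f h) = h" if "h \<in> carrier H" for h
    by (rule H_eqI[OF lin_maps_compose[OF f f'] lin_maps_id _ _ that]) (auto simp: fg f'g)
  moreover have "f (f' h) = h" if "h \<in> carrier K" for h
    by (rule K.H_eqI[OF lin_maps_compose[OF f' f] lin_maps_id _ _ that]) (auto simp: fg f'g)
  ultimately have bij: "bij_betw f (carrier H) (carrier K)"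
    by (intro bij_betw_byWitness[where f' = f']) (use fD f'D in auto)
  have hom: "f \<in> star_alg_hom H K"
    by (rule H_star_alg_hom[OF f]) (auto simp: fg K.g_zero K.g_star)
  have [simp]: "vec (tensor K K)" by (auto intro!: star_alg_vec)
  note tm = tensor_map[OF H H K.H K.H f f]
  have "comult K (f h) = tensor_map H H K K f f (comult H h)" if "h \<in> carrier H" for h
    by (rule H_eqI[OF lin_maps_compose[OF f K.comult(1)] lin_maps_compose[OF comult(1) tm(1)] _ _ that])
      (auto simp: fg K.comult(2) comult(2) tm(2))
  moreover have "counit K (f h) = counit H h" if "h \<in> carrier H" for h
    by (rule H_eqI[OF lin_maps_compose[OF f K.counit(1)] counit(1) _ _ that])
      (auto simp: fg K.counit(2) counit(2))
  moreover have "antipode K (f h) = f (antipode H h)" if "h \<in> carrier H" for h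
    by (rule H_eqI[OF lin_maps_compose[OF f K.antipode(1)] lin_maps_compose[OF antipode(1) f] _ _ that])
      (auto simp: fg K.antipode(2) antipode(2))
  ultimately have "f \<in> hopf_star_iso H K" using hom bij by (simp add: hopf_star_iso_def)
  thus ?thesis by auto
qed

section \<open>Tensor products of subalgebras\<close>

text \<open>A linear retraction onto each factor makes the canonical map of the tensor products injective.\<close>

context
  fixes A :: "('a, 'x) star_algebra_scheme" and B :: "('b, 'y) star_algebra_scheme"
    and F :: "'a set" and K :: "'b set" and \<rho> \<sigma>
  assumes A: "is_star_algebra A" and B: "is_star_algebra B"
    and F: "star_subalgebra F A" and K: "star_subalgebra K B"
    and \<rho>: "\<rho> \<in> linear_maps A (A\<lparr>carrier := F\<rparr>)" "\<forall>a\<in>F. \<rho> a = a"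
    and \<sigma>: "\<sigma> \<in> linear_maps B (B\<lparr>carrier := K\<rparr>)" "\<forall>b\<in>K. \<sigma> b = b"
begin

private abbreviation "AF \<equiv> A\<lparr>carrier := F\<rparr>"
private abbreviation "BK \<equiv> B\<lparr>carrier := K\<rparr>"

private lemma AF: "is_star_algebra AF" and BK: "is_star_algebra BK"
  using is_star_algebra_subalgebra A B F K by auto

private lemmas incl = tensor_incl[OF A B AF star_subalgebraD(2)[OF A F] BK star_subalgebraD(2)[OF B K]]
private lemmas retr = tensor_map[OF A B AF BK \<rho>(1) \<sigma>(1)]

private lemma retraction_incl:
  assumes "y \<in> carrier (tensor AF BK)"
  shows "tensor_map A B AF BK \<rho> \<sigma> (tensor_incl AF BK A B y) = y"
proof (rule tensor_eqI[OF AF BK lin_maps_compose[OF incl(1) retr(1)] lin_maps_id _ _ assms])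
  show "vec (tensor AF BK)" using AF BK by auto
qed (use star_subalgebraD(2)[OF A F] star_subalgebraD(2)[OF B K] \<rho> \<sigma> in
  \<open>auto simp: incl(2) retr(2) subset_iff\<close>)

lemma corestrict_tensor_eq:
  assumes "y \<in> carrier (tensor AF BK)" "tensor_incl AF BK A B y = f x"
  shows "corestrict_tensor AF BK A B f x = y"
  unfolding corestrict_tensor_def
proof (rule the_equality)
  fix y' assume "y' \<in> carrier (tensor AF BK) \<and> tensor_incl AF BK A B y' = f x"
  thus "y' = y" using assms retraction_incl[of y] retraction_incl[of y'] by auto
qed (use assms in auto)

lemma corestrict_tensor_tens:
  assumes "a \<in> F" "b \<in> K" "f x = tens A B a b"
  shows "corestrict_tensor AF BK A B f x = tens AF BK a b"
  by (rule corestrict_tensor_eq) (use assms AF BK in \<open>auto simp: incl(2)\<close>)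

text \<open>Since \<open>f\<close> maps a spanning set to pure tensors over the subalgebras, all its
  values lie in the image of the inclusion. There the unique preimage is obtained by applying
  \<open>\<rho> \<otimes> \<sigma>\<close>, which shows that it depends linearly on
  \<open>x\<close>.\<close>

lemma corestrict_tensor:
  assumes f: "f \<in> linear_maps M (tensor A B)" and M: "vec M"
    and S: "S \<subseteq> carrier M" "carrier M \<subseteq> lin_span M S"
    and fS: "\<And>x. x \<in> S \<Longrightarrow> \<exists>a\<in>F. \<exists>b\<in>K. f x = tens A B a b"
  shows "corestrict_tensor AF BK A B f \<in> linear_maps M (tensor AF BK)"
    and "x \<in> carrier M \<Longrightarrow> tensor_incl AF BK A B (corestrict_tensor AF BK A B f x) = f x"
proof -
  have v: "vec (tensor A B)" "vec (tensor AF BK)" using A B AF BK by auto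
  have im: "f x \<in> tensor_incl AF BK A B ` carrier (tensor AF BK)" if "x \<in> carrier M" for x
  proof (rule lin_span_map_into[OF _ f M v(1) S(1)])
    show "x \<in> lin_span M S" using that S by auto
    show "lin_subspace (tensor_incl AF BK A B ` carrier (tensor AF BK)) (tensor A B)"
      by (rule lin_subspace_image[OF incl(1) v(2,1) lin_subspace_carrier[OF v(2)]])
    fix s assume "s \<in> S"
    then obtain a b where "a \<in> F" "b \<in> K" "f s = tens A B a b" using fS by blast
    thus "f s \<in> tensor_incl AF BK A B ` carrier (tensor AF BK)"
      using AF BK by (intro image_eqI[of _ _ "tens AF BK a b"]) (auto simp: incl(2))
  qed
  have eq: "corestrict_tensor AF BK A B f x = tensor_map A B AF BK \<rho> \<sigma> (f x)"
    "tensor_incl AF BK A B (corestrict_tensor AF BK A B f x) = f x" if x: "x \<in> carrier M" for x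
  proof -
    obtain y where y: "y \<in> carrier (tensor AF BK)" "tensor_incl AF BK A B y = f x" using im[OF x] by auto
    show "corestrict_tensor AF BK A B f x = tensor_map A B AF BK \<rho> \<sigma> (f x)"
      "tensor_incl AF BK A B (corestrict_tensor AF BK A B f x) = f x"
      using corestrict_tensor_eq[of y f x] y retraction_incl[OF y(1)] by auto
  qed
  show "corestrict_tensor AF BK A B f \<in> linear_maps M (tensor AF BK)"
    by (rule iffD2[OF lin_maps_cong[OF eq(1) M] lin_maps_compose[OF f retr(1)]])
  show "x \<in> carrier M \<Longrightarrow> tensor_incl AF BK A B (corestrict_tensor AF BK A B f x) = f x"
    by (rule eq)
qed

end

section \<open>Algebras given by generators and relations\<close>

abbreviation words :: "'i set \<Rightarrow> ('i \<times> bool) list set" where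
  "words N \<equiv> lists (N \<times> UNIV)"

definition word_star :: "('i \<times> bool) list \<Rightarrow> ('i \<times> bool) list" where
  "word_star w = rev (map (\<lambda>(i, b). (i, \<not> b)) w)"

lemma word_star_words [simp]: "w \<in> words N \<Longrightarrow> word_star w \<in> words N"
  by (auto simp: word_star_def)

lemma free_star_alg_eq:
  "free_star_alg N = monoid_alg \<lparr>carrier = words N, monoid.mult = (@), one = []\<rparr> word_star"
  by (simp add: free_star_alg_def word_star_def[abs_def])

lemma is_star_algebra_free [simp]: "is_star_algebra (free_star_alg N)"
  unfolding free_star_alg_eq
proof (rule is_star_algebra_monoid_alg)
  have "word_star (word_star w) = w" for w :: "('i \<times> bool) list"
    by (simp add: word_star_def rev_map comp_def case_prod_beta)
  thus "inv_monoid \<lparr>carrier = words N, monoid.mult = (@), one = []\<rparr> word_star"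
    by (auto simp: inv_monoid_def word_star_def intro!: monoidI)
qed

lemma free_star_alg_simps [simp]:
  "p \<in> carrier (free_star_alg N) \<longleftrightarrow> Poly_Mapping.keys p \<subseteq> words N"
  "\<zero>\<^bsub>free_star_alg N\<^esub> = 0" "p \<oplus>\<^bsub>free_star_alg N\<^esub> p' = p + p'"
  "c \<odot>\<^bsub>free_star_alg N\<^esub> p = Poly_Mapping.map ((*) c) p" "\<one>\<^bsub>free_star_alg N\<^esub> = Poly_Mapping.single [] 1"
  "Poly_Mapping.single u c \<otimes>\<^bsub>free_star_alg N\<^esub> Poly_Mapping.single v d = Poly_Mapping.single (u @ v) (c * d)"
  "star (free_star_alg N) (Poly_Mapping.single u c) = Poly_Mapping.single (word_star u) (cnj c)"
  by (simp_all add: free_star_alg_eq)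

lemma lin_maps_free_diff:
  assumes "f \<in> linear_maps (free_star_alg N) M" "Poly_Mapping.keys p \<subseteq> words N" "Poly_Mapping.keys p' \<subseteq> words N"
  shows "f (p - p') = f p \<oplus>\<^bsub>M\<^esub> (- 1) \<odot>\<^bsub>M\<^esub> f p'"
  using lin_maps_monoid_alg_diff[OF assms(1)[unfolded free_star_alg_eq]] assms(2,3) by simp

text \<open>The sphere relations contain sums of the type class; this turns them into
  \<open>finsum\<close> in the target.\<close>

lemma lin_maps_free_sum:
  assumes f: "f \<in> linear_maps (free_star_alg N) M" and M: "vec M" and J: "finite J"
    and p: "\<And>j. j \<in> J \<Longrightarrow> Poly_Mapping.keys (p j) \<subseteq> words N"
  shows "f (\<Sum>j\<in>J. p j) = finsum M (\<lambda>j. f (p j)) J"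
  using J p
proof (induction J rule: finite_induct)
  interpret M: abelian_group M by (rule vec_abelian_group[OF M])
  case empty
  show ?case using lin_maps_zero[OF f _ M] by simp
next
  interpret M: abelian_group M by (rule vec_abelian_group[OF M])
  case (insert j J)
  have "Poly_Mapping.keys (\<Sum>j\<in>J. p j) \<subseteq> words N"
    by (intro order.trans[OF Poly_Mapping.keys_sum] UN_least) (use insert in auto)
  thus ?case using insert lin_mapsD(2)[OF f, of "p j" "\<Sum>j\<in>J. p j"] lin_mapsD(1)[OF f]
    by (simp add: Pi_def)
qed

definition eval_word ::
    "('b, 'y) star_algebra_scheme \<Rightarrow> ('i \<Rightarrow> 'b) \<Rightarrow> ('i \<times> bool) list \<Rightarrow> 'b" where
  "eval_word B b w = foldr (\<lambda>(i, c) x. (if c then star B (b i) else b i) \<otimes>\<^bsub>B\<^esub> x) w \<one>\<^bsub>B\<^esub>"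

lemma eval_word_simps [simp]:
  "eval_word B b [] = \<one>\<^bsub>B\<^esub>"
  "eval_word B b ((i, c) # w) = (if c then star B (b i) else b i) \<otimes>\<^bsub>B\<^esub> eval_word B b w"
  by (simp_all add: eval_word_def)

context
  fixes B :: "('b, 'y) star_algebra_scheme" and b :: "'i \<Rightarrow> 'b" and N :: "'i set"
  assumes B: "is_star_algebra B" and b: "\<And>i. i \<in> N \<Longrightarrow> b i \<in> carrier B"
begin

lemma eval_word_closed: "w \<in> words N \<Longrightarrow> eval_word B b w \<in> carrier B"
  by (induction w) (use B b in auto)

lemma eval_word_append:
  "u \<in> words N \<Longrightarrow> v \<in> words N \<Longrightarrow> eval_word B b (u @ v) = eval_word B b u \<otimes>\<^bsub>B\<^esub> eval_word B b v"
proof (induction u)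
  case (Cons x u)
  have "eval_word B b u \<in> carrier B" "eval_word B b v \<in> carrier B"
    using Cons by (auto intro!: eval_word_closed)
  with Cons B b show ?case by (cases x) (auto simp: star_alg_assoc)
qed (use B eval_word_closed in simp)

lemma eval_word_star: "w \<in> words N \<Longrightarrow> eval_word B b (word_star w) = star B (eval_word B b w)"
proof (induction w)
  case (Cons x w)
  obtain i c where x: "x = (i, c)" by (cases x)
  have "eval_word B b (word_star w @ [(i, \<not> c)]) = eval_word B b (word_star w) \<otimes>\<^bsub>B\<^esub> eval_word B b [(i, \<not> c)]"
    by (rule eval_word_append) (use Cons x in auto)
  moreover have "word_star (x # w) = word_star w @ [(i, \<not> c)]" by (simp add: word_star_def x)
  ultimately show ?case using Cons x B b eval_word_closed[of w] by simp
qed (use B in \<open>simp add: word_star_def\<close>)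

definition free_hom :: "(('i \<times> bool) list \<Rightarrow>\<^sub>0 complex) \<Rightarrow> 'b" where
  "free_hom = lin_ext B (eval_word B b)"

lemma free_hom_single: "w \<in> words N \<Longrightarrow> free_hom (Poly_Mapping.single w c) = c \<odot>\<^bsub>B\<^esub> eval_word B b w"
  unfolding free_hom_def using B eval_word_closed by (intro lin_ext_single) auto

lemma free_hom: "free_hom \<in> star_alg_hom (free_star_alg N) B"
proof (rule star_alg_hom_span[OF is_star_algebra_free B])
  let ?F = "free_star_alg N"
  show lin: "free_hom \<in> linear_maps ?F B"
    unfolding free_hom_def free_star_alg_eq by (rule lin_ext_linear) (use B eval_word_closed in auto)
  show "(\<lambda>w. Poly_Mapping.single w 1) ` words N \<subseteq> carrier ?F" by auto
  show "carrier ?F \<subseteq> lin_span ?F ((\<lambda>w. Poly_Mapping.single w 1) ` words N)"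
    unfolding free_star_alg_eq
    using monoid_alg_span[of "\<lparr>carrier = words N, monoid.mult = (@), one = []\<rparr>" word_star] by simp
  show "free_hom \<one>\<^bsub>?F\<^esub> = \<one>\<^bsub>B\<^esub>" using B by (simp add: free_hom_single)
  fix x assume "x \<in> (\<lambda>w. Poly_Mapping.single w (1::complex)) ` words N"
  then obtain w where w: "x = Poly_Mapping.single w 1" "w \<in> words N" by auto
  show "free_hom (star ?F x) = star B (free_hom x)"
    using w B eval_word_star[OF w(2)] eval_word_closed[OF w(2)] by (simp add: free_hom_single)
  fix y assume "y \<in> (\<lambda>w. Poly_Mapping.single w (1::complex)) ` words N"
  then obtain v where v: "y = Poly_Mapping.single v 1" "v \<in> words N" by auto
  show "free_hom (x \<otimes>\<^bsub>?F\<^esub> y) = free_hom x \<otimes>\<^bsub>B\<^esub> free_hom y"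
    using w v B eval_word_append[OF w(2) v(2)] eval_word_closed[OF w(2)] eval_word_closed[OF v(2)]
      free_hom_single[of "w @ v" 1] free_hom_single[of w 1] free_hom_single[of v 1] by simp
qed

end

text \<open>Through minimality of \<open>star_ideal\<close> this reduces the vanishing of a
  homomorphism on the ideal to its vanishing on the relations.\<close>

lemma hom_kernel_ideal:
  assumes A: "is_star_algebra A" and B: "is_star_algebra B" and f: "f \<in> star_alg_hom A B"
  shows "selfadjoint_ideal {x \<in> carrier A. f x = \<zero>\<^bsub>B\<^esub>} A"
proof (rule selfadjoint_idealI[OF A])
  have v: "vec A" "vec B" using A B by auto
  have "lin_subspace {\<zero>\<^bsub>B\<^esub>} B" by (rule lin_subspaceI) (use v in auto)
  from lin_subspace_vimage[OF star_alg_homD(1)[OF f] v this]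
  show "lin_subspace {x \<in> carrier A. f x = \<zero>\<^bsub>B\<^esub>} A" by simp
qed (use A B star_alg_homD[OF f] in auto)

definition monomial :: "'i set \<Rightarrow> (('i \<times> bool) list \<Rightarrow>\<^sub>0 complex) set \<Rightarrow> ('i \<times> bool) list \<Rightarrow>
    (('i \<times> bool) list \<Rightarrow>\<^sub>0 complex) set" where
  "monomial N R w = star_ideal N R +>\<^bsub>free_star_alg N\<^esub> Poly_Mapping.single w 1"

lemma presented_gen_eq: "presented_gen N R i = monomial N R [(i, False)]"
  by (simp add: presented_gen_def monomial_def free_gen_def)

context
  fixes N :: "'i set" and R :: "(('i \<times> bool) list \<Rightarrow>\<^sub>0 complex) set"
  assumes R: "R \<subseteq> carrier (free_star_alg N)"
begin

private abbreviation "FN \<equiv> free_star_alg N"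
private abbreviation "PA \<equiv> presented_alg N R"

private lemma gens: "R \<union> star FN ` R \<subseteq> carrier FN"
proof -
  have "star FN p \<in> carrier FN" if "p \<in> R" for p
    using star_alg_simps(3)[OF is_star_algebra_free, of p N] R that by blast
  thus ?thesis using R by blast
qed

private lemma star_ideal_minimal:
  assumes "selfadjoint_ideal I FN" "R \<subseteq> I"
  shows "star_ideal N R \<subseteq> I"
  unfolding star_ideal_def
  by (rule ring.genideal_minimal[OF star_alg_ring[OF is_star_algebra_free]])
    (use assms in \<open>auto simp: selfadjoint_ideal_def\<close>)

private lemma star_ideal_superset: "R \<union> star FN ` R \<subseteq> star_ideal N R"
  unfolding star_ideal_def
  by (rule ring.genideal_self[OF star_alg_ring[OF is_star_algebra_free] gens])

text \<open>The elements whose adjoint lies in the ideal form an ideal themselves. It contains the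
  generators, because \<open>R\<close> was enlarged by the adjoints of its elements, and hence the
  whole ideal.\<close>

lemma star_ideal: "selfadjoint_ideal (star_ideal N R) FN"
proof -
  let ?I = "star_ideal N R"
  have F: "is_star_algebra FN" by simp
  have vF: "vec FN" using F by auto
  have idl: "ideal ?I FN"
    unfolding star_ideal_def by (rule ring.genideal_ideal[OF star_alg_ring[OF F] gens])
  interpret ideal ?I FN by (rule idl)
  note sub = lin_subspaceD[OF vF ideal_lin_subspace[OF F idl]]
  have ss: "star FN (star FN p) = p" if "p \<in> carrier FN" for p
    using star_alg_simps(10)[OF F that] .
  let ?J = "{x \<in> carrier FN. star FN x \<in> ?I}"
  have "ideal ?J FN"
  proof (rule idealI[OF star_alg_ring[OF F]])
    have "lin_subspace ?J FN"
    proof (rule lin_subspaceI[OF vF])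
      show "\<zero>\<^bsub>FN\<^esub> \<in> ?J" using sub(2) vec_simps(1)[OF vF] star_zero[OF F]
        by (simp del: free_star_alg_simps)
      show "x \<oplus>\<^bsub>FN\<^esub> y \<in> ?J" if "x \<in> ?J" "y \<in> ?J" for x y
        using that sub(3)[of "star FN x" "star FN y"] vec_simps(2)[OF vF, of x y] star_alg_simps(11)[OF F, of x y]
        by (simp del: free_star_alg_simps)
      show "c \<odot>\<^bsub>FN\<^esub> x \<in> ?J" if "x \<in> ?J" for c x
        using that sub(4)[of "star FN x" "cnj c"] vec_simps(3)[OF vF, of x c] star_alg_simps(13)[OF F, of x c]
        by (simp del: free_star_alg_simps)
    qed auto
    thus "subgroup ?J (add_monoid FN)" by (rule submodule.axioms(1))
    show "x \<otimes>\<^bsub>FN\<^esub> a \<in> ?J" "a \<otimes>\<^bsub>FN\<^esub> x \<in> ?J" if "a \<in> ?J" "x \<in> carrier FN" for a x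
    proof -
      have *: "a \<in> carrier FN" "star FN a \<in> ?I" "star FN x \<in> carrier FN"
        using that star_alg_simps(3)[OF F] by (simp_all del: free_star_alg_simps)
      show "x \<otimes>\<^bsub>FN\<^esub> a \<in> ?J" "a \<otimes>\<^bsub>FN\<^esub> x \<in> ?J"
        using * that(2) star_alg_simps(2,12)[OF F] I_l_closed[OF *(2,3)] I_r_closed[OF *(2,3)]
        by (simp_all del: free_star_alg_simps)
    qed
  qed
  moreover have "R \<union> star FN ` R \<subseteq> ?J"
  proof -
    have "p \<in> carrier FN" "star FN p \<in> carrier FN" if "p \<in> R" for p
      using gens that by blast+
    thus ?thesis using star_ideal_superset ss by (force simp del: free_star_alg_simps)
  qed
  ultimately have "?I \<subseteq> ?J"
    unfolding star_ideal_def by (rule ring.genideal_minimal[OF star_alg_ring[OF F]])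
  thus ?thesis using idl F by (auto simp: selfadjoint_ideal_def)
qed

lemma is_star_algebra_presented: "is_star_algebra PA"
  unfolding presented_alg_def by (rule is_star_algebra_star_quot[OF star_ideal])

lemma presented_class_hom: "(\<lambda>p. star_ideal N R +>\<^bsub>FN\<^esub> p) \<in> star_alg_hom FN PA"
  unfolding presented_alg_def by (rule star_quot_class_hom[OF star_ideal])

lemma presented_relation:
  assumes "p \<in> R"
  shows "star_ideal N R +>\<^bsub>FN\<^esub> p = \<zero>\<^bsub>PA\<^esub>"
proof -
  have "p \<in> star_ideal N R" using star_ideal_superset assms by auto
  thus ?thesis unfolding presented_alg_def using star_quot_class_eq_zero[OF star_ideal, of p] R assms by auto
qed

lemma monomial_closed: "w \<in> words N \<Longrightarrow> monomial N R w \<in> carrier PA"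
  unfolding monomial_def by (rule star_alg_homD(5)[OF presented_class_hom]) auto

lemma monomial_Nil: "monomial N R [] = \<one>\<^bsub>PA\<^esub>"
  using star_alg_homD(3)[OF presented_class_hom] by (simp add: monomial_def)

lemma monomial_append:
  "u \<in> words N \<Longrightarrow> v \<in> words N \<Longrightarrow> monomial N R (u @ v) = monomial N R u \<otimes>\<^bsub>PA\<^esub> monomial N R v"
  using star_alg_homD(2)[OF presented_class_hom, of "Poly_Mapping.single u 1" "Poly_Mapping.single v 1"]
  by (simp add: monomial_def)

lemma monomial_star: "w \<in> words N \<Longrightarrow> monomial N R (word_star w) = star PA (monomial N R w)"
  using star_alg_homD(4)[OF presented_class_hom, of "Poly_Mapping.single w 1"]
  by (simp add: monomial_def)

lemma presented_span: "carrier PA \<subseteq> lin_span PA (monomial N R ` words N)"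
proof
  have vP: "vec PA" and vF: "vec FN" using is_star_algebra_presented by auto
  note q = star_alg_homD(1)[OF presented_class_hom]
  have W: "lin_subspace (lin_span PA (monomial N R ` words N)) PA"
    by (rule lin_span_subspace[OF vP]) (use monomial_closed in auto)
  fix x assume "x \<in> carrier PA"
  then obtain p where p: "p \<in> carrier FN" "x = star_ideal N R +>\<^bsub>FN\<^esub> p"
    by (auto simp: presented_alg_def star_quot_carrier[OF star_ideal])
  have "p \<in> lin_span FN ((\<lambda>w. Poly_Mapping.single w 1) ` words N)"
    using monoid_alg_span[of "\<lparr>carrier = words N, monoid.mult = (@), one = []\<rparr>" word_star] p
    by (simp add: free_star_alg_eq)
  hence "star_ideal N R +>\<^bsub>FN\<^esub> p \<in> lin_span PA (monomial N R ` words N)"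
    using q vF vP _ W
  proof (rule lin_span_map_into)
    fix s assume "s \<in> (\<lambda>w. Poly_Mapping.single w (1::complex)) ` words N"
    thus "star_ideal N R +>\<^bsub>FN\<^esub> s \<in> lin_span PA (monomial N R ` words N)"
      by (auto simp: monomial_def[symmetric] intro!: lin_span_base)
  qed auto
  thus "x \<in> lin_span PA (monomial N R ` words N)" using p by simp
qed

lemma monomial_eval: "w \<in> words N \<Longrightarrow> monomial N R w = eval_word PA (presented_gen N R) w"
proof (induction w)
  case (Cons x w)
  obtain i c where x: "x = (i, c)" by (cases x)
  have i: "i \<in> N" "w \<in> words N" using Cons x by auto
  have "monomial N R ([(i, True)]) = star PA (presented_gen N R i)"
    using monomial_star[of "[(i, False)]"] i by (simp add: presented_gen_eq word_star_def)
  moreover have "monomial N R ([x] @ w) = monomial N R [x] \<otimes>\<^bsub>PA\<^esub> monomial N R w"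
    by (rule monomial_append) (use i x in auto)
  ultimately show ?case using Cons x i by (cases c) (auto simp: presented_gen_eq)
qed (simp add: monomial_Nil)

text \<open>The pattern of \<open>tensor_lift\<close>: the homomorphism on the free algebra vanishes
  on the ideal and descends, and uniqueness holds because the classes of words span.\<close>

lemma presented_hom:
  assumes B: "is_star_algebra B" and b: "\<And>i. i \<in> N \<Longrightarrow> b i \<in> carrier B"
    and k: "\<And>p. p \<in> R \<Longrightarrow> free_hom B b p = \<zero>\<^bsub>B\<^esub>"
  shows "presented_hom N R B b \<in> star_alg_hom PA B"
    and "w \<in> words N \<Longrightarrow> presented_hom N R B b (monomial N R w) = eval_word B b w"
proof -
  let ?h = "free_hom B b"
  have F: "is_star_algebra FN" by simp
  have vs: "vec FN" "vec B" "vec PA" using B is_star_algebra_presented by auto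
  have h: "?h \<in> star_alg_hom FN B" by (rule free_hom[OF B b])
  have "star_ideal N R \<subseteq> {x \<in> carrier FN. ?h x = \<zero>\<^bsub>B\<^esub>}"
    by (rule star_ideal_minimal[OF hom_kernel_ideal[OF F B h]]) (use R k in blast)
  hence "\<And>x. x \<in> star_ideal N R \<Longrightarrow> ?h x = \<zero>\<^bsub>B\<^esub>" by auto
  then obtain f where f: "f \<in> linear_maps PA B"
      "\<And>p. p \<in> carrier FN \<Longrightarrow> f (star_ideal N R +>\<^bsub>FN\<^esub> p) = ?h p"
    unfolding presented_alg_def using star_quot_lift[OF star_ideal star_alg_homD(1)[OF h] vs(2)] by metis
  have fw: "f (monomial N R w) = eval_word B b w" if "w \<in> words N" for w
    unfolding monomial_def using f(2)[of "Poly_Mapping.single w 1"] that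
      free_hom_single[OF B b that, where c = 1] eval_word_closed[OF B b that] vs by simp
  have fh: "f \<in> star_alg_hom PA B"
  proof (rule star_alg_hom_span[OF is_star_algebra_presented B f(1) _ presented_span])
    show "monomial N R ` words N \<subseteq> carrier PA" using monomial_closed by auto
    show "f \<one>\<^bsub>PA\<^esub> = \<one>\<^bsub>B\<^esub>" using fw[of "[]"] by (simp add: monomial_Nil)
    fix x assume "x \<in> monomial N R ` words N"
    then obtain w where w: "w \<in> words N" "x = monomial N R w" by auto
    show "f (star PA x) = star B (f x)"
      using w fw eval_word_star[OF B b w(1)] by (simp add: monomial_star[symmetric])
    fix y assume "y \<in> monomial N R ` words N"
    then obtain v where v: "v \<in> words N" "y = monomial N R v" by auto
    show "f (x \<otimes>\<^bsub>PA\<^esub> y) = f x \<otimes>\<^bsub>B\<^esub> f y"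
      using w v fw[of "w @ v"] fw eval_word_append[OF B b w(1) v(1)] by (simp add: monomial_append[symmetric])
  qed
  \<comment> \<open>Values outside the carrier are fixed, as the definite description
    demands.\<close>
  define f' where "f' = restrict f (carrier PA)"
  have f'w: "f' (monomial N R w) = eval_word B b w" if "w \<in> words N" for w
    using fw[OF that] monomial_closed[OF that] by (simp add: f'_def)
  have P: "is_star_algebra PA" by (rule is_star_algebra_presented)
  have f': "f' \<in> star_alg_hom PA B"
    by (intro star_alg_homI lin_mapsI)
      (use star_alg_homD[OF fh] lin_mapsD[OF f(1)] P vs in \<open>auto simp: f'_def\<close>)
  have f'g: "f' (presented_gen N R i) = b i" if "i \<in> N" for i
    using f'w[of "[(i, False)]"] that B b by (simp add: presented_gen_eq)
  have "presented_hom N R B b = f'"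
    unfolding presented_hom_def
  proof (rule the_equality)
    show "f' \<in> extensional (carrier PA) \<and> f' \<in> star_alg_hom PA B \<and> (\<forall>i\<in>N. f' (presented_gen N R i) = b i)"
      using f' f'g by (auto simp: f'_def)
    fix h assume h: "h \<in> extensional (carrier PA) \<and> h \<in> star_alg_hom PA B \<and> (\<forall>i\<in>N. h (presented_gen N R i) = b i)"
    have hh: "h \<in> star_alg_hom PA B" using h by auto
    \<comment> \<open>Any competitor agrees on words, by recursion over the letters from its values
      on the generators.\<close>
    have hw: "h (monomial N R w) = eval_word B b w" if "w \<in> words N" for w
      using that
    proof (induction w)
      case (Cons x w)
      obtain i c where x: "x = (i, c)" by (cases x)
      have i: "i \<in> N" "w \<in> words N" using Cons x by auto
      have g: "presented_gen N R i \<in> carrier PA" using monomial_closed[of "[(i, False)]"] i by (simp add: presented_gen_eq)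
      have "h (monomial N R (x # w)) =
          (if c then star B (b i) else b i) \<otimes>\<^bsub>B\<^esub> h (monomial N R w)"
        using monomial_eval[of "x # w"] monomial_eval[of w] monomial_closed[OF i(2)] Cons.prems x i h g P
          star_alg_homD(2,4)[OF hh] by simp
      thus ?case using Cons x i by simp
    qed (use star_alg_homD(3)[OF hh] monomial_Nil in simp)
    show "h = f'"
    proof (rule extensionalityI)
      fix x assume "x \<in> carrier PA"
      hence "x \<in> lin_span PA (monomial N R ` words N)" using presented_span by auto
      thus "h x = f' x"
      proof (rule lin_span_map_eq[OF _ star_alg_homD(1)[OF hh] star_alg_homD(1)[OF f'] vs(3,2)])
        show "monomial N R ` words N \<subseteq> carrier PA" using monomial_closed by blast
        show "h s = f' s" if "s \<in> monomial N R ` words N" for s using that hw f'w by (metis imageE)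
      qed
    qed (use h in \<open>auto simp: f'_def\<close>)
  qed
  thus "presented_hom N R B b \<in> star_alg_hom PA B"
    "w \<in> words N \<Longrightarrow> presented_hom N R B b (monomial N R w) = eval_word B b w"
    using f' f'w by auto
qed

end

section \<open>Homogeneous relations\<close>

definition word_deg :: "('i \<times> bool) list \<Rightarrow> int" where
  "word_deg w = (\<Sum>(i, b)\<leftarrow>w. if b then - 1 else 1)"

lemma word_deg_simps [simp]:
  "word_deg [] = 0" "word_deg ((i, b) # w) = (if b then - 1 else 1) + word_deg w"
  "word_deg (u @ v) = word_deg u + word_deg v"
  by (simp_all add: word_deg_def)

lemma word_deg_star [simp]: "word_deg (word_star w) = - word_deg w"
proof (induction w)
  case (Cons x w)
  obtain i b where x: "x = (i, b)" by (cases x)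
  have "word_star (x # w) = word_star w @ [(i, \<not> b)]" by (simp add: word_star_def x)
  thus ?case using Cons by (simp add: x)
qed (simp add: word_star_def)

definition homogeneous :: "'i set \<Rightarrow> int \<Rightarrow> (('i \<times> bool) list \<Rightarrow>\<^sub>0 complex) \<Rightarrow> bool" where
  "homogeneous N k p \<longleftrightarrow> Poly_Mapping.keys p \<subseteq> {w \<in> words N. word_deg w = k}"

lemma homogeneous_keys: "homogeneous N k p \<Longrightarrow> Poly_Mapping.keys p \<subseteq> words N"
  unfolding homogeneous_def by blast

lemma homogeneous_single: "w \<in> words N \<Longrightarrow> word_deg w = k \<Longrightarrow> homogeneous N k (Poly_Mapping.single w c)"
  by (simp add: homogeneous_def)

lemma homogeneous_diff: "homogeneous N k p \<Longrightarrow> homogeneous N k p' \<Longrightarrow> homogeneous N k (p - p')"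
  unfolding homogeneous_def using keys_diff[of p p'] by blast

lemma homogeneous_scale: "homogeneous N k p \<Longrightarrow> homogeneous N k (Poly_Mapping.map ((*) (c::complex)) p)"
  unfolding homogeneous_def using keys_pm_scale[of c p] by blast

lemma homogeneous_sum: "(\<And>j. j \<in> J \<Longrightarrow> homogeneous N k (p j)) \<Longrightarrow> homogeneous N k (\<Sum>j\<in>J. p j)"
  unfolding homogeneous_def by (intro order.trans[OF Poly_Mapping.keys_sum] UN_least) blast

text \<open>The maps \<open>T k\<close> prescribe the values in degree \<open>k\<close>. On a
  homogeneous \<open>p\<close> of degree \<open>k\<close> the induced map on the free algebra is
  \<open>T k\<close> of the class of \<open>p\<close>. For a relation this class is zero, so the
  relation holds in the target without being computed there.\<close>

lemma presented_hom_graded: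
  fixes N :: "'i set" and R :: "(('i \<times> bool) list \<Rightarrow>\<^sub>0 complex) set"
    and T :: "int \<Rightarrow> (('i \<times> bool) list \<Rightarrow>\<^sub>0 complex) set \<Rightarrow> 'b"
  defines P: "P \<equiv> presented_alg N R"
  assumes R: "\<And>p. p \<in> R \<Longrightarrow> \<exists>k. homogeneous N k p" and B: "is_star_algebra B"
    and lin: "\<And>k. T k \<in> linear_maps P B"
    and mult: "\<And>k m x y. x \<in> carrier P \<Longrightarrow> y \<in> carrier P \<Longrightarrow> T (k + m) (x \<otimes>\<^bsub>P\<^esub> y) = T k x \<otimes>\<^bsub>B\<^esub> T m y"
    and one: "T 0 \<one>\<^bsub>P\<^esub> = \<one>\<^bsub>B\<^esub>"
    and star: "\<And>k x. x \<in> carrier P \<Longrightarrow> T (- k) (star P x) = star B (T k x)"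
    and b: "\<And>i. i \<in> N \<Longrightarrow> b i = T 1 (presented_gen N R i)"
  shows "presented_hom N R B b \<in> star_alg_hom P B"
    and "w \<in> words N \<Longrightarrow> presented_hom N R B b (monomial N R w) = T (word_deg w) (monomial N R w)"
proof -
  have RF: "R \<subseteq> carrier (free_star_alg N)" using R homogeneous_keys by fastforce
  have PA: "is_star_algebra P" unfolding P by (rule is_star_algebra_presented[OF RF])
  have gc: "presented_gen N R i \<in> carrier P" if "i \<in> N" for i
    using monomial_closed[OF RF, of "[(i, False)]"] that by (simp add: presented_gen_eq P)
  have bc: "b i \<in> carrier B" if "i \<in> N" for i
    using lin_mapsD(1)[OF lin gc[OF that]] b[OF that] by simp
  have ev: "eval_word B b w = T (word_deg w) (monomial N R w)" if "w \<in> words N" for w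
    using that
  proof (induction w)
    case Nil show ?case using one by (simp add: monomial_Nil[OF RF] P)
  next
    case (Cons x w)
    obtain i c where x: "x = (i, c)" by (cases x)
    have i: "i \<in> N" "w \<in> words N" using Cons x by auto
    have wc: "monomial N R w \<in> carrier P" unfolding P by (rule monomial_closed[OF RF i(2)])
    have m: "monomial N R (x # w) =
        (if c then star P (presented_gen N R i) else presented_gen N R i) \<otimes>\<^bsub>P\<^esub> monomial N R w"
      using monomial_eval[OF RF, of "(i, c) # w"] monomial_eval[OF RF i(2)] i by (cases c) (simp_all add: P x)
    have st: "T (- 1) (star P (presented_gen N R i)) = star B (b i)"
      using star[OF gc[OF i(1)], of 1] b[OF i(1)] by simp
    show ?case
    proof (cases c)
      case True
      have "T (- 1 + word_deg w) (star P (presented_gen N R i) \<otimes>\<^bsub>P\<^esub> monomial N R w) =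
          star B (b i) \<otimes>\<^bsub>B\<^esub> T (word_deg w) (monomial N R w)"
        using mult[of "star P (presented_gen N R i)" "monomial N R w" "- 1" "word_deg w"] gc[OF i(1)] wc PA st
        by simp
      thus ?thesis using Cons i m True by (simp add: x)
    next
      case False
      have "T (1 + word_deg w) (presented_gen N R i \<otimes>\<^bsub>P\<^esub> monomial N R w) =
          b i \<otimes>\<^bsub>B\<^esub> T (word_deg w) (monomial N R w)"
        using mult[of "presented_gen N R i" "monomial N R w" 1 "word_deg w"] gc[OF i(1)] wc b[OF i(1)]
        by simp
      thus ?thesis using Cons i m False by (simp add: x)
    qed
  qed
  have vs: "vec B" "vec P" "vec (free_star_alg N)" using B PA by auto
  have h: "free_hom B b \<in> linear_maps (free_star_alg N) B"
    using star_alg_homD(1)[OF free_hom[OF B bc]] .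
  have q: "(\<lambda>p. star_ideal N R +>\<^bsub>free_star_alg N\<^esub> p) \<in> linear_maps (free_star_alg N) P"
    unfolding P using star_alg_homD(1)[OF presented_class_hom[OF RF]] .
  \<comment> \<open>Homogeneity makes one \<open>k\<close> serve all words of \<open>p\<close>, so
    that the word formula \<open>ev\<close> extends linearly.\<close>
  have hT: "free_hom B b p = T k (star_ideal N R +>\<^bsub>free_star_alg N\<^esub> p)" if "homogeneous N k p" for k p
    using that unfolding homogeneous_def
  proof (induction p rule: pm_induct)
    case zero
    show ?case using lin_maps_zero[OF h vs(3,1)] lin_maps_zero[OF lin_maps_compose[OF q lin] vs(3,1)] by simp
  next
    case (single w c)
    hence w: "w \<in> words N" "word_deg w = k" by auto
    have "star_ideal N R +>\<^bsub>free_star_alg N\<^esub> Poly_Mapping.single w c = c \<odot>\<^bsub>P\<^esub> monomial N R w"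
      using lin_mapsD(3)[OF q, of "Poly_Mapping.single w 1" c] w by (simp add: monomial_def)
    thus ?case
      using w ev[OF w(1)] free_hom_single[OF B bc w(1)] lin_mapsD(3)[OF lin] monomial_closed[OF RF w(1)]
      by (simp add: P)
  next
    case (add p p')
    have "p \<in> carrier (free_star_alg N)" "p' \<in> carrier (free_star_alg N)" using add(1,2) by auto
    thus ?case
      using add lin_mapsD(2)[OF h] lin_mapsD(2)[OF lin_maps_compose[OF q lin[of k]]] by simp
  qed
  have kill: "free_hom B b p = \<zero>\<^bsub>B\<^esub>" if p: "p \<in> R" for p
  proof -
    obtain k where k: "homogeneous N k p" using R[OF p] by auto
    show ?thesis
      using hT[OF k] presented_relation[OF RF p] lin_maps_zero[OF lin vs(2,1)] by (simp add: P)
  qed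
  note * = presented_hom[OF RF B bc kill]
  show "presented_hom N R B b \<in> star_alg_hom P B" unfolding P by (rule *(1))
  show "w \<in> words N \<Longrightarrow> presented_hom N R B b (monomial N R w) = T (word_deg w) (monomial N R w)"
    using *(2) ev by auto
qed

section \<open>Powers of unitary elements\<close>

definition unitary :: "('b, 'y) star_algebra_scheme \<Rightarrow> 'b \<Rightarrow> bool" where
  "unitary B u \<longleftrightarrow> u \<in> carrier B \<and> star B u \<otimes>\<^bsub>B\<^esub> u = \<one>\<^bsub>B\<^esub> \<and> u \<otimes>\<^bsub>B\<^esub> star B u = \<one>\<^bsub>B\<^esub>"

text \<open>Integer powers in which the adjoint plays the role of the inverse, as is right for
  \<open>unitary\<close> elements.\<close>

definition upow :: "('b, 'y) star_algebra_scheme \<Rightarrow> 'b \<Rightarrow> int \<Rightarrow> 'b" where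
  "upow B u k = (if 0 \<le> k then u [^]\<^bsub>B\<^esub> nat k else star B u [^]\<^bsub>B\<^esub> nat (- k))"

context
  fixes B :: "('b, 'y) star_algebra_scheme"
  assumes B: "is_star_algebra B"
begin

interpretation B: ring B by (rule star_alg_ring[OF B])

declare pow_nat [simp del]

private lemma star_nat_pow: "u \<in> carrier B \<Longrightarrow> star B (u [^]\<^bsub>B\<^esub> (n::nat)) = star B u [^]\<^bsub>B\<^esub> n"
proof (induction n)
  case (Suc n)
  have "star B (u [^]\<^bsub>B\<^esub> Suc n) = star B u \<otimes>\<^bsub>B\<^esub> star B u [^]\<^bsub>B\<^esub> n" using Suc B by simp
  also have "\<dots> = star B u [^]\<^bsub>B\<^esub> Suc n" using Suc.prems B by (subst B.nat_pow_Suc2) auto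
  finally show ?case .
qed (use B in simp)

lemma upow_closed: "u \<in> carrier B \<Longrightarrow> upow B u k \<in> carrier B"
  using B by (simp add: upow_def)

lemma upow_0: "upow B u 0 = \<one>\<^bsub>B\<^esub>"
  by (simp add: upow_def)

lemma upow_1: "u \<in> carrier B \<Longrightarrow> upow B u 1 = u"
  by (simp add: upow_def)

lemma upow_uminus: "u \<in> carrier B \<Longrightarrow> upow B u (- k) = star B (upow B u k)"
  using B by (auto simp: upow_def star_nat_pow)

lemma upow_Suc:
  assumes u: "unitary B u"
  shows "upow B u (k + 1) = upow B u k \<otimes>\<^bsub>B\<^esub> u"
proof -
  have uc: "u \<in> carrier B" "star B u \<in> carrier B" and uu: "star B u \<otimes>\<^bsub>B\<^esub> u = \<one>\<^bsub>B\<^esub>"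
    using u B by (auto simp: unitary_def)
  consider "0 \<le> k" | m where "k = - int (Suc m)"
    by (cases k) auto
  thus ?thesis
  proof cases
    case 1
    hence "nat (k + 1) = Suc (nat k)" by simp
    thus ?thesis using 1 by (simp add: upow_def)
  next
    case 2
    have "upow B u (k + 1) = star B u [^]\<^bsub>B\<^esub> m" by (auto simp: upow_def 2)
    \<comment> \<open>For negative \<open>k\<close> the extra factor \<open>u\<close> cancels the
      last adjoint in the power.\<close>
    moreover have "upow B u k = star B u [^]\<^bsub>B\<^esub> m \<otimes>\<^bsub>B\<^esub> star B u"
      by (simp add: upow_def 2 nat_add_distrib)
    ultimately show ?thesis using uc uu by (simp add: B.m_assoc)
  qed
qed

lemma upow_pred:
  assumes u: "unitary B u"
  shows "upow B u (k - 1) = upow B u k \<otimes>\<^bsub>B\<^esub> star B u"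
proof -
  have uc: "u \<in> carrier B" and uu: "u \<otimes>\<^bsub>B\<^esub> star B u = \<one>\<^bsub>B\<^esub>"
    using u by (auto simp: unitary_def)
  show ?thesis using upow_Suc[OF u, of "k - 1"] uc uu B upow_closed[OF uc, of "k - 1"]
    by (simp add: star_alg_assoc)
qed

lemma upow_add:
  assumes u: "unitary B u"
  shows "upow B u (k + m) = upow B u k \<otimes>\<^bsub>B\<^esub> upow B u m"
proof (induction m rule: int_induct[where k = 0])
  have uc: "u \<in> carrier B" using u by (auto simp: unitary_def)
  note c = upow_closed[OF uc]
  case base show ?case using c by (simp add: upow_0)
  case (step1 i)
  have "upow B u (k + (i + 1)) = upow B u (k + i) \<otimes>\<^bsub>B\<^esub> u"
    using upow_Suc[OF u, of "k + i"] by (simp add: add.assoc)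
  thus ?case using step1 c uc by (simp add: upow_Suc[OF u] B.m_assoc)
next
  have uc: "u \<in> carrier B" using u by (auto simp: unitary_def)
  note c = upow_closed[OF uc]
  case (step2 i)
  have "upow B u (k + (i - 1)) = upow B u (k + i) \<otimes>\<^bsub>B\<^esub> star B u"
    using upow_pred[OF u, of "k + i"] by (simp add: add_diff_eq)
  thus ?case using step2 c uc B by (simp add: upow_pred[OF u] B.m_assoc)
qed

lemma upow_nat: "upow B u (int n) = u [^]\<^bsub>B\<^esub> n"
  by (simp add: upow_def)

lemma upow_mem_subalgebra:
  assumes S: "star_subalgebra S B" and u: "u \<in> S"
  shows "upow B u k \<in> S"
proof -
  note D = star_subalgebraD[OF B S]
  have "v [^]\<^bsub>B\<^esub> (n::nat) \<in> S" if "v \<in> S" for v n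
    by (induction n) (use D(3,4) that in auto)
  thus ?thesis using u D(7) by (simp add: upow_def)
qed

lemma unitary_upow:
  assumes u: "unitary B u"
  shows "unitary B (upow B u k)"
proof -
  have uc: "u \<in> carrier B" using u by (auto simp: unitary_def)
  show ?thesis unfolding unitary_def
    using upow_add[OF u, of "- k" k] upow_add[OF u, of k "- k"] upow_uminus[OF uc, of k] upow_closed[OF uc]
    by (simp add: upow_0)
qed

text \<open>A one-step recursion determines a family indexed by all integers, since multiplication
  by \<open>u\<close> can be undone. It serves to recognise given families as powers.\<close>

lemma upow_unique:
  assumes f: "f 0 = \<one>\<^bsub>B\<^esub>" "\<And>k. f (k + 1) = f k \<otimes>\<^bsub>B\<^esub> u" and u: "unitary B u" and fc: "\<And>k. f k \<in> carrier B"
  shows "f k = upow B u k"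
proof (induction k rule: int_induct[where k = 0])
  case base show ?case using f by (simp add: upow_0)
  case (step1 i) thus ?case using f(2)[of i] upow_Suc[OF u, of i] by simp
next
  case (step2 i)
  have "f (i - 1) = f (i - 1) \<otimes>\<^bsub>B\<^esub> (u \<otimes>\<^bsub>B\<^esub> star B u)" using u fc by (simp add: unitary_def)
  also have "\<dots> = f i \<otimes>\<^bsub>B\<^esub> star B u"
    using f(2)[of "i - 1"] u fc[of "i - 1"] B by (simp add: unitary_def B.m_assoc)
  finally show ?case using step2 upow_pred[OF u, of i] by simp
qed

text \<open>All letters become \<open>u\<close> or its inverse, so only their signed number
  matters.\<close>

lemma eval_word_unitary:
  assumes u: "unitary B u" and w: "w \<in> words N"
  shows "eval_word B (\<lambda>_. u) w = upow B u (word_deg w)"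
  using w
proof (induction w)
  case (Cons x w)
  obtain i c where x: "x = (i, c)" by (cases x)
  have uc: "u \<in> carrier B" using u by (auto simp: unitary_def)
  have "upow B u (- 1) = star B u" using upow_uminus[OF uc, of 1] by (simp add: upow_1 uc)
  thus ?case using Cons upow_add[OF u, of "- 1" "word_deg w"] upow_add[OF u, of 1 "word_deg w"]
    by (auto simp: x upow_1 uc)
qed (simp add: upow_0)

end

lemma upow_hom:
  assumes f: "f \<in> star_alg_hom A B" and A: "is_star_algebra A" and u: "u \<in> carrier A"
  shows "f (upow A u k) = upow B (f u) k"
proof -
  interpret A: ring A by (rule star_alg_ring[OF A])
  have "f (v [^]\<^bsub>A\<^esub> (n::nat)) = f v [^]\<^bsub>B\<^esub> n" if "v \<in> carrier A" for v n
    by (induction n) (use star_alg_homD[OF f] that in auto)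
  thus ?thesis using u A star_alg_homD(4)[OF f] by (simp add: upow_def del: pow_nat)
qed

section \<open>Algebras with the same underlying structure\<close>

text \<open>\<open>circle_hopf\<close> extends \<open>circle_alg\<close> by further fields, and
  \<open>quotient_circle_hopf\<close> differs from \<open>circle_subalg\<close> in
  \<open>comult\<close>, so these records cannot simply be equated. The tensor constructions read
  only the fields compared here.\<close>

definition same_alg :: "('a, 'x) star_algebra_scheme \<Rightarrow> ('a, 'y) star_algebra_scheme \<Rightarrow> bool" where
  "same_alg A A' \<longleftrightarrow> carrier A = carrier A' \<and> monoid.mult A = monoid.mult A' \<and> one A = one A' \<and>
     ring.zero A = ring.zero A' \<and> add A = add A' \<and> smult A = smult A' \<and> star A = star A'"

lemma same_alg_refl: "same_alg A A"
  by (simp add: same_alg_def)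

lemma same_alg_tensor:
  assumes "same_alg A A'" "same_alg B B'"
  shows "tensor A B = tensor A' B'" "tens A B = tens A' B'"
proof -
  have 1: "free_pairs A B = free_pairs A' B'"
    using assms by (simp add: same_alg_def free_pairs_def DirProd_def)
  have "bilinear_relations A B = bilinear_relations A' B'"
    using assms by (simp add: same_alg_def bilinear_relations_def)
  hence 2: "tensor_null A B = tensor_null A' B'" by (simp add: tensor_null_def 1)
  show "tensor A B = tensor A' B'" "tens A B = tens A' B'"
    by (auto simp: tensor_def tens_def 1 2 fun_eq_iff)
qed

lemma same_alg_linear_maps: "same_alg A A' \<Longrightarrow> linear_maps A M = linear_maps A' M"
  by (simp add: same_alg_def linear_maps_def)

lemma same_alg_star_algebra: "same_alg A A' \<Longrightarrow> is_star_algebra A' \<Longrightarrow> is_star_algebra A"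
  by (rule is_star_algebra_cong[of A']) (auto simp: same_alg_def)

lemma same_alg_corestrict_tensor:
  assumes "same_alg A A'" "same_alg B B'" "same_alg C C'" "same_alg D D'"
  shows "corestrict_tensor A B C D = corestrict_tensor A' B' C' D'"
  using assms same_alg_tensor[OF assms(1,2)] same_alg_tensor[OF assms(3,4)]
  by (simp add: fun_eq_iff corestrict_tensor_def tensor_incl_def tensor_map_def tensor_lift_def)
     (simp add: same_alg_def)

lemma same_alg_lin_span:
  assumes "same_alg A A'" "vec A" "vec A'"
  shows "lin_span A S = lin_span A' S"
  using assms(1) by (auto simp: lin_span_def lin_subspace_iff[OF assms(2)] lin_subspace_iff[OF assms(3)] same_alg_def)

section \<open>The circle and its quotient\<close>

lemma circle_relations_eq:
  "circle_relations = {Poly_Mapping.single [(0, False), (0, True)] 1 - Poly_Mapping.single [(0, True), (0, False)] 1,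
     Poly_Mapping.single [(0, True), (0, False)] 1 - Poly_Mapping.single [] 1}"
  by (simp add: circle_relations_def free_gen_def word_star_def)

lemma circle_relations_carrier: "circle_relations \<subseteq> carrier (free_star_alg {0})"
proof -
  have "\<exists>k. homogeneous {0} k p" if "p \<in> circle_relations" for p
    using that by (auto simp: circle_relations_eq intro!: exI[of _ 0] homogeneous_diff homogeneous_single)
  thus ?thesis using homogeneous_keys by fastforce
qed

lemma is_star_algebra_circle [simp]: "is_star_algebra circle_alg"
  unfolding circle_alg_def by (rule is_star_algebra_presented[OF circle_relations_carrier])

text \<open>One relation gives \<open>\<xi>* \<xi> = 1\<close>; the commutation relation transfers
  this to the other order.\<close>

lemma unitary_xi: "unitary circle_alg xi"
proof -
  let ?m = "monomial {0} circle_relations" and ?q = "\<lambda>p. star_ideal {0} circle_relations +>\<^bsub>free_star_alg {0::nat}\<^esub> p"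
  note R = circle_relations_carrier
  have q: "?q \<in> linear_maps (free_star_alg {0}) circle_alg"
    unfolding circle_alg_def by (rule star_alg_homD(1)[OF presented_class_hom[OF R]])
  have eq: "?m u = ?m v" if uv: "u \<in> words {0}" "v \<in> words {0}"
    and p: "Poly_Mapping.single u 1 - Poly_Mapping.single v 1 \<in> circle_relations" for u v
  proof (rule vec_diff_eq_zero)
    have "?q (Poly_Mapping.single u 1 - Poly_Mapping.single v 1) = \<zero>\<^bsub>circle_alg\<^esub>"
      unfolding circle_alg_def by (rule presented_relation[OF R p])
    thus "?m u \<oplus>\<^bsub>circle_alg\<^esub> (- 1) \<odot>\<^bsub>circle_alg\<^esub> ?m v = \<zero>\<^bsub>circle_alg\<^esub>"
      using lin_maps_free_diff[OF q, of "Poly_Mapping.single u 1" "Poly_Mapping.single v 1"] uv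
      by (simp add: monomial_def)
  qed (use monomial_closed[OF R] uv in \<open>auto simp: circle_alg_def[symmetric]\<close>)
  have xi: "xi = ?m [(0, False)]" "xi \<in> carrier circle_alg"
    using monomial_closed[OF R, of "[(0, False)]"] by (simp_all add: xi_def presented_gen_eq circle_alg_def)
  have xs: "star circle_alg xi = ?m [(0, True)]"
    using monomial_star[OF R, of "[(0, False)]"] by (simp add: xi(1) circle_alg_def word_star_def)
  have "star circle_alg xi \<otimes>\<^bsub>circle_alg\<^esub> xi = ?m [(0, True), (0, False)]"
    using monomial_append[OF R, of "[(0, True)]" "[(0, False)]"] xs xi(1) by (simp add: circle_alg_def)
  moreover have "xi \<otimes>\<^bsub>circle_alg\<^esub> star circle_alg xi = ?m [(0, False), (0, True)]"
    using monomial_append[OF R, of "[(0, False)]" "[(0, True)]"] xs xi(1) by (simp add: circle_alg_def)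
  moreover have "?m [(0, True), (0, False)] = \<one>\<^bsub>circle_alg\<^esub>"
    using eq[of "[(0, True), (0, False)]" "[]"] monomial_Nil[OF R] by (simp add: circle_relations_eq circle_alg_def)
  moreover have "?m [(0, False), (0, True)] = ?m [(0, True), (0, False)]"
    by (rule eq) (auto simp: circle_relations_eq)
  ultimately show ?thesis using xi by (simp add: unitary_def)
qed

lemma xi_closed [simp]: "xi \<in> carrier circle_alg"
  using unitary_xi by (simp add: unitary_def)

text \<open>By unitarity of \<open>xi\<close> every word equals the power of \<open>xi\<close> given
  by its degree.\<close>

lemma circle_span: "carrier circle_alg \<subseteq> lin_span circle_alg (range (upow circle_alg xi))"
proof -
  have "monomial {0} circle_relations w = upow circle_alg xi (word_deg w)" if "w \<in> words {0}" for w
  proof -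
    have "eval_word circle_alg (presented_gen {0} circle_relations) w = eval_word circle_alg (\<lambda>_. xi) w"
      using that by (induction w) (auto simp: xi_def)
    thus ?thesis
      using monomial_eval[OF circle_relations_carrier that] eval_word_unitary[OF _ unitary_xi that]
      by (simp add: circle_alg_def[symmetric])
  qed
  hence "monomial {0} circle_relations ` words {0} \<subseteq> range (upow circle_alg xi)" by auto
  from lin_span_mono[OF this] presented_span[OF circle_relations_carrier]
  show ?thesis unfolding circle_alg_def by blast
qed

text \<open>The universal property of the circle algebra: homomorphisms out of it are prescribed by
  unitary elements.\<close>

lemma circle_hom:
  assumes B: "is_star_algebra B" and u: "unitary B u"
  shows "presented_hom {0} circle_relations B (\<lambda>_. u) \<in> star_alg_hom circle_alg B"
    and "presented_hom {0} circle_relations B (\<lambda>_. u) (upow circle_alg xi k) = upow B u k"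
proof -
  have uc: "u \<in> carrier B" and uu: "star B u \<otimes>\<^bsub>B\<^esub> u = \<one>\<^bsub>B\<^esub>" "u \<otimes>\<^bsub>B\<^esub> star B u = \<one>\<^bsub>B\<^esub>"
    using u by (auto simp: unitary_def)
  note R = circle_relations_carrier
  note h = star_alg_homD(1)[OF free_hom[OF B uc, where N = "{0::nat}"]]
  have d: "free_hom B (\<lambda>_. u) (Poly_Mapping.single v 1 - Poly_Mapping.single w 1) = \<zero>\<^bsub>B\<^esub>"
    if "v \<in> words {0}" "w \<in> words {0::nat}" "eval_word B (\<lambda>_. u) v = eval_word B (\<lambda>_. u) w" for v w
    using lin_maps_free_diff[OF h, of "Poly_Mapping.single v 1" "Poly_Mapping.single w 1"] that
      free_hom_single[OF B uc that(1), where c = 1] free_hom_single[OF B uc that(2), where c = 1]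
      eval_word_closed[OF B uc that(2)] B by simp
  have kill: "free_hom B (\<lambda>_. u) p = \<zero>\<^bsub>B\<^esub>" if "p \<in> circle_relations" for p
    using that B uc uu by (auto simp: circle_relations_eq intro!: d)
  note * = presented_hom[OF R B uc kill]
  show f: "presented_hom {0} circle_relations B (\<lambda>_. u) \<in> star_alg_hom circle_alg B"
    unfolding circle_alg_def by (rule *(1)) auto
  have "presented_hom {0} circle_relations B (\<lambda>_. u) xi = u"
    using *(2)[of "[(0, False)]"] B uc by (simp add: xi_def presented_gen_eq)
  thus "presented_hom {0} circle_relations B (\<lambda>_. u) (upow circle_alg xi k) = upow B u k"
    using upow_hom[OF f is_star_algebra_circle xi_closed] by simp
qed

lemma circle_hopf_fields [simp]:
  "carrier circle_hopf = carrier circle_alg" "monoid.mult circle_hopf = monoid.mult circle_alg"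
  "one circle_hopf = one circle_alg" "ring.zero circle_hopf = ring.zero circle_alg"
  "add circle_hopf = add circle_alg" "smult circle_hopf = smult circle_alg"
  "star circle_hopf = star circle_alg"
  "comult circle_hopf = presented_hom {0} circle_relations (tensor circle_alg circle_alg)
        (\<lambda>_. tens circle_alg circle_alg xi xi)"
  "counit circle_hopf = presented_hom {0} circle_relations complex_alg (\<lambda>_. 1)"
  "antipode circle_hopf = presented_hom {0} circle_relations circle_alg (\<lambda>_. star circle_alg xi)"
  by (simp_all add: circle_hopf_def star_algebra.extend_def hopf_algebra.fields_def)

lemma same_circle: "same_alg circle_hopf circle_alg"
  by (simp add: same_alg_def)

lemma is_star_algebra_circle_hopf [simp]: "is_star_algebra circle_hopf"
  by (rule same_alg_star_algebra[OF same_circle is_star_algebra_circle])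

text \<open>The homomorphism that sends \<open>xi\<close> to the generator of the Laurent
  polynomials. It separates the powers of \<open>xi\<close> without a normal form for words.\<close>

definition circle_coord :: "word_class \<Rightarrow> int \<Rightarrow>\<^sub>0 complex" where
  "circle_coord = presented_hom {0} circle_relations int_alg (\<lambda>_. Poly_Mapping.single 1 1)"

text \<open>Every structure map comes from \<open>circle_hom\<close>, which computes it on powers of
  \<open>xi\<close> as powers of a unitary. The values claimed by the locale are recognised as these
  powers by \<open>upow_unique\<close>.\<close>

lemma group_like_basis_circle: "group_like_basis circle_hopf (upow circle_alg xi) circle_coord"
proof
  let ?C = circle_alg
  let ?CC = "tensor ?C ?C"
  have u: "xi \<in> carrier ?C" "star ?C xi \<in> carrier ?C" by auto
  have C: "is_star_algebra ?C" "vec ?C" "vec circle_hopf" by auto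
  have lin: "linear_maps circle_hopf M = linear_maps ?C M" for M :: "('m, 'n) star_algebra_scheme"
    by (rule same_alg_linear_maps[OF same_circle])
  have lin': "linear_maps circle_hopf circle_hopf = linear_maps ?C ?C"
    by (simp add: linear_maps_def)
  have tc: "tensor circle_hopf circle_hopf = ?CC" "tens circle_hopf circle_hopf = tens ?C ?C"
    using same_alg_tensor[OF same_circle same_circle] by auto
  show "is_star_algebra circle_hopf" by simp
  show "upow ?C xi k \<in> carrier circle_hopf" for k by (simp add: upow_closed)
  show "carrier circle_hopf \<subseteq> lin_span circle_hopf (range (upow ?C xi))"
    using circle_span same_alg_lin_span[OF same_circle] C by simp
  show "upow ?C xi 0 = \<one>\<^bsub>circle_hopf\<^esub>" by (simp add: upow_0)
  show "upow ?C xi (k + m) = upow ?C xi k \<otimes>\<^bsub>circle_hopf\<^esub> upow ?C xi m" for k m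
    using upow_add[OF C(1) unitary_xi] by simp
  show "star circle_hopf (upow ?C xi k) = upow ?C xi (- k)" for k
    using upow_uminus[OF C(1) u(1)] by simp
  have z: "unitary int_alg (Poly_Mapping.single 1 1)" by (simp add: unitary_def)
  have zp: "Poly_Mapping.single k 1 = upow int_alg (Poly_Mapping.single 1 1) k" for k
    by (rule upow_unique[OF is_star_algebra_int_alg _ _ z]) auto
  show "circle_coord \<in> linear_maps circle_hopf int_alg"
    unfolding lin circle_coord_def by (rule star_alg_homD(1)[OF circle_hom(1)[OF _ z]]) simp
  show "circle_coord (upow ?C xi k) = Poly_Mapping.single k 1" for k
    unfolding circle_coord_def zp[of k] by (rule circle_hom(2)[OF _ z]) simp
  have CC: "is_star_algebra ?CC" using C by simp
  have x2: "unitary ?CC (tens ?C ?C xi xi)"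
    using unitary_xi C by (simp add: unitary_def tensor_one)
  \<comment> \<open>The tensors of a power with itself are the powers of
    \<open>xi \<otimes> xi\<close>; hence all powers of \<open>xi\<close> are group-like.\<close>
  have x2p: "tens ?C ?C (upow ?C xi k) (upow ?C xi k) = upow ?CC (tens ?C ?C xi xi) k" for k
    by (rule upow_unique[OF CC _ _ x2])
      (use C u in \<open>auto simp: upow_0 upow_Suc[OF C(1) unitary_xi] upow_closed tensor_one\<close>)
  show "comult circle_hopf \<in> linear_maps circle_hopf (tensor circle_hopf circle_hopf)"
    unfolding lin tc using star_alg_homD(1)[OF circle_hom(1)[OF CC x2]] by simp
  show "comult circle_hopf (upow ?C xi k) = tens circle_hopf circle_hopf (upow ?C xi k) (upow ?C xi k)" for k
    unfolding tc x2p using circle_hom(2)[OF CC x2] by simp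
  have o: "unitary complex_alg 1" by (simp add: unitary_def)
  have op: "1 = upow complex_alg 1 k" for k
    by (rule upow_unique[OF _ _ _ o, where f = "\<lambda>_. 1"]) auto
  show "counit circle_hopf \<in> linear_maps circle_hopf complex_alg"
    unfolding lin using star_alg_homD(1)[OF circle_hom(1)[OF _ o]] by simp
  show "counit circle_hopf (upow ?C xi k) = 1" for k
    using circle_hom(2)[OF _ o, of k] op by simp
  have s: "unitary ?C (star ?C xi)" using unitary_xi C by (simp add: unitary_def)
  \<comment> \<open>Negative powers of \<open>xi\<close> are the powers of its adjoint, to which the
    antipode maps \<open>xi\<close>.\<close>
  have sp: "upow ?C xi (- k) = upow ?C (star ?C xi) k" for k
  proof (rule upow_unique[OF C(1) _ _ s])
    show "upow ?C xi (- (k + 1)) = upow ?C xi (- k) \<otimes>\<^bsub>?C\<^esub> star ?C xi" for k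
      using upow_pred[OF C(1) unitary_xi, of "- k"] by simp
  qed (auto simp: upow_0 upow_closed)
  show "antipode circle_hopf \<in> linear_maps circle_hopf circle_hopf"
    unfolding lin' using star_alg_homD(1)[OF circle_hom(1)[OF C(1) s]] by simp
  show "antipode circle_hopf (upow ?C xi k) = upow ?C xi (- k)" for k
    using circle_hom(2)[OF C(1) s, of k] sp by simp
qed

text \<open>The subspaces of the restricted record are those of \<open>A\<close> inside
  \<open>F\<close>, and the ambient span is one of them.\<close>

lemma lin_span_subalgebra:
  assumes A: "vec A" and F: "lin_subspace F A" and S: "S \<subseteq> F"
  shows "lin_span (A\<lparr>carrier := F\<rparr>) S = lin_span A S"
proof -
  note D = lin_subspaceD[OF A F]
  have v: "vec (A\<lparr>carrier := F\<rparr>)" by (rule vec_subspace[OF A F])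
  have 1: "lin_subspace V (A\<lparr>carrier := F\<rparr>) \<longleftrightarrow> lin_subspace V A \<and> V \<subseteq> F" for V
    using D(1) by (auto simp: lin_subspace_iff[OF A] lin_subspace_iff[OF v])
  have 2: "lin_span A S \<subseteq> F" by (rule lin_span_minimal[OF F S])
  have 3: "lin_subspace (lin_span A S) A" by (rule lin_span_subspace[OF A]) (use S D(1) in auto)
  show ?thesis
  proof
    show "lin_span (A\<lparr>carrier := F\<rparr>) S \<subseteq> lin_span A S"
      by (rule lin_span_minimal) (use 1 2 3 in \<open>auto intro: lin_span_base\<close>)
    show "lin_span A S \<subseteq> lin_span (A\<lparr>carrier := F\<rparr>) S"
      unfolding lin_span_def 1 by blast
  qed
qed

lemma lin_subspace_finsum:
  assumes A: "vec A" and W: "lin_subspace W A" and J: "finite J" and f: "\<And>j. j \<in> J \<Longrightarrow> f j \<in> W"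
  shows "finsum A f J \<in> W"
  using J f
proof (induction J rule: finite_induct)
  interpret A: abelian_group A by (rule vec_abelian_group[OF A])
  note D = lin_subspaceD[OF A W]
  case empty show ?case using D(2) by simp
next
  interpret A: abelian_group A by (rule vec_abelian_group[OF A])
  note D = lin_subspaceD[OF A W]
  case (insert j J)
  have "f \<in> J \<rightarrow> carrier A" "f j \<in> carrier A" using insert D(5) by auto
  thus ?case using insert D(3) by simp
qed

text \<open>The functional with value one on the powers with exponent in \<open>E\<close> and zero
  on the others; together with the coaction it selects degrees in the sphere algebra.\<close>

definition circle_functional :: "int set \<Rightarrow> word_class \<Rightarrow> complex" where
  "circle_functional E h = lin_ext complex_alg (\<lambda>k. if k \<in> E then 1 else 0) (circle_coord h)"

interpretation circle: group_like_basis circle_hopf "upow circle_alg xi" circle_coord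
  by (rule group_like_basis_circle)

lemma circle_functional:
  "circle_functional E \<in> linear_maps circle_hopf complex_alg"
  "circle_functional E (upow circle_alg xi k) = (if k \<in> E then 1 else 0)"
proof -
  have "lin_ext complex_alg (\<lambda>k. if k \<in> E then 1 else 0) \<in> linear_maps int_alg complex_alg"
    unfolding int_alg_def by (rule lin_ext_linear) auto
  from lin_maps_compose[OF circle.\<kappa> this]
  show "circle_functional E \<in> linear_maps circle_hopf complex_alg"
    by (simp add: circle_functional_def[abs_def])
  show "circle_functional E (upow circle_alg xi k) = (if k \<in> E then 1 else 0)"
    by (simp add: circle_functional_def circle.\<kappa>_g lin_ext_single)
qed

section \<open>The Hopf subalgebra generated by the r-th power of \<open>xi\<close>\<close>

definition circle_sub :: "nat \<Rightarrow> word_class set" where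
  "circle_sub r = lin_span circle_hopf (range (\<lambda>k. upow circle_alg xi (int r * k)))"

lemma circle_sub_star_subalgebra: "star_subalgebra (circle_sub r) circle_hopf"
  unfolding circle_sub_def
proof (rule star_subalgebra_lin_span)
  show "\<one>\<^bsub>circle_hopf\<^esub> \<in> range (\<lambda>k. upow circle_alg xi (int r * k))"
    unfolding circle.g_zero[symmetric] by (rule range_eqI[of _ _ 0]) simp
  fix x assume "x \<in> range (\<lambda>k. upow circle_alg xi (int r * k))"
  then obtain k where x: "x = upow circle_alg xi (int r * k)" by auto
  show "star circle_hopf x \<in> range (\<lambda>k. upow circle_alg xi (int r * k))"
    unfolding x circle.g_star by (rule range_eqI[of _ _ "- k"]) simp
  fix y assume "y \<in> range (\<lambda>k. upow circle_alg xi (int r * k))"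
  then obtain m where y: "y = upow circle_alg xi (int r * m)" by auto
  show "x \<otimes>\<^bsub>circle_hopf\<^esub> y \<in> range (\<lambda>k. upow circle_alg xi (int r * k))"
    unfolding x y circle.g_mult by (rule range_eqI[of _ _ "k + m"]) (simp add: distrib_left)
qed (use circle.g_closed in auto)

lemma circle_sub_subset: "circle_sub r \<subseteq> carrier circle_hopf"
  by (rule star_subalgebraD(2)[OF circle.H circle_sub_star_subalgebra])

lemma upow_circle_sub: "upow circle_alg xi (int r * k) \<in> circle_sub r"
  unfolding circle_sub_def by (rule lin_span_base) auto

lemma same_alg_star_subalgebra:
  assumes "same_alg A A'" "is_star_algebra A" "is_star_algebra A'" "star_subalgebra F A"
  shows "star_subalgebra F A'"
proof (rule star_subalgebraI[OF assms(3)])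
  note D = star_subalgebraD[OF assms(2,4)]
  show "lin_subspace F A'"
    by (rule lin_subspaceI) (use D assms(1,3) in \<open>auto simp: same_alg_def\<close>)
qed (use star_subalgebraD[OF assms(2,4)] assms(1) in \<open>auto simp: same_alg_def\<close>)

text \<open>The multiples of \<open>r\<close> form a group, so the span is a star-subalgebra.
  Conversely a star-subalgebra that contains the unitary \<open>\<xi>^r\<close> contains all its
  integer powers.\<close>

lemma gen_star_subalgebra_circle:
  "gen_star_subalgebra circle_alg {xi [^]\<^bsub>circle_alg\<^esub> r, star circle_alg xi [^]\<^bsub>circle_alg\<^esub> r} = circle_sub r"
    (is "?G = _")
proof
  let ?C = circle_alg
  have C: "is_star_algebra ?C" by simp
  show "?G \<subseteq> circle_sub r"
  proof (rule gen_star_subalgebra_minimal)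
    show "star_subalgebra (circle_sub r) ?C"
      by (rule same_alg_star_subalgebra[OF same_circle _ _ circle_sub_star_subalgebra]) auto
    have "xi [^]\<^bsub>?C\<^esub> r = upow ?C xi (int r * 1)" "star ?C xi [^]\<^bsub>?C\<^esub> r = upow ?C xi (int r * (- 1))"
      by (auto simp: upow_def)
    thus "{xi [^]\<^bsub>?C\<^esub> r, star ?C xi [^]\<^bsub>?C\<^esub> r} \<subseteq> circle_sub r"
      using upow_circle_sub by (metis empty_subsetI insert_subset)
  qed
  show "circle_sub r \<subseteq> ?G"
  proof (rule gen_star_subalgebra_greatest)
    fix B assume B: "star_subalgebra B ?C" "{xi [^]\<^bsub>?C\<^esub> r, star ?C xi [^]\<^bsub>?C\<^esub> r} \<subseteq> B"
    let ?u = "upow ?C xi (int r)"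
    have u: "unitary ?C ?u" by (rule unitary_upow[OF C unitary_xi])
    have "upow ?C xi (int r * k) = upow ?C ?u k" for k
      by (rule upow_unique[OF C _ _ u])
        (simp_all add: upow_0 distrib_left upow_add[OF C unitary_xi] upow_closed)
    moreover have "?u \<in> B" using B(2) by (simp add: upow_nat)
    ultimately have "upow ?C xi (int r * k) \<in> B" for k
      using upow_mem_subalgebra[OF C B(1), of ?u k] by simp
    moreover have "lin_subspace B circle_hopf"
      by (rule star_subalgebraD(1)[OF circle.H same_alg_star_subalgebra[OF _ _ _ B(1)]])
        (use same_circle in \<open>auto simp: same_alg_def\<close>)
    ultimately show "circle_sub r \<subseteq> B" unfolding circle_sub_def by (intro lin_span_minimal) auto
  qed
qed

text \<open>The projection onto the invariants of the r-th roots of unity: it drops all powers of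
  \<open>xi\<close> whose exponent \<open>r\<close> does not divide.\<close>

definition circle_retract :: "nat \<Rightarrow> word_class \<Rightarrow> word_class" where
  "circle_retract r h = lin_ext circle_hopf
     (\<lambda>k. if int r dvd k then upow circle_alg xi k else \<zero>\<^bsub>circle_hopf\<^esub>) (circle_coord h)"

abbreviation circle_subalg :: "nat \<Rightarrow> word_class hopf_algebra" where
  "circle_subalg r \<equiv> circle_hopf\<lparr>carrier := circle_sub r\<rparr>"

lemma circle_retract:
  "circle_retract r \<in> linear_maps circle_hopf (circle_subalg r)"
  "\<forall>h\<in>circle_sub r. circle_retract r h = h"
proof -
  let ?f = "\<lambda>k. if int r dvd k then upow circle_alg xi k else \<zero>\<^bsub>circle_hopf\<^esub>"
  have fc: "?f k \<in> circle_sub r" for k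
    using upow_circle_sub[of r] star_subalgebraD(8)[OF circle.H circle_sub_star_subalgebra[of r]]
    by (auto elim!: dvdE simp del: circle_hopf_fields)
  have fc': "?f k \<in> carrier circle_hopf" for k using fc[of k] circle_sub_subset by blast
  have "lin_ext circle_hopf ?f \<in> linear_maps int_alg circle_hopf"
    unfolding int_alg_def by (rule lin_ext_linear) (use fc' in \<open>auto simp del: circle_hopf_fields\<close>)
  from lin_maps_compose[OF circle.\<kappa> this]
  have lin: "circle_retract r \<in> linear_maps circle_hopf circle_hopf"
    by (simp add: circle_retract_def[abs_def])
  have g: "circle_retract r (upow circle_alg xi k) = ?f k" for k
    using lin_ext_single[OF circle.vH, of ?f k 1] fc'[of k]
    by (simp add: circle_retract_def circle.\<kappa>_g del: circle_hopf_fields)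
  have rc: "range (upow circle_alg xi) \<subseteq> carrier circle_hopf" using circle.g_closed by blast
  have sub: "lin_subspace (circle_sub r) circle_hopf"
    by (rule star_subalgebraD(1)[OF circle.H circle_sub_star_subalgebra])
  have into: "circle_retract r h \<in> circle_sub r" if "h \<in> carrier circle_hopf" for h
    by (rule lin_span_map_into[OF subsetD[OF circle.g_span that] lin circle.vH circle.vH rc sub])
      (use g fc in auto)
  show "circle_retract r \<in> linear_maps circle_hopf (circle_subalg r)"
    by (rule lin_maps_corestrict[OF lin into])
  have "circle_retract r h = h" if "h \<in> circle_sub r" for h
    by (rule lin_span_map_eq[OF that[unfolded circle_sub_def] lin lin_maps_id circle.vH circle.vH])
      (use circle.g_closed g in auto)
  thus "\<forall>h\<in>circle_sub r. circle_retract r h = h" by blast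
qed

lemma quotient_circle_fields [simp]:
  "carrier (quotient_circle_hopf r) = circle_sub r"
  "counit (quotient_circle_hopf r) = counit circle_hopf"
  "antipode (quotient_circle_hopf r) = antipode circle_hopf"
  "comult (quotient_circle_hopf r) =
     corestrict_tensor (circle_subalg r) (circle_subalg r) circle_hopf circle_hopf (comult circle_hopf)"
  by (simp_all add: quotient_circle_hopf_def gen_star_subalgebra_circle sub_hopf_def)

lemma same_quotient: "same_alg (quotient_circle_hopf r) (circle_subalg r)"
  by (simp add: same_alg_def quotient_circle_hopf_def gen_star_subalgebra_circle sub_hopf_def)

lemma is_star_algebra_circle_subalg [simp]: "is_star_algebra (circle_subalg r)"
  by (rule is_star_algebra_subalgebra[OF circle.H circle_sub_star_subalgebra])

lemma circle_subalg_span: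
  "carrier (circle_subalg r) \<subseteq> lin_span (circle_subalg r) (range (\<lambda>k. upow circle_alg xi (int r * k)))"
proof -
  have "range (\<lambda>k. upow circle_alg xi (int r * k)) \<subseteq> circle_sub r" using upow_circle_sub by auto
  thus ?thesis
    using lin_span_subalgebra[OF circle.vH star_subalgebraD(1)[OF circle.H circle_sub_star_subalgebra]]
    by (simp add: circle_sub_def)
qed

text \<open>Exponents are divided by \<open>r\<close>, because the basis element with index
  \<open>k\<close> is \<open>\<xi>^(r k)\<close>.\<close>

definition quotient_coord :: "nat \<Rightarrow> word_class \<Rightarrow> int \<Rightarrow>\<^sub>0 complex" where
  "quotient_coord r h = lin_ext int_alg
     (\<lambda>k. if int r dvd k then Poly_Mapping.single (k div int r) 1 else 0) (circle_coord h)"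

text \<open>The basis elements are group-like already in the circle algebra, so their coproducts are
  pure tensors over the subalgebra and \<open>corestrict_tensor\<close> applies with
  \<open>circle_retract\<close> on both factors.\<close>

lemma group_like_basis_quotient:
  assumes r: "r > 0"
  shows "group_like_basis (quotient_circle_hopf r) (\<lambda>k. upow circle_alg xi (int r * k)) (quotient_coord r)"
proof
  let ?Q = "quotient_circle_hopf r" and ?K = "circle_subalg r" and ?g = "\<lambda>k. upow circle_alg xi (int r * k)"
  note same = same_quotient[of r]
  have lin: "linear_maps ?Q M = linear_maps ?K M" for M :: "('m, 'n) star_algebra_scheme"
    by (rule same_alg_linear_maps[OF same])
  have linQ: "linear_maps ?K ?Q = linear_maps ?K ?K"
    using same by (simp add: linear_maps_def same_alg_def)
  note tQ = same_alg_tensor[OF same same]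
  have f: "monoid.mult ?Q = monoid.mult circle_hopf" "one ?Q = one circle_hopf" "star ?Q = star circle_hopf"
    using same by (simp_all add: same_alg_def)
  show Q: "is_star_algebra ?Q" by (rule same_alg_star_algebra[OF same is_star_algebra_circle_subalg])
  have vK: "vec ?K" "vec ?Q" using Q is_star_algebra_circle_subalg[of r] by blast+
  show gc: "?g k \<in> carrier ?Q" for k using upow_circle_sub by simp
  have grange: "range ?g \<subseteq> carrier ?K" using upow_circle_sub by auto
  show "carrier ?Q \<subseteq> lin_span ?Q (range ?g)"
    using circle_subalg_span[of r] same_alg_lin_span[OF same vK(2,1)] by simp
  show "?g 0 = \<one>\<^bsub>?Q\<^esub>" using circle.g_zero by (simp add: f)
  show "?g (k + m) = ?g k \<otimes>\<^bsub>?Q\<^esub> ?g m" for k m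
    unfolding f distrib_left by (rule circle.g_add)
  show "star ?Q (?g k) = ?g (- k)" for k unfolding f circle.g_star by simp
  let ?e = "\<lambda>k. if int r dvd k then Poly_Mapping.single (k div int r) (1::complex) else 0"
  have "lin_ext int_alg ?e \<in> linear_maps int_alg int_alg"
    using lin_ext_linear[of int_alg ?e "\<lparr>carrier = UNIV, monoid.mult = (+), one = 0\<rparr>" uminus]
    by (simp add: int_alg_def[symmetric] star_alg_vec)
  from lin_maps_compose[OF circle.\<kappa> this]
  have "quotient_coord r \<in> linear_maps circle_hopf int_alg" by (simp add: quotient_coord_def[abs_def])
  thus "quotient_coord r \<in> linear_maps ?Q int_alg"
    unfolding lin by (rule lin_maps_restrict[OF _ circle_sub_subset])
  \<comment> \<open>Positivity of \<open>r\<close> enters through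
    \<open>int r * k div int r = k\<close>.\<close>
  show "quotient_coord r (?g k) = Poly_Mapping.single k 1" for k
    using lin_ext_single[of int_alg ?e "int r * k" 1] r
    by (simp add: quotient_coord_def circle.\<kappa>_g star_alg_vec)
  have cg: "comult circle_hopf (?g k) = tens circle_hopf circle_hopf (?g k) (?g k)" for k
    by (rule circle.comult(2))
  note sub = circle_sub_star_subalgebra[of r]
  note ret = circle_retract[of r]
  note core = corestrict_tensor[OF circle.H circle.H sub sub ret ret,
      OF lin_maps_restrict[OF circle.comult(1) circle_sub_subset] vK(1) grange circle_subalg_span]
  show "comult ?Q \<in> linear_maps ?Q (tensor ?Q ?Q)"
    unfolding lin tQ quotient_circle_fields
    by (rule core(1)) (use cg upow_circle_sub in blast)
  show "comult ?Q (?g k) = tens ?Q ?Q (?g k) (?g k)" for k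
    unfolding tQ quotient_circle_fields
    by (rule corestrict_tensor_tens[where f = "comult circle_hopf" and x = "?g k",
          OF circle.H circle.H sub sub ret ret upow_circle_sub upow_circle_sub cg])
  show "counit ?Q \<in> linear_maps ?Q complex_alg"
    unfolding lin quotient_circle_fields by (rule lin_maps_restrict[OF circle.counit(1) circle_sub_subset])
  show "counit ?Q (?g k) = 1" for k unfolding quotient_circle_fields by (rule circle.counit(2))
  have anti: "antipode circle_hopf \<in> linear_maps ?K circle_hopf"
    by (rule lin_maps_restrict[OF circle.antipode(1) circle_sub_subset])
  have ag: "antipode circle_hopf (?g k) = ?g (- k)" for k
    using circle.antipode(2)[of "int r * k"] by simp
  have "antipode circle_hopf h \<in> circle_sub r" if "h \<in> carrier ?K" for h
    by (rule lin_span_map_into[OF subsetD[OF circle_subalg_span that] anti vK(1) circle.vH grange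
          star_subalgebraD(1)[OF circle.H sub]]) (use ag upow_circle_sub[of r "- k" for k] in \<open>auto simp del: circle_hopf_fields\<close>)
  from lin_maps_corestrict[OF anti this]
  show "antipode ?Q \<in> linear_maps ?Q ?Q" unfolding lin linQ quotient_circle_fields by simp
  show "antipode ?Q (?g k) = ?g (- k)" for k unfolding quotient_circle_fields by (rule ag)
qed

text \<open>The first isomorphism theorem for the r-th power map, whose kernel consists of the r-th
  roots of unity.\<close>

lemma quotient_circle_group_iso:
  assumes r: "r > 0"
  shows "quotient_circle_group r \<cong> circle_group"
proof -
  have G: "group circle_group"
  proof (rule groupI)
    fix x assume "x \<in> carrier circle_group"
    thus "\<exists>y\<in>carrier circle_group. y \<otimes>\<^bsub>circle_group\<^esub> x = \<one>\<^bsub>circle_group\<^esub>"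
      by (intro bexI[of _ "inverse x"]) (auto simp: circle_group_def norm_inverse intro!: left_inverse)
  qed (auto simp: circle_group_def norm_mult)
  interpret h: group_hom circle_group circle_group "\<lambda>l. l ^ r"
    by (rule group_hom.intro[OF G G])
      (auto simp: group_hom_axioms_def hom_def circle_group_def norm_power power_mult_distrib)
  have "kernel circle_group circle_group (\<lambda>l. l ^ r) = roots_of_unity r"
    by (auto simp: kernel_def roots_of_unity_def circle_group_def)
  moreover have "(\<lambda>l. l ^ r) ` carrier circle_group = carrier circle_group"
  proof (intro equalityI subsetI)
    fix l assume "l \<in> carrier circle_group"
    hence "l = cis (Arg l)" using rcis_cmod_Arg[of l] by (auto simp: circle_group_def rcis_def)
    \<comment> \<open>Dividing the argument by \<open>r\<close> gives an r-th root on the circle,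
      hence surjectivity.\<close>
    also have "\<dots> = cis (Arg l / real r) ^ r" using r by (simp add: DeMoivre)
    finally show "l \<in> (\<lambda>l. l ^ r) ` carrier circle_group"
      by (rule image_eqI) (simp add: circle_group_def)
  qed (auto simp: circle_group_def norm_power)
  ultimately have "(\<lambda>c. the_elem ((\<lambda>l. l ^ r) ` c)) \<in> iso (quotient_circle_group r) circle_group"
    using h.FactGroup_iso_set unfolding quotient_circle_group_def by simp
  thus ?thesis by (auto simp: is_iso_def)
qed

lemma vec_add_diff_cancel:
  "vec M \<Longrightarrow> x \<in> carrier M \<Longrightarrow> c \<in> carrier M \<Longrightarrow> x \<oplus>\<^bsub>M\<^esub> c \<oplus>\<^bsub>M\<^esub> (- 1) \<odot>\<^bsub>M\<^esub> c = x"
  by (simp add: vec_add_assoc)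

lemma vec_add_diff:
  "vec M \<Longrightarrow> x \<in> carrier M \<Longrightarrow> c \<in> carrier M \<Longrightarrow> x \<oplus>\<^bsub>M\<^esub> (c \<oplus>\<^bsub>M\<^esub> (- 1) \<odot>\<^bsub>M\<^esub> x) = c"
  by (simp add: vec_add_left_commute)

section \<open>The grading of the quantum sphere\<close>

locale quantum_sphere =
  fixes n :: nat and q :: real
  assumes q_nonzero: "q \<noteq> 0"
begin

abbreviation "S \<equiv> sphere_alg n q"
abbreviation "R \<equiv> sphere_relations n q"
abbreviation "m \<equiv> monomial {..n} R"
abbreviation "W \<equiv> words {..n}"
abbreviation "C \<equiv> circle_hopf"
abbreviation "\<xi> \<equiv> upow circle_alg xi"
abbreviation "cls p \<equiv> star_ideal {..n} R +>\<^bsub>free_star_alg {..n}\<^esub> p"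

lemma sphere_relations_eq:
  "R = {Poly_Mapping.single [(i, False), (j, False)] 1 -
          Poly_Mapping.map ((*) (complex_of_real (inverse q))) (Poly_Mapping.single [(j, False), (i, False)] 1)
          | i j. i < j \<and> j \<le> n} \<union>
       {Poly_Mapping.single [(i, True), (j, False)] 1 -
          Poly_Mapping.map ((*) (complex_of_real q)) (Poly_Mapping.single [(j, False), (i, True)] 1)
          | i j. i \<le> n \<and> j \<le> n \<and> i \<noteq> j} \<union>
       {Poly_Mapping.single [(n, True), (n, False)] 1 - Poly_Mapping.single [(n, False), (n, True)] 1} \<union>
       {(Poly_Mapping.single [(i, True), (i, False)] 1 - Poly_Mapping.single [(i, False), (i, True)] 1) -
          Poly_Mapping.map ((*) (complex_of_real (1 - q\<^sup>2)))
            (\<Sum>j = i + 1..n. Poly_Mapping.single [(j, False), (j, True)] 1) | i. i < n} \<union>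
       {(\<Sum>i = 0..n. Poly_Mapping.single [(i, False), (i, True)] 1) - Poly_Mapping.single [] 1}"
  by (simp add: sphere_relations_def Let_def free_gen_def word_star_def)

text \<open>The relations between \<open>z\<^sub>i\<close> and \<open>z\<^sub>j\<close> have degree
  2. All others have degree 0, including the last one, whose constant term is the empty
  word.\<close>

lemma R_homogeneous: "p \<in> R \<Longrightarrow> \<exists>k. homogeneous {..n} k p"
proof -
  assume "p \<in> R"
  hence "homogeneous {..n} 2 p \<or> homogeneous {..n} 0 p"
    unfolding sphere_relations_eq
    by (elim UnE; elim CollectE singletonE exE conjE; hypsubst)
      ((rule disjI1, intro homogeneous_diff homogeneous_scale homogeneous_sum homogeneous_single; force) |
       (rule disjI2, intro homogeneous_diff homogeneous_scale homogeneous_sum homogeneous_single; force))+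
  thus ?thesis by blast
qed

lemma R_carrier: "R \<subseteq> carrier (free_star_alg {..n})"
  using R_homogeneous homogeneous_keys by fastforce

lemma S [simp]: "is_star_algebra S"
  unfolding sphere_alg_def by (rule is_star_algebra_presented[OF R_carrier])

lemma vS [simp]: "vec S"
  using S by blast

interpretation S: abelian_group S
  by (rule vec_abelian_group[OF vS])

lemma m_closed [simp]: "w \<in> W \<Longrightarrow> m w \<in> carrier S"
  unfolding sphere_alg_def by (rule monomial_closed[OF R_carrier])

lemma m_Nil: "m [] = \<one>\<^bsub>S\<^esub>"
  unfolding sphere_alg_def by (rule monomial_Nil[OF R_carrier])

lemma m_append: "u \<in> W \<Longrightarrow> v \<in> W \<Longrightarrow> m (u @ v) = m u \<otimes>\<^bsub>S\<^esub> m v"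
  unfolding sphere_alg_def by (rule monomial_append[OF R_carrier])

lemma m_star: "w \<in> W \<Longrightarrow> star S (m w) = m (word_star w)"
  unfolding sphere_alg_def by (rule monomial_star[OF R_carrier, symmetric])

lemma m_span: "carrier S \<subseteq> lin_span S (m ` W)"
  unfolding sphere_alg_def by (rule presented_span[OF R_carrier])

lemma sphere_gen_eq: "sphere_gen n q i = m [(i, False)]"
  by (simp add: sphere_gen_def presented_gen_eq)

lemma cls: "(\<lambda>p. cls p) \<in> linear_maps (free_star_alg {..n}) S"
  unfolding sphere_alg_def by (rule star_alg_homD(1)[OF presented_class_hom[OF R_carrier]])

text \<open>Turns a member of \<open>R\<close>, written as a difference, into an equation in the
  sphere algebra.\<close>

lemma cls_relation:
  assumes "p - p' \<in> R" "Poly_Mapping.keys p \<subseteq> W" "Poly_Mapping.keys p' \<subseteq> W"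
  shows "cls p = cls p'"
proof (rule vec_diff_eq_zero[OF vS])
  have "cls (p - p') = \<zero>\<^bsub>S\<^esub>" unfolding sphere_alg_def by (rule presented_relation[OF R_carrier assms(1)])
  thus "cls p \<oplus>\<^bsub>S\<^esub> (- 1) \<odot>\<^bsub>S\<^esub> cls p' = \<zero>\<^bsub>S\<^esub>" using lin_maps_free_diff[OF cls assms(2,3)] by simp
qed (use lin_mapsD(1)[OF cls] assms in auto)

lemma cls_scale: "Poly_Mapping.keys p \<subseteq> W \<Longrightarrow> cls (Poly_Mapping.map ((*) c) p) = c \<odot>\<^bsub>S\<^esub> cls p"
  using lin_mapsD(3)[OF cls, of p c] by simp

lemma cls_single: "cls (Poly_Mapping.single w 1) = m w"
  by (simp add: monomial_def)

lemma zz_star_sum_keys: "J \<subseteq> {..n} \<Longrightarrow> Poly_Mapping.keys (\<Sum>j\<in>J. Poly_Mapping.single [(j, False), (j, True)] (1::complex)) \<subseteq> W"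
  by (intro order.trans[OF Poly_Mapping.keys_sum] UN_least) auto

lemma cls_zz_star_sum:
  assumes "J \<subseteq> {..n}"
  shows "cls (\<Sum>j\<in>J. Poly_Mapping.single [(j, False), (j, True)] 1) = finsum S (\<lambda>j. m [(j, False), (j, True)]) J"
proof -
  have "finite J" using assms finite_subset by blast
  from lin_maps_free_sum[OF cls vS this, of "\<lambda>j. Poly_Mapping.single [(j, False), (j, True)] 1"] assms
  show ?thesis by (auto simp: cls_single)
qed

lemma star_commute:
  assumes "i \<le> n" "j \<le> n" "i \<noteq> j"
  shows "m [(i, True), (j, False)] = complex_of_real q \<odot>\<^bsub>S\<^esub> m [(j, False), (i, True)]"
proof -
  have "cls (Poly_Mapping.single [(i, True), (j, False)] 1) =
      cls (Poly_Mapping.map ((*) (complex_of_real q)) (Poly_Mapping.single [(j, False), (i, True)] 1))"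
    by (rule cls_relation) (use assms in \<open>auto simp: sphere_relations_eq\<close>)
  thus ?thesis
    using assms cls_scale[of "Poly_Mapping.single [(j, False), (i, True)] 1" "complex_of_real q"]
    by (simp add: cls_single del: map_single)
qed

lemma star_commute_last: "m [(n, True), (n, False)] = m [(n, False), (n, True)]"
proof -
  have "cls (Poly_Mapping.single [(n, True), (n, False)] 1) = cls (Poly_Mapping.single [(n, False), (n, True)] 1)"
    by (rule cls_relation) (auto simp: sphere_relations_eq)
  thus ?thesis by (simp add: cls_single)
qed

lemma star_commutator:
  assumes "i < n"
  shows "m [(i, True), (i, False)] = m [(i, False), (i, True)] \<oplus>\<^bsub>S\<^esub>
    complex_of_real (1 - q\<^sup>2) \<odot>\<^bsub>S\<^esub> finsum S (\<lambda>j. m [(j, False), (j, True)]) {i + 1..n}"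
proof -
  let ?a = "Poly_Mapping.single [(i, True), (i, False)] (1::complex)"
  let ?b = "Poly_Mapping.single [(i, False), (i, True)] (1::complex)"
  let ?s = "\<Sum>j = i + 1..n. Poly_Mapping.single [(j, False), (j, True)] (1::complex)"
  have k: "Poly_Mapping.keys ?a \<subseteq> W" "Poly_Mapping.keys ?b \<subseteq> W" "Poly_Mapping.keys ?s \<subseteq> W"
    using assms zz_star_sum_keys[of "{i + 1..n}"] by auto
  have c: "cls ?a = m [(i, True), (i, False)]" "cls ?b = m [(i, False), (i, True)]"
    "cls ?s = finsum S (\<lambda>j. m [(j, False), (j, True)]) {i + 1..n}"
    using cls_zz_star_sum[of "{i + 1..n}"] by (auto simp: cls_single)
  have mc: "m [(i, True), (i, False)] \<in> carrier S" "m [(i, False), (i, True)] \<in> carrier S"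
    using assms by auto
  have "cls (?a - ?b) = cls (Poly_Mapping.map ((*) (complex_of_real (1 - q\<^sup>2))) ?s)"
  proof (rule cls_relation)
    show "?a - ?b - Poly_Mapping.map ((*) (complex_of_real (1 - q\<^sup>2))) ?s \<in> R"
      unfolding sphere_relations_eq
      by (rule UnI1, rule UnI2, rule CollectI, rule exI[of _ i], rule conjI[OF refl assms])
    show "Poly_Mapping.keys (?a - ?b) \<subseteq> W" by (rule order.trans[OF keys_diff Un_least[OF k(1,2)]])
    show "Poly_Mapping.keys (Poly_Mapping.map ((*) (complex_of_real (1 - q\<^sup>2))) ?s) \<subseteq> W"
      by (rule order.trans[OF keys_pm_scale k(3)])
  qed
  hence e: "m [(i, True), (i, False)] \<oplus>\<^bsub>S\<^esub> (- 1) \<odot>\<^bsub>S\<^esub> m [(i, False), (i, True)] =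
      complex_of_real (1 - q\<^sup>2) \<odot>\<^bsub>S\<^esub> finsum S (\<lambda>j. m [(j, False), (j, True)]) {i + 1..n}"
    using lin_maps_free_diff[OF cls k(1,2)] cls_scale[OF k(3)] by (simp only: c)
  have "m [(i, True), (i, False)] = m [(i, False), (i, True)] \<oplus>\<^bsub>S\<^esub>
      (m [(i, True), (i, False)] \<oplus>\<^bsub>S\<^esub> (- 1) \<odot>\<^bsub>S\<^esub> m [(i, False), (i, True)])"
    by (rule vec_add_diff[OF vS mc(2,1), symmetric])
  thus ?thesis unfolding e .
qed

lemma sphere_one: "finsum S (\<lambda>i. m [(i, False), (i, True)]) {0..n} = \<one>\<^bsub>S\<^esub>"
proof -
  have "cls (\<Sum>i = 0..n. Poly_Mapping.single [(i, False), (i, True)] 1) = cls (Poly_Mapping.single [] 1)"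
    by (rule cls_relation) (use zz_star_sum_keys[of "{0..n}"] in \<open>auto simp: sphere_relations_eq\<close>)
  thus ?thesis using cls_zz_star_sum[of "{0..n}"] by (simp add: cls_single m_Nil atLeast0AtMost)
qed

text \<open>The commutator relations are triangular, so the products \<open>z\<^sub>i z\<^sub>i*\<close> are combinations of the
  \<open>z\<^sub>j* z\<^sub>j\<close>; in particular so is the unit.\<close>

lemma zz_star_mem:
  assumes V: "lin_subspace V S" and s: "\<And>i. i \<le> n \<Longrightarrow> m [(i, True), (i, False)] \<in> V"
  shows "i \<le> n \<Longrightarrow> m [(i, False), (i, True)] \<in> V"
proof (induction "n - i" arbitrary: i rule: less_induct)
  case less
  note D = lin_subspaceD[OF vS V]
  show ?case
  proof (cases "i = n")
    case True thus ?thesis using s[of n] star_commute_last by simp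
  next
    case False
    hence i: "i < n" using less by simp
    let ?c = "complex_of_real (1 - q\<^sup>2) \<odot>\<^bsub>S\<^esub> finsum S (\<lambda>j. m [(j, False), (j, True)]) {i + 1..n}"
    have c: "?c \<in> V"
      by (intro D(4) lin_subspace_finsum[OF vS V]) (use less i in auto)
    have "m [(i, False), (i, True)] = m [(i, True), (i, False)] \<oplus>\<^bsub>S\<^esub> (- 1) \<odot>\<^bsub>S\<^esub> ?c"
      unfolding star_commutator[OF i] by (rule vec_add_diff_cancel[OF vS _ D(5)[OF c], symmetric]) (use i in simp)
    thus ?thesis using D(3)[OF s[OF less.prems] D(4)[OF c, of "- 1"]] by simp
  qed
qed

text \<open>Membership in an arbitrary subspace \<open>V\<close> replaces an explicit combination
  with its coefficients. In the applications \<open>V\<close> is a span of products or a preimage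
  under a linear map.\<close>

lemma one_mem_z_zstar:
  assumes "lin_subspace V S" "\<And>i. i \<le> n \<Longrightarrow> m [(i, False), (i, True)] \<in> V"
  shows "\<one>\<^bsub>S\<^esub> \<in> V"
  unfolding sphere_one[symmetric] by (rule lin_subspace_finsum[OF vS assms(1)]) (use assms in auto)

lemma one_mem_zstar_z:
  assumes "lin_subspace V S" "\<And>i. i \<le> n \<Longrightarrow> m [(i, True), (i, False)] \<in> V"
  shows "\<one>\<^bsub>S\<^esub> \<in> V"
  by (rule one_mem_z_zstar[OF assms(1) zz_star_mem[OF assms]])

lemma S_eqI:
  assumes "f \<in> linear_maps S M" "f' \<in> linear_maps S M" "vec M" "\<And>w. w \<in> W \<Longrightarrow> f (m w) = f' (m w)" "x \<in> carrier S"
  shows "f x = f' x"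
proof (rule lin_span_map_eq[OF subsetD[OF m_span assms(5)] assms(1,2) vS assms(3)])
  show "m ` W \<subseteq> carrier S" using m_closed by blast
  show "f s = f' s" if "s \<in> m ` W" for s using that by (elim imageE) (simp only: assms(4))
qed

section \<open>The coaction of the circle algebra on the sphere algebra\<close>

abbreviation "\<delta> \<equiv> sphere_coaction n q"

lemma SC [simp]: "is_star_algebra (tensor S C)" "vec (tensor S C)"
  using is_star_algebra_tensor[OF S circle.H] by auto

text \<open>\<open>presented_hom_graded\<close> for the sphere; both the coaction and the circle
  action are obtained from it.\<close>

lemma sphere_hom:
  assumes "is_star_algebra B" "\<And>k. T k \<in> linear_maps S B"
    "\<And>k j x y. x \<in> carrier S \<Longrightarrow> y \<in> carrier S \<Longrightarrow> T (k + j) (x \<otimes>\<^bsub>S\<^esub> y) = T k x \<otimes>\<^bsub>B\<^esub> T j y"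
    "T 0 \<one>\<^bsub>S\<^esub> = \<one>\<^bsub>B\<^esub>" "\<And>k x. x \<in> carrier S \<Longrightarrow> T (- k) (star S x) = star B (T k x)"
    "\<And>i. i \<in> {..n} \<Longrightarrow> b i = T 1 (presented_gen {..n} R i)"
  shows "presented_hom {..n} R B b \<in> star_alg_hom S B"
    and "w \<in> W \<Longrightarrow> presented_hom {..n} R B b (m w) = T (word_deg w) (m w)"
proof -
  show "presented_hom {..n} R B b \<in> star_alg_hom S B"
    unfolding sphere_alg_def
    by (rule presented_hom_graded(1)[where T = T])
      (rule R_homogeneous assms[unfolded sphere_alg_def] | assumption)+
  show "w \<in> W \<Longrightarrow> presented_hom {..n} R B b (m w) = T (word_deg w) (m w)"
    by (rule presented_hom_graded(2)[where T = T and B = B])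
      (rule R_homogeneous assms[unfolded sphere_alg_def] | assumption)+
qed

text \<open>The graded family is \<open>x \<mapsto> x \<otimes> \<xi>^k\<close>; it is
  multiplicative in \<open>k\<close> and \<open>x\<close> together because \<open>\<xi>\<close> is
  unitary.\<close>

lemma sphere_coaction:
  "\<delta> \<in> star_alg_hom S (tensor S C)"
  "w \<in> W \<Longrightarrow> \<delta> (m w) = tens S C (m w) (\<xi> (word_deg w))"
proof -
  let ?T = "\<lambda>k x. tens S C x (\<xi> k)"
  have lin: "?T k \<in> linear_maps S (tensor S C)" for k
    by (rule tens_bilin(2)[OF S circle.H circle.g_closed])
  have mult: "?T (k + j) (x \<otimes>\<^bsub>S\<^esub> y) = ?T k x \<otimes>\<^bsub>tensor S C\<^esub> ?T j y" if "x \<in> carrier S" "y \<in> carrier S" for k j x y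
    using tens_mult[OF S circle.H that(1) circle.g_closed that(2) circle.g_closed, of k j]
    unfolding circle.g_mult by simp
  have one: "?T 0 \<one>\<^bsub>S\<^esub> = \<one>\<^bsub>tensor S C\<^esub>"
    unfolding tensor_one[OF S circle.H] circle.g_zero ..
  have st: "?T (- k) (star S x) = star (tensor S C) (?T k x)" if "x \<in> carrier S" for k x
    using tens_star[OF S circle.H that circle.g_closed, of k] unfolding circle.g_star by simp
  have b: "tens S C (sphere_gen n q i) xi = ?T 1 (presented_gen {..n} R i)" for i
    by (simp add: sphere_gen_def upow_1)
  show "\<delta> \<in> star_alg_hom S (tensor S C)" "w \<in> W \<Longrightarrow> \<delta> (m w) = tens S C (m w) (\<xi> (word_deg w))"
    unfolding sphere_coaction_def
    by (rule sphere_hom[where T = ?T] SC(1) lin mult one st b; assumption?)+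
qed

end

section \<open>Circle action, homogeneous components and line bundles\<close>

context quantum_sphere
begin

interpretation S: abelian_group S
  by (rule vec_abelian_group[OF vS])

text \<open>The graded family is multiplication by \<open>l powi k\<close>.\<close>

lemma circle_action:
  assumes l: "cmod l = 1"
  shows "circle_action n q l \<in> star_alg_hom S S"
    and "w \<in> W \<Longrightarrow> circle_action n q l (m w) = l powi word_deg w \<odot>\<^bsub>S\<^esub> m w"
proof -
  let ?T = "\<lambda>k x. l powi k \<odot>\<^bsub>S\<^esub> x"
  have l0: "l \<noteq> 0" using l by auto
  \<comment> \<open>On the unit circle conjugation is inversion, which makes the family compatible
    with \<open>star\<close>.\<close>
  have cl: "cnj l = inverse l"
    using l complex_norm_square[of l] l0 by (simp add: field_simps)
  have lin: "?T k \<in> linear_maps S S" for k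
    by (rule lin_maps_smult[OF lin_maps_id vS])
  have mult: "?T (k + j) (x \<otimes>\<^bsub>S\<^esub> y) = ?T k x \<otimes>\<^bsub>S\<^esub> ?T j y" if "x \<in> carrier S" "y \<in> carrier S" for k j x y
    using that l0 by (simp add: power_int_add mult.commute)
  have one: "?T 0 \<one>\<^bsub>S\<^esub> = \<one>\<^bsub>S\<^esub>" by simp
  have st: "?T (- k) (star S x) = star S (?T k x)" if "x \<in> carrier S" for k x
    using that by (simp add: power_int_minus cl power_int_inverse)
  have b: "l \<odot>\<^bsub>S\<^esub> sphere_gen n q i = ?T 1 (presented_gen {..n} R i)" for i
    by (simp add: sphere_gen_def)
  show "circle_action n q l \<in> star_alg_hom S S"
    "w \<in> W \<Longrightarrow> circle_action n q l (m w) = l powi word_deg w \<odot>\<^bsub>S\<^esub> m w"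
    unfolding circle_action_def
    by (rule sphere_hom[where T = ?T] S lin mult one st b; assumption?)+
qed

text \<open>A set of degrees is allowed so that single components, the multiples of \<open>r\<close>
  and the whole algebra are instances of one notion.\<close>

definition degrees :: "int set \<Rightarrow> word_class set" where
  "degrees E = lin_span S (m ` {w \<in> W. word_deg w \<in> E})"

lemma monomials_carrier: "m ` {w \<in> W. word_deg w \<in> E} \<subseteq> carrier S"
  using m_closed by blast

lemma degrees_subspace: "lin_subspace (degrees E) S"
  unfolding degrees_def by (rule lin_span_subspace[OF vS monomials_carrier])

lemma degrees_carrier: "degrees E \<subseteq> carrier S"
  by (rule lin_subspaceD(1)[OF vS degrees_subspace])

lemma degrees_mono: "E \<subseteq> E' \<Longrightarrow> degrees E \<subseteq> degrees E'"
  unfolding degrees_def by (rule lin_span_mono) auto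

lemma degrees_UNIV: "degrees UNIV = carrier S"
  using m_span degrees_carrier[of UNIV] by (auto simp: degrees_def)

lemma m_degrees: "w \<in> W \<Longrightarrow> word_deg w \<in> E \<Longrightarrow> m w \<in> degrees E"
  unfolding degrees_def by (rule lin_span_base) blast

lemma degrees_into:
  assumes "x \<in> degrees E" "f \<in> linear_maps S M" "vec M" "lin_subspace V M"
    "\<And>w. w \<in> W \<Longrightarrow> word_deg w \<in> E \<Longrightarrow> f (m w) \<in> V"
  shows "f x \<in> V"
  by (rule lin_span_map_into[OF assms(1)[unfolded degrees_def] assms(2) vS assms(3) monomials_carrier assms(4)])
    (use assms(5) in blast)

lemma degrees_eq:
  assumes "x \<in> degrees E" "f \<in> linear_maps S M" "f' \<in> linear_maps S M" "vec M"
    "\<And>w. w \<in> W \<Longrightarrow> word_deg w \<in> E \<Longrightarrow> f (m w) = f' (m w)"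
  shows "f x = f' x"
proof (rule lin_span_map_eq[OF assms(1)[unfolded degrees_def] assms(2,3) vS assms(4) monomials_carrier])
  fix s assume "s \<in> m ` {w \<in> W. word_deg w \<in> E}"
  thus "f s = f' s" by (elim imageE CollectE conjE) (simp only: assms(5))
qed

lemma degrees_subalgebra:
  assumes "0 \<in> E" "\<And>a b. a \<in> E \<Longrightarrow> b \<in> E \<Longrightarrow> a + b \<in> E" "\<And>a. a \<in> E \<Longrightarrow> - a \<in> E"
  shows "star_subalgebra (degrees E) S"
  unfolding degrees_def
proof (rule star_subalgebra_lin_span[OF S monomials_carrier])
  show "\<one>\<^bsub>S\<^esub> \<in> m ` {w \<in> W. word_deg w \<in> E}"
    unfolding m_Nil[symmetric] by (rule imageI) (use assms in simp)
  fix x assume "x \<in> m ` {w \<in> W. word_deg w \<in> E}"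
  then obtain w where w: "x = m w" "w \<in> W" "word_deg w \<in> E" by blast
  show "star S x \<in> m ` {w \<in> W. word_deg w \<in> E}"
    unfolding w m_star[OF w(2)] by (rule imageI) (use w assms word_star_words[OF w(2)] in simp)
  fix y assume "y \<in> m ` {w \<in> W. word_deg w \<in> E}"
  then obtain v where v: "y = m v" "v \<in> W" "word_deg v \<in> E" by blast
  show "x \<otimes>\<^bsub>S\<^esub> y \<in> m ` {w \<in> W. word_deg w \<in> E}"
    unfolding w v m_append[OF w(2) v(2), symmetric] by (rule imageI) (use w v assms in simp)
qed

lemma degrees_mult:
  assumes x: "x \<in> degrees E" and y: "y \<in> degrees E'" and E: "\<And>a b. a \<in> E \<Longrightarrow> b \<in> E' \<Longrightarrow> a + b \<in> E''"
  shows "x \<otimes>\<^bsub>S\<^esub> y \<in> degrees E''"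
proof (rule degrees_into[OF x lin_maps_mult_right vS degrees_subspace])
  fix w assume w: "w \<in> W" "word_deg w \<in> E"
  show "m w \<otimes>\<^bsub>S\<^esub> y \<in> degrees E''"
  proof (rule degrees_into[OF y lin_maps_mult_left vS degrees_subspace])
    fix v assume v: "v \<in> W" "word_deg v \<in> E'"
    show "m w \<otimes>\<^bsub>S\<^esub> m v \<in> degrees E''"
      unfolding m_append[OF w(1) v(1), symmetric] by (rule m_degrees) (use w v E in auto)
  qed (use w in auto)
qed (use y degrees_carrier in auto)

text \<open>The projection onto the degrees in \<open>E\<close>, as
  \<open>(id \<otimes> circle_functional E)\<close> after the coaction. It is well defined because
  the coaction is, and so it shows that words of different degrees are independent.\<close>

definition sproj :: "int set \<Rightarrow> word_class \<Rightarrow> word_class" where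
  "sproj E x = tensor_lift S C S (\<lambda>x h. circle_functional E h \<odot>\<^bsub>S\<^esub> x) (\<delta> x)"

lemma sproj:
  "sproj E \<in> linear_maps S S"
  "w \<in> W \<Longrightarrow> sproj E (m w) = (if word_deg w \<in> E then m w else \<zero>\<^bsub>S\<^esub>)"
  "x \<in> carrier S \<Longrightarrow> \<delta> x = tens S C x (\<xi> k) \<Longrightarrow> k \<in> E \<Longrightarrow> sproj E x = x"
proof -
  have b: "bilin S C S (\<lambda>x h. circle_functional E h \<odot>\<^bsub>S\<^esub> x)"
  proof (rule bilinI)
    show "(\<lambda>h. circle_functional E h \<odot>\<^bsub>S\<^esub> x) \<in> linear_maps C S" if "x \<in> carrier S" for x
      by (rule lin_maps_functional[OF circle_functional(1) that vS])
    show "(\<lambda>x. circle_functional E h \<odot>\<^bsub>S\<^esub> x) \<in> linear_maps S S" for h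
      by (rule lin_maps_smult[OF lin_maps_id vS])
  qed
  note L = tensor_lift[OF S circle.H vS b]
  show "sproj E \<in> linear_maps S S"
    using lin_maps_compose[OF star_alg_homD(1)[OF sphere_coaction(1)] L(1)] by (simp add: sproj_def[abs_def])
  show "w \<in> W \<Longrightarrow> sproj E (m w) = (if word_deg w \<in> E then m w else \<zero>\<^bsub>S\<^esub>)"
    unfolding sproj_def
    using L(2)[OF m_closed circle.g_closed, of w "word_deg w"]
    by (simp only: sphere_coaction(2) circle_functional(2)) simp
  show "x \<in> carrier S \<Longrightarrow> \<delta> x = tens S C x (\<xi> k) \<Longrightarrow> k \<in> E \<Longrightarrow> sproj E x = x"
    unfolding sproj_def using L(2)[OF _ circle.g_closed, of x k] by (simp add: circle_functional(2))
qed

lemma sproj_degrees: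
  assumes "x \<in> carrier S"
  shows "sproj E x \<in> degrees E"
proof (rule degrees_into[of x UNIV, OF _ sproj(1) vS degrees_subspace])
  show "sproj E (m w) \<in> degrees E" if "w \<in> W" for w
    using sproj(2)[OF that] m_degrees[OF that] lin_subspaceD(2)[OF vS degrees_subspace] by simp
qed (use assms degrees_UNIV in auto)

lemma sproj_id:
  assumes "x \<in> degrees E"
  shows "sproj E x = x"
  by (rule degrees_eq[OF assms sproj(1) lin_maps_id vS]) (simp add: sproj(2))

lemma sphere_coaction_degrees:
  assumes "x \<in> degrees {k}"
  shows "\<delta> x = tens S C x (\<xi> k)"
  by (rule degrees_eq[OF assms star_alg_homD(1)[OF sphere_coaction(1)] tens_bilin(2)[OF S circle.H circle.g_closed] SC(2)])
    (use sphere_coaction(2) in auto)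

lemma circle_action_degrees:
  assumes "x \<in> degrees {k}" "cmod l = 1"
  shows "circle_action n q l x = l powi k \<odot>\<^bsub>S\<^esub> x"
  by (rule degrees_eq[OF assms(1) star_alg_homD(1)[OF circle_action(1)[OF assms(2)]]
        lin_maps_smult[OF lin_maps_id vS] vS]) (use circle_action(2)[OF assms(2)] in auto)

text \<open>The expansion is stated for all sufficiently large finite index sets, so that the sets
  for two summands can be united. Here \<open>f\<close> enumerates the admissible degrees.\<close>

lemma degrees_decomposition:
  assumes f: "inj f" and x: "x \<in> degrees (range f)"
  shows "\<exists>I0. finite I0 \<and> (\<forall>I. finite I \<longrightarrow> I0 \<subseteq> I \<longrightarrow> finsum S (\<lambda>N. sproj {f N} x) I = x)"
  using x[unfolded degrees_def] vS monomials_carrier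
proof (induction rule: lin_span_induct)
  case (base s)
  then obtain w where w: "s = m w" "w \<in> W" "word_deg w \<in> range f" by blast
  then obtain k where k: "word_deg w = f k" by blast
  have "finsum S (\<lambda>N. sproj {f N} s) I = s" if "finite I" "{k} \<subseteq> I" for I
  proof -
    \<comment> \<open>By injectivity of \<open>f\<close> only the index \<open>k\<close>
      contributes.\<close>
    have "finsum S (\<lambda>N. sproj {f N} s) I = finsum S (\<lambda>N. if k = N then m w else \<zero>\<^bsub>S\<^esub>) I"
      by (rule S.finsum_cong') (use w k f in \<open>auto simp: sproj(2) inj_eq\<close>)
    also have "\<dots> = s" using that w by (simp add: S.add.finprod_singleton)
    finally show ?thesis .
  qed
  thus ?case by (intro exI[of _ "{k}"]) auto
next
  case zero
  have "sproj E \<zero>\<^bsub>S\<^esub> = \<zero>\<^bsub>S\<^esub>" for E by (rule lin_maps_zero[OF sproj(1) vS vS])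
  thus ?case by (intro exI[of _ "{}"]) simp
next
  case (add x y)
  obtain I where I: "finite I" "\<forall>K. finite K \<longrightarrow> I \<subseteq> K \<longrightarrow> finsum S (\<lambda>N. sproj {f N} x) K = x"
    using add(3) by (elim exE conjE)
  obtain J where J: "finite J" "\<forall>K. finite K \<longrightarrow> J \<subseteq> K \<longrightarrow> finsum S (\<lambda>N. sproj {f N} y) K = y"
    using add(4) by (elim exE conjE)
  have "finsum S (\<lambda>N. sproj {f N} (x \<oplus>\<^bsub>S\<^esub> y)) K = x \<oplus>\<^bsub>S\<^esub> y" if "finite K" "I \<union> J \<subseteq> K" for K
  proof -
    note D = lin_mapsD[OF sproj(1)]
    have "finsum S (\<lambda>N. sproj {f N} (x \<oplus>\<^bsub>S\<^esub> y)) K = finsum S (\<lambda>N. sproj {f N} x \<oplus>\<^bsub>S\<^esub> sproj {f N} y) K"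
      using add(1,2) by (simp add: D(2))
    also have "\<dots> = finsum S (\<lambda>N. sproj {f N} x) K \<oplus>\<^bsub>S\<^esub> finsum S (\<lambda>N. sproj {f N} y) K"
      by (rule S.finsum_addf) (use add(1,2) D(1) in auto)
    finally show ?thesis using I J that by simp
  qed
  thus ?case using I(1) J(1) by (intro exI[of _ "I \<union> J"]) auto
next
  case (smult c x)
  obtain I where I: "finite I" "\<forall>K. finite K \<longrightarrow> I \<subseteq> K \<longrightarrow> finsum S (\<lambda>N. sproj {f N} x) K = x"
    using smult(2) by (elim exE conjE)
  have "finsum S (\<lambda>N. sproj {f N} (c \<odot>\<^bsub>S\<^esub> x)) K = c \<odot>\<^bsub>S\<^esub> x" if "finite K" "I \<subseteq> K" for K
  proof -
    note D = lin_mapsD[OF sproj(1)]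
    have "finsum S (\<lambda>N. sproj {f N} (c \<odot>\<^bsub>S\<^esub> x)) K = finsum S (\<lambda>N. c \<odot>\<^bsub>S\<^esub> sproj {f N} x) K"
      using smult(1) by (simp add: D(3))
    also have "\<dots> = c \<odot>\<^bsub>S\<^esub> finsum S (\<lambda>N. sproj {f N} x) K"
      by (rule Module.module.finsum_smult_ldistr[OF vS that(1), symmetric]) (use smult(1) D(1) in auto)
    finally show ?thesis using I that by simp
  qed
  thus ?case using I(1) by (intro exI[of _ I]) auto
qed

text \<open>A word of degree \<open>k\<close> is scaled by the k-th power of \<open>l\<close>, so
  the eigenvalue \<open>l powi (- N)\<close> belongs to degree \<open>- N\<close>. For the converse
  all other components of an eigenvector are shown to vanish.\<close>

lemma line_bundle_eq: "line_bundle n q N = degrees {- N}"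
proof (intro equalityI subsetI)
  fix x assume "x \<in> degrees {- N}"
  thus "x \<in> line_bundle n q N"
    using circle_action_degrees subsetD[OF degrees_carrier] by (auto simp: line_bundle_def circle_group_def)
next
  fix x assume x: "x \<in> line_bundle n q N"
  hence xc: "x \<in> carrier S" by (simp add: line_bundle_def)
  have z: "sproj {k} x = \<zero>\<^bsub>S\<^esub>" if k: "k \<noteq> - N" for k
  proof -
    \<comment> \<open>Chosen such that \<open>l powi (k + N) = - 1\<close>; then the eigenvalues
      \<open>l powi k\<close> and \<open>l powi (- N)\<close> differ.\<close>
    define l where "l = cis (pi / of_int (k + N))"
    have l: "cmod l = 1" by (simp add: l_def)
    hence l0: "l \<noteq> 0" by auto
    have "l powi (k + N) = - 1" using k by (simp add: l_def cis_power_int)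
    hence lk: "l powi k \<noteq> l powi (- N)"
      using l0 by (auto simp: power_int_add power_int_minus field_simps)
    \<comment> \<open>The k-th component of the rotated element can be computed in two ways: by the
      degree \<open>k\<close> of the component, and below by the eigenvalue of
      \<open>x\<close>.\<close>
    have "sproj {k} (circle_action n q l x) = l powi k \<odot>\<^bsub>S\<^esub> sproj {k} x"
    proof (rule S_eqI[OF lin_maps_compose[OF star_alg_homD(1)[OF circle_action(1)[OF l]] sproj(1)]
          lin_maps_smult[OF sproj(1) vS] vS _ xc])
      show "sproj {k} (circle_action n q l (m w)) = l powi k \<odot>\<^bsub>S\<^esub> sproj {k} (m w)" if "w \<in> W" for w
        using that lin_mapsD(3)[OF sproj(1)] by (simp add: circle_action(2)[OF l] sproj(2))
    qed
    moreover have "circle_action n q l x = l powi (- N) \<odot>\<^bsub>S\<^esub> x"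
      using x l by (simp add: line_bundle_def circle_group_def)
    ultimately have e: "l powi k \<odot>\<^bsub>S\<^esub> sproj {k} x = l powi (- N) \<odot>\<^bsub>S\<^esub> sproj {k} x"
      using lin_mapsD(3)[OF sproj(1) xc] by simp
    have sc: "sproj {k} x \<in> carrier S" using lin_mapsD(1)[OF sproj(1) xc] .
    have "(l powi k + - 1 * (l powi (- N))) \<odot>\<^bsub>S\<^esub> sproj {k} x = \<zero>\<^bsub>S\<^esub>"
      unfolding vec_smult_add[OF vS sc] e
      using vec_smult_add[OF vS sc, of "l powi (- N)" "- (l powi (- N))"] sc by simp
    hence "inverse (l powi k - l powi (- N)) \<odot>\<^bsub>S\<^esub> ((l powi k - l powi (- N)) \<odot>\<^bsub>S\<^esub> sproj {k} x) = \<zero>\<^bsub>S\<^esub>"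
      by simp
    thus ?thesis using sc lk by simp
  qed
  have "x \<in> degrees (range (\<lambda>k. k))" using xc degrees_UNIV by simp
  then obtain I0 where I0: "finite I0" "\<And>I. finite I \<Longrightarrow> I0 \<subseteq> I \<Longrightarrow> finsum S (\<lambda>N. sproj {N} x) I = x"
    using degrees_decomposition[of "\<lambda>k. k" x] by auto
  \<comment> \<open>The index \<open>- N\<close> is inserted so that the only surviving component
    certainly occurs in the sum.\<close>
  have "x = finsum S (\<lambda>k. sproj {k} x) (insert (- N) I0)" using I0 by (simp add: subset_insertI)
  also have "\<dots> = finsum S (\<lambda>k. if - N = k then sproj {- N} x else \<zero>\<^bsub>S\<^esub>) (insert (- N) I0)"
    by (rule S.finsum_cong') (use z lin_mapsD(1)[OF sproj(1) xc] in auto)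
  also have "\<dots> = sproj {- N} x"
    using I0(1) lin_mapsD(1)[OF sproj(1) xc] by (subst S.add.finprod_singleton) auto
  finally show "x \<in> degrees {- N}" using sproj_degrees[OF xc] by metis
qed

section \<open>The quantum projective space\<close>

definition projective :: "word_class set" where
  "projective = gen_star_subalgebra S {m [(i, True), (j, False)] | i j. i \<le> n \<and> j \<le> n}"

lemma projective_eq_carrier: "carrier (projective_alg n q) = projective"
proof -
  have "star S (sphere_gen n q i) \<otimes>\<^bsub>S\<^esub> sphere_gen n q j = m [(i, True), (j, False)]" if "i \<le> n" "j \<le> n" for i j
    using that m_append[of "[(i, True)]" "[(j, False)]"] m_star[of "[(i, False)]"]
    by (simp add: sphere_gen_eq word_star_def)
  hence "{star S (sphere_gen n q i) \<otimes>\<^bsub>S\<^esub> sphere_gen n q j | i j. i \<le> n \<and> j \<le> n} =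
      {m [(i, True), (j, False)] | i j. i \<le> n \<and> j \<le> n}"
    by (intro Collect_cong iff_exI iffI; elim conjE; simp)
  thus ?thesis by (simp add: projective_alg_def projective_def)
qed

text \<open>The generators have one letter of each sign, and degree zero is a
  star-subalgebra.\<close>

lemma projective_subset_degrees: "projective \<subseteq> degrees {0}"
  unfolding projective_def
  by (rule gen_star_subalgebra_minimal[OF degrees_subalgebra]) (auto intro!: m_degrees)

lemma projective_subalgebra: "star_subalgebra projective S"
proof -
  show ?thesis
  proof (rule star_subalgebraI[OF S])
    show "lin_subspace projective S"
    proof (rule lin_subspaceI[OF vS])
      show "projective \<subseteq> carrier S" using projective_subset_degrees degrees_carrier by blast
    qed (use star_subalgebraD[OF S] in \<open>auto simp: projective_def gen_star_subalgebra_def\<close>)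
  qed (use star_subalgebraD[OF S] in \<open>auto simp: projective_def gen_star_subalgebra_def\<close>)
qed

lemma zstar_z_projective: "i \<le> n \<Longrightarrow> j \<le> n \<Longrightarrow> m [(i, True), (j, False)] \<in> projective"
  unfolding projective_def gen_star_subalgebra_def by blast

text \<open>For \<open>i \<noteq> j\<close> the product is a multiple of a generator, as
  \<open>q\<close> is invertible; for \<open>i = j\<close> the triangular commutators apply.\<close>

lemma z_zstar_projective:
  assumes "i \<le> n" "j \<le> n"
  shows "m [(i, False), (j, True)] \<in> projective"
proof (cases "i = j")
  case True
  thus ?thesis
    using zz_star_mem[OF star_subalgebraD(1)[OF S projective_subalgebra] zstar_z_projective] assms by auto
next
  case False
  have "m [(i, False), (j, True)] = inverse (complex_of_real q) \<odot>\<^bsub>S\<^esub> m [(j, True), (i, False)]"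
    using star_commute[of j i] assms False q_nonzero by simp
  thus ?thesis using star_subalgebraD(6)[OF S projective_subalgebra] zstar_z_projective assms by simp
qed

lemma pair_projective: "i \<le> n \<Longrightarrow> j \<le> n \<Longrightarrow> m [(i, b), (j, \<not> b)] \<in> projective"
  using zstar_z_projective z_zstar_projective by (cases b) auto

text \<open>The sign \<open>b\<close> selects which of the two expressions of the unit is used, so
  that later arguments treat both orders at once.\<close>

lemma one_mem_pairs:
  assumes V: "lin_subspace V S" and p: "\<And>i. i \<le> n \<Longrightarrow> m [(i, b), (i, \<not> b)] \<in> V"
  shows "\<one>\<^bsub>S\<^esub> \<in> V"
proof (cases b)
  case True thus ?thesis using one_mem_zstar_z[OF V] p by simp
next
  case False thus ?thesis using one_mem_z_zstar[OF V] p by simp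
qed

text \<open>To sandwich a product \<open>x y\<close>, insert between the factors the unit as a combination of the
  \<open>z\<^sub>k* z\<^sub>k\<close> or of the \<open>z\<^sub>k z\<^sub>k*\<close>.\<close>

lemma sandwich_projective:
  assumes x: "x \<in> projective" and ij: "i \<le> n" "j \<le> n"
  shows "m [(i, b)] \<otimes>\<^bsub>S\<^esub> x \<otimes>\<^bsub>S\<^esub> m [(j, \<not> b)] \<in> projective"
proof -
  note P = projective_subalgebra
  note D = star_subalgebraD[OF S P]
  have Pc: "y \<in> carrier S" if "y \<in> projective" for y using that D(2) by blast
  have g [simp]: "m [(i, b)] \<in> carrier S" if "i \<le> n" for i b using that by simp
  have pair: "m [(i, b)] \<otimes>\<^bsub>S\<^esub> m [(j, c)] = m [(i, b), (j, c)]" if "i \<le> n" "j \<le> n" for i j b c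
    using that m_append[of "[(i, b)]" "[(j, c)]"] by simp
  have gs: "star S (m [(i, b)]) = m [(i, \<not> b)]" if "i \<le> n" for i b
    using that m_star[of "[(i, b)]"] by (simp add: word_star_def)
  let ?P = "\<lambda>y. \<forall>i\<le>n. \<forall>j\<le>n. \<forall>b. m [(i, b)] \<otimes>\<^bsub>S\<^esub> y \<otimes>\<^bsub>S\<^esub> m [(j, \<not> b)] \<in> projective"
  \<comment> \<open>The elements that can be enclosed in every way form a star-subalgebra; after
    this only the generators have to be enclosed.\<close>
  let ?B = "{y \<in> carrier S. ?P y}"
  have "star_subalgebra ?B S"
  proof (rule star_subalgebraI[OF S])
    show "lin_subspace ?B S"
    proof (rule lin_subspaceI[OF vS])
      show "\<zero>\<^bsub>S\<^esub> \<in> ?B" using D(8) by simp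
      show "y \<oplus>\<^bsub>S\<^esub> y' \<in> ?B" if "y \<in> ?B" "y' \<in> ?B" for y y'
        using that D(5) by (simp add: star_alg_distrib del: in_lists_conv_set)
      show "c \<odot>\<^bsub>S\<^esub> y \<in> ?B" if "y \<in> ?B" for c y
        using that D(6) by simp
    qed auto
    show "\<one>\<^bsub>S\<^esub> \<in> ?B" using pair pair_projective by simp
    show "star S y \<in> ?B" if y: "y \<in> ?B" for y
    proof -
      have "m [(i, b)] \<otimes>\<^bsub>S\<^esub> star S y \<otimes>\<^bsub>S\<^esub> m [(j, \<not> b)] \<in> projective" if ij: "i \<le> n" "j \<le> n" for i j b
      proof -
        \<comment> \<open>Taking adjoints exchanges the two outer letters and flips their signs, so
          the pattern is kept.\<close>
        have "star S (m [(j, b)] \<otimes>\<^bsub>S\<^esub> y \<otimes>\<^bsub>S\<^esub> m [(i, \<not> b)]) \<in> projective"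
          using y ij by (intro D(7)) auto
        thus ?thesis using y ij by (simp add: gs star_alg_assoc)
      qed
      thus ?thesis using y by simp
    qed
    show "y \<otimes>\<^bsub>S\<^esub> y' \<in> ?B" if y: "y \<in> ?B" and y': "y' \<in> ?B" for y y'
    proof -
      have yc: "y \<in> carrier S" "y' \<in> carrier S" using y y' by auto
      have "m [(i, b)] \<otimes>\<^bsub>S\<^esub> (y \<otimes>\<^bsub>S\<^esub> y') \<otimes>\<^bsub>S\<^esub> m [(j, \<not> b)] \<in> projective" if ij: "i \<le> n" "j \<le> n" for i j b
      proof -
        let ?f = "\<lambda>t. (m [(i, b)] \<otimes>\<^bsub>S\<^esub> y) \<otimes>\<^bsub>S\<^esub> t \<otimes>\<^bsub>S\<^esub> (y' \<otimes>\<^bsub>S\<^esub> m [(j, \<not> b)])"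
        have f: "?f \<in> linear_maps S S"
          by (rule lin_maps_compose[OF lin_maps_mult_left lin_maps_mult_right]) (use yc ij in auto)
        \<comment> \<open>The admissible values of \<open>t\<close> form a subspace. It contains
          each pair of equal indices, as such a pair completes both factors to enclosed elements,
          and hence it contains the unit.\<close>
        have "\<one>\<^bsub>S\<^esub> \<in> {t \<in> carrier S. ?f t \<in> projective}"
        proof (rule one_mem_pairs[where b = "\<not> b", OF lin_subspace_vimage[OF f vS vS D(1)]])
          fix k assume k: "k \<le> n"
          have "(m [(i, b)] \<otimes>\<^bsub>S\<^esub> y \<otimes>\<^bsub>S\<^esub> m [(k, \<not> b)]) \<otimes>\<^bsub>S\<^esub> (m [(k, b)] \<otimes>\<^bsub>S\<^esub> y' \<otimes>\<^bsub>S\<^esub> m [(j, \<not> b)]) \<in> projective"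
            by (rule D(4)) (use y y' ij k in auto)
          thus "m [(k, \<not> b), (k, \<not> \<not> b)] \<in> {t \<in> carrier S. ?f t \<in> projective}"
            using yc ij k by (simp add: pair[symmetric] star_alg_assoc)
        qed
        thus ?thesis using yc ij by (simp add: star_alg_assoc)
      qed
      thus ?thesis using yc by simp
    qed
  qed
  moreover have "m [(k, True), (l, False)] \<in> ?B" if kl: "k \<le> n" "l \<le> n" for k l
  proof -
    have "m [(i, b)] \<otimes>\<^bsub>S\<^esub> m [(k, True), (l, False)] \<otimes>\<^bsub>S\<^esub> m [(j, \<not> b)] \<in> projective" if ij: "i \<le> n" "j \<le> n" for i j b
    proof (cases b)
      case False
      \<comment> \<open>Regrouping the four letters gives a product of two balanced pairs.\<close>
      have "m [(i, False), (k, True)] \<otimes>\<^bsub>S\<^esub> m [(l, False), (j, True)] \<in> projective"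
        by (rule D(4)) (use pair_projective[of i k False] pair_projective[of l j False] ij kl in auto)
      thus ?thesis using ij kl False by (simp add: pair[symmetric] star_alg_assoc)
    next
      case True
      show ?thesis
      proof (cases "k = l")
        case kl': False
        \<comment> \<open>The two middle letters are exchanged, at the cost of a factor
          \<open>q\<close>, before regrouping into balanced pairs.\<close>
        have "m [(i, True), (l, False)] \<otimes>\<^bsub>S\<^esub> m [(k, True), (j, False)] \<in> projective"
          by (rule D(4)) (use pair_projective[of i l True] pair_projective[of k j True] ij kl in auto)
        hence "complex_of_real q \<odot>\<^bsub>S\<^esub> (m [(i, True), (l, False)] \<otimes>\<^bsub>S\<^esub> m [(k, True), (j, False)]) \<in> projective"
          by (rule D(6))
        moreover have "m [(i, True)] \<otimes>\<^bsub>S\<^esub> m [(k, True), (l, False)] \<otimes>\<^bsub>S\<^esub> m [(j, False)] =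
            complex_of_real q \<odot>\<^bsub>S\<^esub> (m [(i, True), (l, False)] \<otimes>\<^bsub>S\<^esub> m [(k, True), (j, False)])"
          unfolding star_commute[OF kl kl'] using ij kl by (simp add: pair[symmetric] star_alg_assoc)
        ultimately show ?thesis using True by simp
      next
        case kl': True
        \<comment> \<open>Equal middle indices do not simply commute; the commutator relation
          expresses the middle pair through pairs in the other order, each of which
          regroups.\<close>
        let ?f = "\<lambda>t. m [(i, True)] \<otimes>\<^bsub>S\<^esub> t \<otimes>\<^bsub>S\<^esub> m [(j, False)]"
        have f: "?f \<in> linear_maps S S"
          by (rule lin_maps_compose[OF lin_maps_mult_left lin_maps_mult_right]) (use ij in auto)
        have fz: "?f (m [(p, False), (p, True)]) \<in> projective" if p: "p \<le> n" for p
        proof -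
          have "m [(i, True), (p, False)] \<otimes>\<^bsub>S\<^esub> m [(p, True), (j, False)] \<in> projective"
            by (rule D(4)) (use pair_projective[of i p True] pair_projective[of p j True] ij p in auto)
          thus ?thesis using ij p by (simp add: pair[symmetric] star_alg_assoc)
        qed
        have sub: "lin_subspace {t \<in> carrier S. ?f t \<in> projective} S"
          by (rule lin_subspace_vimage[OF f vS vS D(1)])
        note SD = lin_subspaceD[OF vS sub]
        have zz: "m [(p, False), (p, True)] \<in> {t \<in> carrier S. ?f t \<in> projective}" if "p \<le> n" for p
          using fz[OF that] that by simp
        have "m [(k, True), (k, False)] \<in> {t \<in> carrier S. ?f t \<in> projective}"
        proof (cases "k = n")
          case True
          thus ?thesis using zz[of n] star_commute_last by simp
        next
          case False
          hence k: "k < n" using kl by simp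
          show ?thesis unfolding star_commutator[OF k]
            by (intro SD(3,4) lin_subspace_finsum[OF vS sub] zz) (use k in auto)
        qed
        thus ?thesis using kl' True by simp
      qed
    qed
    thus ?thesis using kl by simp
  qed
  ultimately have "projective \<subseteq> ?B"
    unfolding projective_def by (intro gen_star_subalgebra_minimal) auto
  thus ?thesis using x ij by auto
qed

end

text \<open>A balanced word whose first and last letters have the same sign has a balanced proper prefix,
  because its partial degrees change sign in steps of length at most one.\<close>

lemma balanced_word_cases:
  assumes "word_deg w = 0" "w \<noteq> []"
  obtains (split) u v where "w = u @ v" "u \<noteq> []" "v \<noteq> []" "word_deg u = 0" "word_deg v = 0"
    | (pair) i j b v where "w = (i, b) # v @ [(j, \<not> b)]" "word_deg v = 0"
proof -
  obtain i b w' where w: "w = (i, b) # w'" using assms(2) by (cases w) auto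
  have "w' \<noteq> []" using assms(1) w by (auto split: if_splits)
  then obtain v j c where w': "w' = v @ [(j, c)]" by (cases w' rule: rev_cases) auto
  show ?thesis
  proof (cases "c = b")
    case False
    hence "c = (\<not> b)" by auto
    thus ?thesis using pair[of i b v j] assms(1) by (auto simp: w w' split: if_splits)
  next
    case True
    \<comment> \<open>The sign normalises the partial degrees such that they begin at
      \<open>- 1\<close>; since the last letter has the same sign as the first, they equal
      \<open>1\<close> just before it.\<close>
    define s :: int where "s = (if b then 1 else - 1)"
    \<comment> \<open>The shift \<open>Suc t\<close> makes every prefix nonempty, and
      \<open>t \<le> length v\<close> leaves at least the last letter for the suffix.\<close>
    define f where "f = (\<lambda>t. s * word_deg (take (Suc t) w))"
    have step: "\<bar>f (t + 1) - f t\<bar> \<le> 1" for t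
    proof (cases "Suc t < length w")
      case True
      have "take (Suc (Suc t)) w = take (Suc t) w @ [w ! Suc t]" by (rule take_Suc_conv_app_nth[OF True])
      thus ?thesis by (cases "w ! Suc t") (auto simp: f_def s_def)
    qed (simp add: f_def)
    have "f 0 \<le> 0" by (simp add: f_def s_def w)
    moreover have "f (length v) = 1"
      using assms(1) True by (auto simp: f_def s_def w w' split: if_splits)
    ultimately obtain t where t: "t \<le> length v" "f t = 0"
      using nat0_intermed_int_val[of "length v" f 0] step by auto
    have "word_deg (take (Suc t) w) = 0" using t by (auto simp: f_def s_def split: if_splits)
    moreover have "word_deg (drop (Suc t) w) = 0"
      using assms(1) calculation word_deg_simps(3)[of "take (Suc t) w" "drop (Suc t) w"] by simp
    ultimately show ?thesis using split[of "take (Suc t) w" "drop (Suc t) w"] t by (simp add: w w')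
  qed
qed

context quantum_sphere
begin

text \<open>By induction over the length: a split word is a product of shorter balanced words, and
  an enclosed one is handled by \<open>sandwich_projective\<close>.\<close>

lemma balanced_projective:
  "w \<in> W \<Longrightarrow> word_deg w = 0 \<Longrightarrow> m w \<in> projective"
proof (induction "length w" arbitrary: w rule: less_induct)
  case less
  note D = star_subalgebraD[OF S projective_subalgebra]
  show ?case
  proof (cases "w = []")
    case True thus ?thesis using D(3) by (simp add: m_Nil)
  next
    case False
    from less.prems(2) False show ?thesis
    proof (cases rule: balanced_word_cases)
      case (split u v)
      have uv: "u \<in> W" "v \<in> W" using less.prems(1) split(1) by auto
      have "m u \<in> projective" "m v \<in> projective" using less.hyps uv split by auto
      thus ?thesis using D(4) uv by (simp add: split(1) m_append)
    next
      case (pair i j b v)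
      have v: "v \<in> W" "i \<le> n" "j \<le> n" using less.prems(1) pair(1) by auto
      have "m v \<in> projective" using less.hyps[of v] v pair by simp
      from sandwich_projective[OF this v(2,3)]
      have "m [(i, b)] \<otimes>\<^bsub>S\<^esub> m v \<otimes>\<^bsub>S\<^esub> m [(j, \<not> b)] \<in> projective" .
      moreover have "m (([(i, b)] @ v) @ [(j, \<not> b)]) = m [(i, b)] \<otimes>\<^bsub>S\<^esub> m v \<otimes>\<^bsub>S\<^esub> m [(j, \<not> b)]"
        using v m_append[of "[(i, b)] @ v" "[(j, \<not> b)]"] m_append[of "[(i, b)]" v] by simp
      ultimately show ?thesis using pair(1) by simp
    qed
  qed
qed

lemma projective_eq: "carrier (projective_alg n q) = degrees {0}"
proof -
  have "degrees {0} \<subseteq> projective"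
    unfolding degrees_def
    by (rule lin_span_minimal[OF star_subalgebraD(1)[OF S projective_subalgebra]])
      (use balanced_projective in blast)
  thus ?thesis using projective_subset_degrees projective_eq_carrier by auto
qed

end

section \<open>The quantum lens space\<close>

context quantum_sphere
begin

definition opposite_products :: "int \<Rightarrow> word_class set" where
  "opposite_products k = lin_span S {x \<otimes>\<^bsub>S\<^esub> y | x y. x \<in> degrees {- k} \<and> y \<in> degrees {k}}"

lemma opposite_products_carrier: "{x \<otimes>\<^bsub>S\<^esub> y | x y. x \<in> degrees {- k} \<and> y \<in> degrees {k}} \<subseteq> carrier S"
  using degrees_carrier by (auto intro!: star_alg_simps(2))

lemma opposite_products_subspace: "lin_subspace (opposite_products k) S"
  unfolding opposite_products_def by (rule lin_span_subspace[OF vS opposite_products_carrier])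

lemma opposite_productsI: "x \<in> degrees {- k} \<Longrightarrow> y \<in> degrees {k} \<Longrightarrow> x \<otimes>\<^bsub>S\<^esub> y \<in> opposite_products k"
  unfolding opposite_products_def by (rule lin_span_base) blast

text \<open>An expression of the unit in \<open>u v\<close> is inserted between \<open>x\<close> and
  \<open>y\<close>; in \<open>(x u) (v y)\<close> the degrees add up on either side.\<close>

lemma one_opposite_products_add:
  assumes a: "\<one>\<^bsub>S\<^esub> \<in> opposite_products a" and b: "\<one>\<^bsub>S\<^esub> \<in> opposite_products b"
  shows "\<one>\<^bsub>S\<^esub> \<in> opposite_products (a + b)"
proof (rule lin_span_map_into[OF a[unfolded opposite_products_def] lin_maps_id vS vS
      opposite_products_carrier opposite_products_subspace])
  fix s assume "s \<in> {x \<otimes>\<^bsub>S\<^esub> y | x y. x \<in> degrees {- a} \<and> y \<in> degrees {a}}"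
  then obtain x y where s: "s = x \<otimes>\<^bsub>S\<^esub> y" "x \<in> degrees {- a}" "y \<in> degrees {a}" by blast
  have c: "x \<in> carrier S" "y \<in> carrier S" using s degrees_carrier by auto
  have "x \<otimes>\<^bsub>S\<^esub> \<one>\<^bsub>S\<^esub> \<otimes>\<^bsub>S\<^esub> y \<in> opposite_products (a + b)"
  proof (rule lin_span_map_into[OF b[unfolded opposite_products_def], where f = "\<lambda>t. x \<otimes>\<^bsub>S\<^esub> t \<otimes>\<^bsub>S\<^esub> y"])
    show "(\<lambda>t. x \<otimes>\<^bsub>S\<^esub> t \<otimes>\<^bsub>S\<^esub> y) \<in> linear_maps S S"
      by (rule lin_maps_compose[OF lin_maps_mult_left lin_maps_mult_right]) (use c in auto)
    fix t assume "t \<in> {x \<otimes>\<^bsub>S\<^esub> y | x y. x \<in> degrees {- b} \<and> y \<in> degrees {b}}"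
    then obtain u v where t: "t = u \<otimes>\<^bsub>S\<^esub> v" "u \<in> degrees {- b}" "v \<in> degrees {b}" by blast
    have c': "u \<in> carrier S" "v \<in> carrier S" using t degrees_carrier by auto
    have "(x \<otimes>\<^bsub>S\<^esub> u) \<otimes>\<^bsub>S\<^esub> (v \<otimes>\<^bsub>S\<^esub> y) \<in> opposite_products (a + b)"
      by (intro opposite_productsI degrees_mult[OF s(2) t(2)] degrees_mult[OF t(3) s(3)]) auto
    thus "x \<otimes>\<^bsub>S\<^esub> t \<otimes>\<^bsub>S\<^esub> y \<in> opposite_products (a + b)"
      using c c' by (simp add: t(1) star_alg_assoc)
  qed (use opposite_products_carrier opposite_products_subspace in auto)
  thus "s \<in> opposite_products (a + b)" using c s by simp
qed

text \<open>A starred letter has degree \<open>- 1\<close>. Pairs with the starred letter on the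
  left therefore give degree \<open>1\<close>, and the other pairs give degree
  \<open>- 1\<close>.\<close>

lemma one_opposite_products_unit: "\<one>\<^bsub>S\<^esub> \<in> opposite_products (if b then 1 else - 1)"
proof (rule one_mem_pairs[where b = b, OF opposite_products_subspace])
  fix i assume i: "i \<le> n"
  have "m ([(i, b)] @ [(i, \<not> b)]) = m [(i, b)] \<otimes>\<^bsub>S\<^esub> m [(i, \<not> b)]" using i by (intro m_append) auto
  moreover have "m [(i, b)] \<otimes>\<^bsub>S\<^esub> m [(i, \<not> b)] \<in> opposite_products (if b then 1 else - 1)"
    by (intro opposite_productsI m_degrees) (use i in auto)
  ultimately show "m [(i, b), (i, \<not> b)] \<in> opposite_products (if b then 1 else - 1)" by simp
qed

lemma one_opposite_products: "\<one>\<^bsub>S\<^esub> \<in> opposite_products k"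
proof (induction k rule: int_induct[where k = 0])
  case base
  show ?case using one_opposite_products_add[of 1 "- 1"] one_opposite_products_unit[of True]
    one_opposite_products_unit[of False] by simp
next
  case (step1 i)
  thus ?case using one_opposite_products_add[of i 1] one_opposite_products_unit[of True] by simp
next
  case (step2 i)
  thus ?case using one_opposite_products_add[of i "- 1"] one_opposite_products_unit[of False] by simp
qed

lemma carrier_lens_alg:
  assumes r: "r > 0"
  shows "carrier (lens_alg n r q) = degrees {k. int r dvd k}"
proof (intro equalityI subsetI)
  fix x assume "x \<in> carrier (lens_alg n r q)"
  then obtain I \<phi> where x: "x = finsum S \<phi> I" "finite I" "\<And>N. N \<in> I \<Longrightarrow> \<phi> N \<in> line_bundle n q (int r * N)"
    by (auto simp: lens_alg_def)
  have "\<phi> N \<in> degrees {k. int r dvd k}" if "N \<in> I" for N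
    using x(3)[OF that] degrees_mono[of "{- (int r * N)}" "{k. int r dvd k}"] by (auto simp: line_bundle_eq)
  thus "x \<in> degrees {k. int r dvd k}"
    unfolding x(1) by (rule lin_subspace_finsum[OF vS degrees_subspace x(2)])
next
  fix x assume x: "x \<in> degrees {k. int r dvd k}"
  \<comment> \<open>The sign comes from \<open>line_bundle_eq\<close>: the bundle with index
    \<open>r N\<close> is the component of degree \<open>- r N\<close>.\<close>
  let ?f = "\<lambda>N. - (int r * N)"
  have "{k. int r dvd k} = range ?f"
    by (auto elim!: dvdE intro: range_eqI[of _ _ "- k" for k])
  moreover have "inj ?f" using r by (auto intro!: injI)
  ultimately obtain I where I: "finite I" "finsum S (\<lambda>N. sproj {?f N} x) I = x"
    using degrees_decomposition[of ?f x] x by auto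
  have "sproj {?f N} x \<in> line_bundle n q (int r * N)" for N
    unfolding line_bundle_eq by (rule sproj_degrees) (use x degrees_carrier in auto)
  thus "x \<in> carrier (lens_alg n r q)"
    using I by (auto simp: lens_alg_def intro!: exI[of _ I] exI[of _ "\<lambda>N. sproj {?f N} x"])
qed

end

section \<open>The lens algebra as a strongly graded comodule algebra\<close>

locale quantum_lens = quantum_sphere +
  fixes r :: nat
  assumes r_pos: "r > 0"
begin

abbreviation "D \<equiv> {k. int r dvd k}"
abbreviation "SL \<equiv> S\<lparr>carrier := degrees D\<rparr>"
abbreviation "L \<equiv> lens_alg n r q"
abbreviation "Q \<equiv> quotient_circle_hopf r"
text \<open>The same algebra as \<open>Q\<close>, but obtained from the circle by changing the
  carrier only, which is the form that the results on tensor products of subalgebras expect.\<close>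

abbreviation "K \<equiv> circle_subalg r"
abbreviation "\<gamma> \<equiv> \<lambda>k. \<xi> (int r * k)"

lemma L_eq: "L = SL"
  using carrier_lens_alg[OF r_pos] by (simp add: lens_alg_def)

lemma lens_subalgebra: "star_subalgebra (degrees D) S"
  by (rule degrees_subalgebra) auto

lemma lens_carrier: "degrees D \<subseteq> carrier S"
  by (rule degrees_carrier)

lemma SL [simp]: "is_star_algebra SL"
  by (rule is_star_algebra_subalgebra[OF S lens_subalgebra])

lemma vSL [simp]: "vec SL"
  using SL by blast

sublocale Q: group_like_basis Q \<gamma> "quotient_coord r"
  by (rule group_like_basis_quotient[OF r_pos])

lemma tensor_LQ: "tensor L Q = tensor SL K" "tens L Q = tens SL K"
  using same_alg_tensor[OF same_alg_refl same_quotient, of SL] by (simp_all add: L_eq)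

abbreviation "lens_monomials \<equiv> m ` {w \<in> W. word_deg w \<in> D}"

lemma lens_monomials_subset: "lens_monomials \<subseteq> degrees D"
  unfolding degrees_def by (rule lin_span_superset)

lemma lens_span: "carrier SL \<subseteq> lin_span SL lens_monomials"
  unfolding lin_span_subalgebra[OF vS degrees_subspace lens_monomials_subset] by (simp add: degrees_def)

lemma lens_retract: "sproj D \<in> linear_maps S SL" "\<forall>x\<in>degrees D. sproj D x = x"
  using lin_maps_corestrict[OF sproj(1) sproj_degrees, of D] sproj_id by auto

lemma \<delta>_lens_linear: "\<delta> \<in> linear_maps SL (tensor S C)"
  by (rule lin_maps_restrict[OF star_alg_homD(1)[OF sphere_coaction(1)] lens_carrier])

lemma lens_coaction_eq: "lens_coaction n r q = corestrict_tensor SL K S C \<delta>"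
  unfolding lens_coaction_def
  by (rule fun_cong[OF same_alg_corestrict_tensor])
    (auto simp: L_eq intro: same_quotient same_alg_refl simp del: circle_hopf_fields)

lemmas core = S circle.H lens_subalgebra circle_sub_star_subalgebra[of r] lens_retract circle_retract[of r]

lemma lens_coaction_degrees:
  assumes x: "x \<in> degrees {int r * k}"
  shows "lens_coaction n r q x = tens L Q x (\<gamma> k)"
proof -
  have xD: "x \<in> degrees D" using x degrees_mono[of "{int r * k}" D] by auto
  show ?thesis
    unfolding lens_coaction_eq tensor_LQ
    by (rule corestrict_tensor_tens[where f = \<delta> and x = x, OF core xD upow_circle_sub sphere_coaction_degrees[OF x]])
qed

lemma \<delta>_lens_monomial:
  assumes "s \<in> lens_monomials"
  shows "\<exists>k. s \<in> degrees {int r * k}"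
proof -
  obtain w where w: "s = m w" "w \<in> W" "int r dvd word_deg w" using assms by blast
  then obtain k where k: "word_deg w = int r * k" by auto
  have "s \<in> degrees {int r * k}" unfolding w(1) by (rule m_degrees[OF w(2)]) (simp add: k)
  thus ?thesis ..
qed

text \<open>The second part recovers the coaction of the sphere from the corestricted one, as
  \<open>component_zero\<close> requires.\<close>

lemma lens_coaction_linear:
  "lens_coaction n r q \<in> linear_maps L (tensor L Q)"
  "x \<in> degrees D \<Longrightarrow> tensor_incl SL K S C (lens_coaction n r q x) = \<delta> x"
proof -
  have S1: "lens_monomials \<subseteq> carrier SL" using lens_monomials_subset by simp
  have S2: "\<exists>a\<in>degrees D. \<exists>b\<in>circle_sub r. \<delta> s = tens S C a b" if s: "s \<in> lens_monomials" for s
  proof -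
    obtain k where k: "s \<in> degrees {int r * k}" using \<delta>_lens_monomial[OF s] by blast
    have "s \<in> degrees D" by (rule subsetD[OF lens_monomials_subset s])
    thus ?thesis using sphere_coaction_degrees[OF k] upow_circle_sub by blast
  qed
  note * = corestrict_tensor[OF core \<delta>_lens_linear vSL S1 lens_span S2]
  show "lens_coaction n r q \<in> linear_maps L (tensor L Q)"
    unfolding lens_coaction_eq tensor_LQ unfolding L_eq by (rule *(1))
  show "x \<in> degrees D \<Longrightarrow> tensor_incl SL K S C (lens_coaction n r q x) = \<delta> x"
    unfolding lens_coaction_eq using *(2) by auto
qed

lemma is_star_algebra_L [simp]: "is_star_algebra L"
  by (simp add: L_eq)

text \<open>The lens monomials span and each has a degree \<open>r k\<close>, where the coaction is
  explicit; multiplicativity becomes addition of degrees.\<close>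

lemma lens_coaction_hom: "lens_coaction n r q \<in> star_alg_hom L (tensor L Q)"
proof (rule star_alg_hom_span[OF is_star_algebra_L is_star_algebra_tensor[OF is_star_algebra_L Q.H] lens_coaction_linear(1)])
  let ?\<delta> = "lens_coaction n r q"
  show "lens_monomials \<subseteq> carrier L" unfolding L_eq using lens_monomials_subset by simp
  show "carrier L \<subseteq> lin_span L lens_monomials" unfolding L_eq by (rule lens_span)
  have o: "\<one>\<^bsub>L\<^esub> = \<one>\<^bsub>S\<^esub>" "star L = star S" "x \<otimes>\<^bsub>L\<^esub> y = x \<otimes>\<^bsub>S\<^esub> y" for x y
    by (simp_all add: L_eq)
  have o1: "\<one>\<^bsub>S\<^esub> \<in> degrees {int r * 0}" unfolding m_Nil[symmetric] by (rule m_degrees) auto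
  show "?\<delta> \<one>\<^bsub>L\<^esub> = \<one>\<^bsub>tensor L Q\<^esub>"
    unfolding tensor_one[OF is_star_algebra_L Q.H] o lens_coaction_degrees[OF o1] Q.g_zero ..
  fix x assume x: "x \<in> lens_monomials"
  then obtain k where k: "x \<in> degrees {int r * k}" using \<delta>_lens_monomial by blast
  have xL: "x \<in> carrier L" using subsetD[OF lens_monomials_subset x] by (simp add: L_eq)
  have "star S x \<in> degrees {int r * (- k)}"
  proof -
    have "star S x \<in> degrees ((\<lambda>a. - a) ` {int r * k})"
    \<comment> \<open>The adjoint is antilinear, so \<open>degrees_into\<close> does not apply and
      the span induction is used.\<close>
    proof (rule lin_span_induct[OF k[unfolded degrees_def] vS monomials_carrier])
      fix s assume "s \<in> m ` {w \<in> W. word_deg w \<in> {int r * k}}"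
      then obtain v where v: "s = m v" "v \<in> W" "word_deg v = int r * k" by blast
      show "star S s \<in> degrees ((\<lambda>a. - a) ` {int r * k})"
        unfolding v(1) m_star[OF v(2)] by (rule m_degrees) (use v word_star_words[OF v(2)] in auto)
    qed (use lin_subspaceD[OF vS degrees_subspace[of "(\<lambda>a. - a) ` {int r * k}"]] in auto)
    thus ?thesis by simp
  qed
  from lens_coaction_degrees[OF this]
  show "?\<delta> (star L x) = star (tensor L Q) (?\<delta> x)"
    unfolding o lens_coaction_degrees[OF k] tens_star[OF is_star_algebra_L Q.H xL Q.g_closed] Q.g_star .
  fix y assume y: "y \<in> lens_monomials"
  then obtain j where j: "y \<in> degrees {int r * j}" using \<delta>_lens_monomial by blast
  have yL: "y \<in> carrier L" using subsetD[OF lens_monomials_subset y] by (simp add: L_eq)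
  have "x \<otimes>\<^bsub>S\<^esub> y \<in> degrees {int r * (k + j)}" by (rule degrees_mult[OF k j]) (auto simp: distrib_left)
  from lens_coaction_degrees[OF this]
  show "?\<delta> (x \<otimes>\<^bsub>L\<^esub> y) = ?\<delta> x \<otimes>\<^bsub>tensor L Q\<^esub> ?\<delta> y"
    unfolding lens_coaction_degrees[OF k] lens_coaction_degrees[OF j]
      tens_mult[OF is_star_algebra_L Q.H xL Q.g_closed yL Q.g_closed] Q.g_mult o .
qed

lemma degrees_lens: "degrees {int r * k} \<subseteq> carrier L"
  unfolding L_eq using degrees_mono[of "{int r * k}" D] by auto

sublocale lens: graded_comodule Q \<gamma> "quotient_coord r" L "lens_coaction n r q"
proof
  show "carrier L \<subseteq> lin_span L (\<Union>k. {a \<in> carrier L. lens_coaction n r q a = tens L Q a (\<gamma> k)})"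
  proof (rule order.trans[OF _ lin_span_mono])
    show "carrier L \<subseteq> lin_span L lens_monomials" unfolding L_eq by (rule lens_span)
    show "lens_monomials \<subseteq> (\<Union>k. {a \<in> carrier L. lens_coaction n r q a = tens L Q a (\<gamma> k)})"
    proof
      fix s assume "s \<in> lens_monomials"
      then obtain k where k: "s \<in> degrees {int r * k}" using \<delta>_lens_monomial by blast
      show "s \<in> (\<Union>k. {a \<in> carrier L. lens_coaction n r q a = tens L Q a (\<gamma> k)})"
        by (rule UN_I[OF UNIV_I], rule CollectI, rule conjI[OF subsetD[OF degrees_lens k] lens_coaction_degrees[OF k]])
    qed
  qed
qed (use lens_coaction_hom in auto)

lemma degrees_component: "degrees {int r * k} \<subseteq> lens.component k"
  using lens_coaction_degrees[of _ k] subsetD[OF degrees_lens] by (simp add: lens.component_def subset_iff)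

text \<open>Degree \<open>k\<close> of the lens algebra contains the sphere degree
  \<open>r k\<close>, so the expression of the unit found in the sphere algebra for
  \<open>r k\<close> is available here.\<close>

sublocale lens: strongly_graded_comodule Q \<gamma> "quotient_coord r" L "lens_coaction n r q"
proof
  fix k
  let ?U = "{x \<otimes>\<^bsub>S\<^esub> y | x y. x \<in> degrees {- (int r * k)} \<and> y \<in> degrees {int r * k}}"
  have U: "?U \<subseteq> {a \<otimes>\<^bsub>L\<^esub> b | a b. a \<in> lens.component (- k) \<and> b \<in> lens.component k}"
    using degrees_component[of k] degrees_component[of "- k"] by (auto simp: L_eq)
  \<comment> \<open>The products have degree zero and thus lie in the lens algebra, so their span is
    the same in both algebras.\<close>
  have "?U \<subseteq> degrees D" by (auto intro!: degrees_mult)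
  hence "lin_span SL ?U = lin_span S ?U" by (rule lin_span_subalgebra[OF vS degrees_subspace])
  hence "\<one>\<^bsub>L\<^esub> \<in> lin_span L ?U"
    using one_opposite_products[of "int r * k"] by (simp add: L_eq opposite_products_def)
  thus "\<one>\<^bsub>L\<^esub> \<in> lin_span L {a \<otimes>\<^bsub>L\<^esub> b | a b. a \<in> lens.component (- k) \<and> b \<in> lens.component k}"
    using lin_span_mono[OF U] by blast
qed

text \<open>Coinvariance under the corestricted coaction is transported along the inclusion of
  tensor products to the coaction of the sphere, where the projection to degree zero then fixes the
  element.\<close>

lemma component_zero: "lens.component 0 = degrees {0}"
proof
  show "degrees {0} \<subseteq> lens.component 0" using degrees_component[of 0] by simp
  show "lens.component 0 \<subseteq> degrees {0}"
  proof
    fix x assume x: "x \<in> lens.component 0"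
    have xD: "x \<in> degrees D" and d: "lens_coaction n r q x = tens SL K x (\<gamma> 0)"
      using lens.componentD[OF x] by (simp_all add: L_eq[symmetric] tensor_LQ) (simp add: L_eq)
    have xc: "x \<in> carrier S" using xD lens_carrier by blast
    have "\<delta> x = tens S C x (\<gamma> 0)"
      using lens_coaction_linear(2)[OF xD] upow_circle_sub[of r 0]
        tensor_incl(2)[OF S circle.H SL lens_carrier is_star_algebra_circle_subalg circle_sub_subset xD, of "\<gamma> 0" r]
      unfolding d by simp
    hence "sproj {0} x = x" using sproj(3)[OF xc, of 0 "{0}"] by simp
    thus "x \<in> degrees {0}" using sproj_degrees[OF xc, of "{0}"] by simp
  qed
qed

text \<open>The cosets cover the whole circle and act through all their representatives, so the
  invariants are those of the full circle, that is, the line bundle with index zero.\<close>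

lemma lens_invariants_eq: "lens_invariants n r q = degrees {0}"
proof -
  have coset: "\<Union> (carrier (quotient_circle_group r)) = {l. cmod l = 1}"
  proof (intro equalityI subsetI)
    fix l assume "l \<in> \<Union> (carrier (quotient_circle_group r))"
    thus "l \<in> {l. cmod l = 1}"
      by (auto simp: quotient_circle_group_def FactGroup_def RCOSETS_def r_coset_def
        circle_group_def roots_of_unity_def norm_mult)
  next
    fix l :: complex assume l: "l \<in> {l. cmod l = 1}"
    have "l \<in> roots_of_unity r #>\<^bsub>circle_group\<^esub> l"
      by (auto simp: r_coset_def roots_of_unity_def circle_group_def intro!: exI[of _ 1])
    thus "l \<in> \<Union> (carrier (quotient_circle_group r))"
      using l by (auto simp: quotient_circle_group_def FactGroup_def RCOSETS_def circle_group_def)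
  qed
  have "lens_invariants n r q = {a \<in> degrees D. \<forall>l. cmod l = 1 \<longrightarrow> circle_action n q l a = a}"
    using coset unfolding lens_invariants_def L_eq by auto
  also have "\<dots> = degrees D \<inter> line_bundle n q 0"
    using lens_carrier by (auto simp: line_bundle_def circle_group_def)
  also have "\<dots> = degrees {0}"
    using degrees_mono[of "{0}" D] by (auto simp: line_bundle_eq)
  finally show ?thesis .
qed

end

theorem proposition4p2:
  fixes n r :: nat and q :: real
  assumes "n \<ge> 1" and "r \<ge> 2" and "0 < q" and "q < 1"
  shows "quantum_principal_bundle (lens_alg n r q) (quotient_circle_hopf r)
           (lens_coaction n r q) (carrier (projective_alg n q))
         \<and> quotient_circle_group r \<cong> circle_group
         \<and> hopf_star_iso (quotient_circle_hopf r) circle_hopf \<noteq> {}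
         \<and> carrier (projective_alg n q) = lens_invariants n r q"
proof -
  interpret quantum_lens n q r
    by unfold_locales (use assms in auto)
  show ?thesis
    using lens.quantum_principal_bundle quotient_circle_group_iso[OF r_pos]
      Q.hopf_star_iso_nonempty[OF group_like_basis_circle]
    by (simp add: component_zero projective_eq lens_invariants_eq)
qed

end
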